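(* Let $Z=(Z_n)_{n\ge1}$ be a RWRE with distribution $\mu$ on environments that is $\kappa$-regular with $\kappa=2$. Then $$\lim_{n\to\infty}\frac{\mathbb{E}[Z_n]-nv}{\sqrt{n\log n}}=0,\qquad\text{and}\qquad\lim_{n\to\infty}\frac{\operatorname{Var}(Z_n)}{n\log n}=b^2+K_0v .$$
   Context: RWRE. Let $\alpha$ be a probability distribution on $[0,1]$ and $\mu=\alpha^{\mathbb{Z}}$ the product law on environments $\omega=(\omega(x))_{x\in\mathbb{Z}}\in[0,1]^{\mathbb{Z}}$. Given $\omega$, the walk $(Z_n)_{n\ge0}$ is the Markov chain on $\mathbb{Z}$ with $Z_0=0$ that jumps from $x$ to $x+1$ with probability $\omega(x)$ and to $x-1$ with probability $1-\omega(x)$. The annealed law of the walk is obtained by averaging over $\omega\sim\mu$; $\mathbb{P},\mathbb{E},\operatorname{Var}$ refer to the annealed law. Let $\rho_0=\frac{1-\omega(0)}{\omega(0)}$ and let $\langle\cdot\rangle$ denote expectation with respect to $\alpha$. The measure $\mu$ is $\kappa$-regular ($\kappa>0$) if $\mu=\alpha^{\mathbb{Z}}$, $\langle\log\rho_0\rangle<0$, the distribution of $\log\rho_0$ is non-lattice, $\langle\rho_0^\kappa\rangle=1$, and $\langle\rho_0^{\kappa+\varepsilon}\rangle<\infty$ for some $\varepsilon>0$. Known constants when $\mu$ is $2$-regular: $v=\frac{1-\langle\rho_0\rangle}{1+\langle\rho_0\rangle}>0$ is the almost sure limit of $Z_n/n$; $b>0$ is the constant such that $\frac{Z_n-nv}{b\sqrt{n\log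 n}}$ converges in distribution (under the annealed law) to a standard Gaussian (Kesten–Kozlov–Spitzer); $K_0>0$ is the constant such that $\lim_{n\to\infty}\sup_{\sqrt n\log^3n\le x\le nv-\log n}\left|\frac{\mathbb{P}(Z_n-nv<-x)}{(nv-x)x^{-2}}-K_0\right|=0$ (Buraczewski–Dyszewski). Here $\log^kn=(\log n)^k$. *)

theory Defs
  imports "HOL-Probability.Probability"
begin

section \<open>Environments\<close>

definition env_law :: "real measure \<Rightarrow> (int \<Rightarrow> real) measure" where
  "env_law \<alpha> = Pi\<^sub>M UNIV (\<lambda>_. \<alpha>)"

text \<open>
  At the two ends of \<open>[0,1]\<close> the ratio \<open>(1 - p) / p\<close> is \<open>\<infinity>\<close> (for \<open>p = 0\<close>) and \<open>0\<close> (for \<open>p = 1\<close>).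
  Since \<open>1 / 0 = 0\<close> for type \<^typ>\<open>real\<close>, the function \<open>rho\<close> has the wrong value at \<open>p = 0\<close>; therefore
  \<open>log_rho\<close> and \<open>rho_moment\<close> treat this point separately. If some moment of positive order is
  finite, then \<open>\<alpha>\<close> has no atom at \<open>0\<close>, and the value of \<open>rho\<close> there is immaterial.
\<close>

definition rho :: "real \<Rightarrow> real" where
  "rho p = (1 - p) / p"

definition log_rho :: "real \<Rightarrow> ereal" where
  "log_rho p = (if p = 0 then \<infinity> else if p = 1 then -\<infinity> else ereal (ln (rho p)))"

definition rho_moment :: "real measure \<Rightarrow> real \<Rightarrow> ennreal" where
  "rho_moment \<alpha> s = (\<integral>\<^sup>+ p. (if p = 0 then \<infinity> else ennreal (rho p powr s)) \<partial>\<alpha>)"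

text \<open>
  Expectation of an extended real function, as the difference of the integrals of its positive and
  negative parts (\<^const>\<open>e2ennreal\<close> truncates negative values to \<open>0\<close>). The value \<open>-\<infinity>\<close> is possible.
  For type \<^typ>\<open>ereal\<close> we have \<open>\<infinity> - \<infinity> = \<infinity>\<close>, so a negative value is never an artefact of an undefined
  expectation.
\<close>

definition ext_expectation :: "'a measure \<Rightarrow> ('a \<Rightarrow> ereal) \<Rightarrow> ereal" where
  "ext_expectation M f =
     enn2ereal (\<integral>\<^sup>+ x. e2ennreal (f x) \<partial>M) - enn2ereal (\<integral>\<^sup>+ x. e2ennreal (- f x) \<partial>M)"

text \<open>
  Non-lattice in the sense of renewal theory: apart from a possible atom at \<open>-\<infinity>\<close>, the
  distribution of \<open>log \<rho>\<^sub>0\<close> is not supported on a discrete subgroup \<open>h\<int>\<close>.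
\<close>

definition nonlattice_log_rho :: "real measure \<Rightarrow> bool" where
  "nonlattice_log_rho \<alpha> \<longleftrightarrow>
     \<not> (\<exists>h>0. AE p in \<alpha>. log_rho p \<noteq> -\<infinity> \<longrightarrow> (\<exists>k::int. log_rho p = ereal (h * of_int k)))"

text \<open>\<open>kappa_regular \<kappa> \<alpha>\<close> says that the product law \<open>env_law \<alpha>\<close> is \<open>\<kappa>\<close>-regular.\<close>

definition kappa_regular :: "real \<Rightarrow> real measure \<Rightarrow> bool" where
  "kappa_regular \<kappa> \<alpha> \<longleftrightarrow>
     \<kappa> > 0 \<and>
     prob_space \<alpha> \<and> sets \<alpha> = sets borel \<and> (AE p in \<alpha>. p \<in> {0..1}) \<and>
     ext_expectation \<alpha> log_rho < 0 \<and>
     nonlattice_log_rho \<alpha> \<and>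
     rho_moment \<alpha> \<kappa> = 1 \<and>
     (\<exists>\<epsilon>>0. rho_moment \<alpha> (\<kappa> + \<epsilon>) < \<infinity>)"

definition speed :: "real measure \<Rightarrow> real" where
  "speed \<alpha> = (1 - (\<integral>p. rho p \<partial>\<alpha>)) / (1 + (\<integral>p. rho p \<partial>\<alpha>))"


section \<open>The walk and its annealed law\<close>

definition step_prob :: "(int \<Rightarrow> real) \<Rightarrow> int \<Rightarrow> int \<Rightarrow> real" where
  "step_prob e x y = (if y = x + 1 then e x else if y = x - 1 then 1 - e x else 0)"

text \<open>Quenched probability, in the environment \<open>e\<close>, that the first \<open>n\<close> steps follow the path \<open>z\<close>.\<close>

definition quenched_path_prob :: "(int \<Rightarrow> real) \<Rightarrow> nat \<Rightarrow> (nat \<Rightarrow> int) \<Rightarrow> real" where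
  "quenched_path_prob e n z = (if z 0 = 0 then \<Prod>i<n. step_prob e (z i) (z (Suc i)) else 0)"

text \<open>
  On the probability space \<open>M\<close>, the environment \<open>\<omega>\<close> has law \<open>env_law \<alpha>\<close>, and given \<open>\<omega>\<close> the process \<open>Z\<close>
  is the Markov chain started at \<open>0\<close> with transition probabilities \<open>step_prob \<omega>\<close>. The last
  condition determines the joint law of \<open>(\<omega>, Z)\<close>; in particular, \<open>Z\<close> has the annealed law under \<open>M\<close>.
\<close>

definition rwre ::
    "real measure \<Rightarrow> 'a measure \<Rightarrow> ('a \<Rightarrow> int \<Rightarrow> real) \<Rightarrow> (nat \<Rightarrow> 'a \<Rightarrow> int) \<Rightarrow> bool" where
  "rwre \<alpha> M \<omega> Z \<longleftrightarrow>
     prob_space M \<and>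
     \<omega> \<in> measurable M (env_law \<alpha>) \<and> distr M (env_law \<alpha>) \<omega> = env_law \<alpha> \<and>
     (\<forall>n. Z n \<in> measurable M (count_space UNIV)) \<and>
     (\<forall>n z. \<forall>A \<in> sets (env_law \<alpha>).
        measure M {m \<in> space M. \<omega> m \<in> A \<and> (\<forall>i\<le>n. Z i m = z i)} =
        (LINT e:A|env_law \<alpha>. quenched_path_prob e n z))"

end

(*
  All that is needed beyond the central limit theorem and the tail asymptotics is uniform integrability of
  (Z_n - nv)^2 / (n log n), away from the far left tail x >= sqrt n log^3 n, which contributes K_0 v.
  It follows by soft arguments. Cut the line into about sqrt n blocks of length about sqrt n, and consider the delays
  T_{jl} - jl/v of the hitting times. Up to an exponentially small backtracking probability the increments of the
  delays are 1-dependent, so a Hoffmann-Jorgensen argument gives q(3y) <= q(y)^2 + (number of blocks) P(one block is slow)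
  for the maximal tail q. One block of length l being slower by z means Z_{n'} < l for some n' of order z, and at this
  extreme end the tail asymptotics for n' give the bound C l / z^2. Tightness, from the central limit theorem, starts the
  recursion. On the left, the slow blocks contribute n log log n in total, which is o(n log n).
*)

theory Submission
  imports Defs "HOL-Real_Asymp.Real_Asymp"
begin

section \<open>Quenched expectations\<close>

text \<open>The block length l, about sqrt n, answers two opposite needs. It is long enough that
  walking back over a whole block, of probability geometric in l, is negligible against any power of
  n; so skipping one block after a stopping index decouples future from past. It is short enough
  that l / v stays below the scale sqrt (n log n). As a block can be at most l / v too fast, large
  jumps exist only on the slow side, and only there do the tail asymptotics enter. The recursion
  passes from y to 3 y because the skipped block costs a second jump: 2 y + 2 z with z = y / 2.
  Along the levels y 3^i the squared term shrinks faster than 9^(-i), the jump term like 9^(-i) /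
  log n. Against the weight 9^i of a second moment the latter leaves 1 / log n per level. From sqrt
  (n log n) to the far left there are O(log log n) levels; up to n there would be order log n, which
  is where K_0 v comes from. The walk is seen through finite words only: quenched expectations are
  recursions over the first step, and hitting times are cut off at a horizon, so no measure on path
  space appears.\<close>

primrec qexp :: "(int \<Rightarrow> real) \<Rightarrow> nat \<Rightarrow> (int list \<Rightarrow> real) \<Rightarrow> int \<Rightarrow> real" where
  "qexp e 0 f x = f [x]"
| "qexp e (Suc n) f x =
     e x * qexp e n (\<lambda>w. f (x # w)) (x + 1) + (1 - e x) * qexp e n (\<lambda>w. f (x # w)) (x - 1)"

text \<open>A word without entry at or above \<open>b\<close> gets its full length. For words with
  at least k + 1 entries, \<open>hit_len b w \<le> k\<close> therefore says that \<open>b\<close> is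
  reached by time k.\<close>

definition hit_len :: "int \<Rightarrow> int list \<Rightarrow> nat" where
  "hit_len b w = length (takeWhile (\<lambda>x. x < b) w)"

lemma qexp_cong:
  assumes "\<And>w. length w = n \<Longrightarrow> f (x # w) = g (x # w)"
  shows "qexp e n f x = qexp e n g x"
  using assms
proof (induction n arbitrary: f g x)
  case (Suc n)
  have "qexp e n (\<lambda>w. f (x # w)) y = qexp e n (\<lambda>w. g (x # w)) y" for y
    by (rule Suc.IH) (simp add: Suc.prems)
  then show ?case by simp
qed simp

lemma qexp_const [simp]: "qexp e n (\<lambda>_. c) x = c"
  by (induction n arbitrary: x) (simp_all add: algebra_simps)

lemma qexp_add: "qexp e n (\<lambda>w. f w + g w) x = qexp e n f x + qexp e n g x"
  by (induction n arbitrary: f g x) (simp_all add: algebra_simps)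

lemma qexp_cmult: "qexp e n (\<lambda>w. c * f w) x = c * qexp e n f x"
  by (induction n arbitrary: f x) (simp_all add: algebra_simps)

lemma qexp_mono:
  assumes "\<And>i. 0 \<le> e i \<and> e i \<le> 1" and "\<And>w. f w \<le> g w"
  shows "qexp e n f x \<le> qexp e n g x"
  using assms(2)
proof (induction n arbitrary: f g x)
  case (Suc n)
  have "qexp e n (\<lambda>w. f (x # w)) y \<le> qexp e n (\<lambda>w. g (x # w)) y" for y
    by (rule Suc.IH) (simp add: Suc.prems)
  then show ?case
    using assms(1)[of x] by (auto intro!: add_mono mult_left_mono)
qed simp

lemma qexp_nonneg:
  assumes "\<And>i. 0 \<le> e i \<and> e i \<le> 1" and "\<And>w. 0 \<le> f w"
  shows "0 \<le> qexp e n f x"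
  using qexp_mono[of e "\<lambda>_. 0" f n x] assms by simp

lemma qexp_le_one:
  assumes "\<And>i. 0 \<le> e i \<and> e i \<le> 1" and "\<And>w. f w \<le> 1"
  shows "qexp e n f x \<le> 1"
  using qexp_mono[of e f "\<lambda>_. 1" n x] assms by simp

lemma qexp_take: "qexp e (n + k) (\<lambda>w. f (take (Suc n) w)) x = qexp e n f x"
proof (induction n arbitrary: f x)
  case 0
  have "qexp e k (\<lambda>w. f (take (Suc 0) w)) x = qexp e k (\<lambda>_. f [x]) x"
    by (rule qexp_cong) simp
  then show ?case by simp
next
  case (Suc n)
  show ?case
    using Suc.IH[of "\<lambda>w. f (x # w)"] by simp
qed

lemma qexp_shift:
  "qexp e n (\<lambda>w. f (map (\<lambda>y. y - b) w)) (x + b) = qexp (\<lambda>i. e (i + b)) n f x"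
proof (induction n arbitrary: f x)
  case (Suc n)
  have "qexp e n (\<lambda>w. f (x # map (\<lambda>y. y - b) w)) (y + b) =
      qexp (\<lambda>i. e (i + b)) n (\<lambda>w. f (x # w)) y" for y
    by (rule Suc.IH)
  from this[of "x + 1"] this[of "x - 1"] show ?case
    by (simp add: algebra_simps)
qed simp

text \<open>The second assumption says that \<open>f\<close> only sees the path up to its first point outside \<open>S\<close>.\<close>

lemma qexp_local:
  assumes "\<And>i. i \<in> S \<Longrightarrow> e i = e' i"
    and "\<And>z u w. \<exists>y\<in>set z. y \<notin> S \<Longrightarrow> f (z @ u) = f (z @ w)"
  shows "qexp e n f x = qexp e' n f x"
  using assms(2)
proof (induction n arbitrary: f x)
  case (Suc n)
  show ?case
  proof (cases "x \<in> S")
    case True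
    have "qexp e n (\<lambda>w. f (x # w)) y = qexp e' n (\<lambda>w. f (x # w)) y" for y
    proof (rule Suc.IH)
      fix z u w assume "\<exists>y\<in>set z. y \<notin> S"
      then show "f (x # z @ u) = f (x # z @ w)"
        using Suc.prems[of "x # z" u w] by auto
    qed
    with True assms(1) show ?thesis by simp
  next
    case False
    have const: "f (x # w) = f [x]" for w
      using Suc.prems[of "[x]" w "[]"] False by simp
    have "qexp e'' (Suc n) f x = qexp e'' (Suc n) (\<lambda>_. f [x]) x" for e''
      by (rule qexp_cong) (rule const)
    then show ?thesis by simp
  qed
qed simp

text \<open>The induction runs over the deadline \<open>k\<close>, by first steps. The horizon k + t
  leaves at least t steps after any hit by time k; \<open>take\<close> discards the surplus, which
  \<open>qexp_take\<close> integrates out. Steps of size one from below make the walk enter at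
  exactly \<open>b\<close>, so the future starts there. The product is exact because the environment
  is fixed.\<close>

lemma qexp_strong_markov:
  assumes "x \<le> b"
  shows "qexp e (k + t) (\<lambda>z. if hit_len b z \<le> k
             then G (takeWhile (\<lambda>y. y < b) z) * H (take (Suc t) (dropWhile (\<lambda>y. y < b) z)) else 0) x =
         qexp e k (\<lambda>z. if hit_len b z \<le> k then G (takeWhile (\<lambda>y. y < b) z) else 0) x * qexp e t H b"
  using assms
proof (induction k arbitrary: G x)
  case 0
  show ?case
  proof (cases "x = b")
    case True
    have "qexp e t (\<lambda>z. if hit_len b z \<le> 0 then G (takeWhile (\<lambda>y. y < b) z) *
        H (take (Suc t) (dropWhile (\<lambda>y. y < b) z)) else 0) b = qexp e t (\<lambda>z. G [] * H z) b"
      by (rule qexp_cong) (simp add: hit_len_def)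
    then show ?thesis
      using True by (simp add: qexp_cmult hit_len_def)
  next
    case False
    then have "x < b" using 0 by simp
    have "qexp e t (\<lambda>z. if hit_len b z \<le> 0 then G (takeWhile (\<lambda>y. y < b) z) *
        H (take (Suc t) (dropWhile (\<lambda>y. y < b) z)) else 0) x = qexp e t (\<lambda>z. 0) x"
      by (rule qexp_cong) (simp add: hit_len_def \<open>x < b\<close>)
    then show ?thesis
      using \<open>x < b\<close> by (simp add: hit_len_def)
  qed
next
  case (Suc k)
  show ?case
  proof (cases "x = b")
    case True
    have "qexp e (Suc k + t) (\<lambda>z. if hit_len b z \<le> Suc k then G (takeWhile (\<lambda>y. y < b) z) *
        H (take (Suc t) (dropWhile (\<lambda>y. y < b) z)) else 0) b =
        qexp e (t + Suc k) (\<lambda>z. G [] * H (take (Suc t) z)) b"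
      unfolding add.commute[of t] by (rule qexp_cong) (simp add: hit_len_def)
    also have "\<dots> = G [] * qexp e t H b"
      by (subst qexp_cmult) (simp only: qexp_take)
    also have "G [] = qexp e (Suc k) (\<lambda>z. G []) b"
      by simp
    also have "\<dots> = qexp e (Suc k) (\<lambda>z. if hit_len b z \<le> Suc k then G (takeWhile (\<lambda>y. y < b) z) else 0) b"
      by (rule qexp_cong) (simp add: hit_len_def)
    finally show ?thesis using True by simp
  next
    case False
    then have "x < b" using Suc.prems by simp
    have "qexp e (k + t) (\<lambda>z. if hit_len b (x # z) \<le> Suc k then G (takeWhile (\<lambda>y. y < b) (x # z)) *
         H (take (Suc t) (dropWhile (\<lambda>y. y < b) (x # z))) else 0) y =
       qexp e k (\<lambda>z. if hit_len b (x # z) \<le> Suc k then G (takeWhile (\<lambda>y. y < b) (x # z)) else 0) y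
         * qexp e t H b" if "y \<le> b" for y
    proof -
      have "takeWhile (\<lambda>y. y < b) (x # z) = x # takeWhile (\<lambda>y. y < b) z"
        "dropWhile (\<lambda>y. y < b) (x # z) = dropWhile (\<lambda>y. y < b) z"
        "hit_len b (x # z) \<le> Suc k \<longleftrightarrow> hit_len b z \<le> k" for z
        using \<open>x < b\<close> by (simp_all add: hit_len_def)
      then show ?thesis
        using Suc.IH[OF that, of "\<lambda>w. G (x # w)"] by (simp only:)
    qed
    note step = this
    have step_up: "x + 1 \<le> b" and step_down: "x - 1 \<le> b"
      using \<open>x < b\<close> by auto
    show ?thesis
      unfolding add_Suc qexp.simps step[OF step_up] step[OF step_down] by (simp only: ring_distribs mult.assoc)
  qed
qed

text \<open>Up to truncation of the sum, the bound is the decreasing harmonic function of the quenched walk.\<close>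

lemma qexp_backtrack:
  fixes r :: int
  assumes e: "\<And>i. 0 < e i \<and> e i \<le> 1" and "- r \<le> x" and "x + int k \<le> t"
  shows "qexp e k (\<lambda>z. of_bool (\<exists>y\<in>set z. y \<le> - r)) x \<le> (\<Sum>j=x..t. \<Prod>i\<in>{-r<..j}. rho (e i))"
  using assms(2,3)
proof (induction k arbitrary: x)
  case 0
  have rho: "0 \<le> rho (e i)" for i
    using e[of i] by (simp add: rho_def)
  show ?case
  proof (cases "x = - r")
    case True
    have "(\<Prod>i\<in>{-r<..x}. rho (e i)) \<le> (\<Sum>j=x..t. \<Prod>i\<in>{-r<..j}. rho (e i))"
      using 0 by (intro member_le_sum[of x "{x..t}"]) (simp_all add: prod_nonneg rho)
    then show ?thesis using True by simp
  next
    case False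
    then have "qexp e 0 (\<lambda>z. of_bool (\<exists>y\<in>set z. y \<le> - r)) x = 0"
      using 0 by simp
    moreover have "0 \<le> (\<Sum>j=x..t. \<Prod>i\<in>{-r<..j}. rho (e i))"
      by (intro sum_nonneg prod_nonneg) (simp add: rho)
    ultimately show ?thesis by simp
  qed
next
  case (Suc k)
  have rho: "0 \<le> rho (e i)" for i
    using e[of i] by (simp add: rho_def)
  let ?c = "\<lambda>j. \<Prod>i\<in>{-r<..j}. rho (e i)"
  let ?u = "\<lambda>x. \<Sum>j=x..t. ?c j"
  show ?case
  proof (cases "x = - r")
    case True
    have "?c x \<le> ?u x"
      using Suc.prems by (intro member_le_sum[of x "{x..t}" ?c]) (simp_all add: prod_nonneg rho)
    moreover have "qexp e (Suc k) (\<lambda>z. of_bool (\<exists>y\<in>set z. y \<le> - r)) x \<le> 1"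
      by (rule qexp_le_one) (simp_all add: e less_imp_le)
    ultimately show ?thesis using True by simp
  next
    case False
    then have x: "- r < x" using Suc.prems by simp
    have up: "?u (x - 1) = ?c (x - 1) + ?u x"
    proof -
      have "{x - 1..t} = insert (x - 1) {x..t}" using Suc.prems by auto
      then show ?thesis by simp
    qed
    \<comment> \<open>The truncation of the sum does not bite here:
      \<open>x + int (Suc k) \<le> t\<close> gives x <= t, so the finite sum behaves like the
      infinite one within the horizon.\<close>
    have down: "?u (x + 1) = ?u x - ?c x"
    proof -
      have "{x..t} = insert x {x + 1..t}" using Suc.prems by auto
      then show ?thesis by simp
    qed
    have c: "?c x = rho (e x) * ?c (x - 1)"
    proof -
      have "{-r<..x} = insert x {-r<..x - 1}" using x by auto
      then show ?thesis by simp
    qed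
    have f: "(\<lambda>w. of_bool (\<exists>y\<in>set (x # w). y \<le> - r) :: real) = (\<lambda>w. of_bool (\<exists>y\<in>set w. y \<le> - r))"
      using x by (intro ext) simp
    have "qexp e (Suc k) (\<lambda>z. of_bool (\<exists>y\<in>set z. y \<le> - r)) x \<le> e x * ?u (x + 1) + (1 - e x) * ?u (x - 1)"
    proof -
      have up_le: "qexp e k (\<lambda>z. of_bool (\<exists>y\<in>set z. y \<le> - r)) (x + 1) \<le> ?u (x + 1)"
        by (rule Suc.IH) (use Suc.prems x in linarith)+
      have down_le: "qexp e k (\<lambda>z. of_bool (\<exists>y\<in>set z. y \<le> - r)) (x - 1) \<le> ?u (x - 1)"
        by (rule Suc.IH) (use Suc.prems x in linarith)+
      have "0 \<le> e x" "0 \<le> 1 - e x"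
        using e[of x] by auto
      then show ?thesis
        unfolding qexp.simps f using up_le down_le by (intro add_mono mult_left_mono)
    qed
    also have "\<dots> = ?u x"
    proof -
      \<comment> \<open>Detailed balance: the summands c satisfy e x * c x = (1 - e x) * c (x - 1),
        which is the harmonicity of the sum.\<close>
      have "e x * rho (e x) = 1 - e x"
        using e[of x] by (simp add: rho_def)
      then have eq: "e x * ?c x = (1 - e x) * ?c (x - 1)"
        by (simp only: c mult.assoc[symmetric])
      have alg: "p * (u - c) + (1 - p) * (d + u) = u" if "p * c = (1 - p) * d" for p u c d :: real
      proof -
        have "p * (u - c) + (1 - p) * (d + u) = u + ((1 - p) * d - p * c)"
          by (simp add: algebra_simps)
        then show ?thesis using that by simp
      qed
      show ?thesis
        unfolding up down by (rule alg[OF eq])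
    qed
    finally show ?thesis .
  qed
qed

section \<open>Quenched expectations as finite sums over nearest neighbour paths\<close>

primrec nn_paths :: "nat \<Rightarrow> int \<Rightarrow> int list set" where
  "nn_paths 0 x = {[x]}"
| "nn_paths (Suc n) x = (#) x ` (nn_paths n (x + 1) \<union> nn_paths n (x - 1))"

lemma finite_nn_paths [simp]: "finite (nn_paths n x)"
  by (induction n arbitrary: x) auto

lemma nn_paths_hd: "w \<in> nn_paths n x \<Longrightarrow> w ! 0 = x"
  by (cases n) auto

lemma nn_paths_length: "w \<in> nn_paths n x \<Longrightarrow> length w = Suc n"
  by (induction n arbitrary: x w) auto

lemma nn_paths_step:
  "w \<in> nn_paths n x \<Longrightarrow> i < n \<Longrightarrow> w ! Suc i = w ! i + 1 \<or> w ! Suc i = w ! i - 1"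
proof (induction n arbitrary: x w i)
  case (Suc n)
  from Suc.prems(1) obtain u y where w: "w = x # u" and y: "y = x + 1 \<or> y = x - 1" and u: "u \<in> nn_paths n y"
    unfolding nn_paths.simps by blast
  show ?case
  proof (cases i)
    case 0
    then show ?thesis using w y nn_paths_hd[OF u] by simp
  next
    case (Suc j)
    then show ?thesis using w Suc.IH[OF u, of j] Suc.prems(2) by simp
  qed
qed simp

text \<open>The bridge between the recursion and the path probabilities by which \<open>rwre\<close>
  specifies the law. A finite sum can be exchanged with the integral over environments.\<close>

lemma qexp_eq_sum:
  "qexp e n f x = (\<Sum>w\<in>nn_paths n x. f w * (\<Prod>i<n. step_prob e (w ! i) (w ! Suc i)))"
proof (induction n arbitrary: f x)
  case (Suc n)
  have disj: "nn_paths n (x + 1) \<inter> nn_paths n (x - 1) = {}"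
    by (auto dest!: nn_paths_hd)
  have part: "(\<Sum>w\<in>nn_paths n y. f (x # w) * (\<Prod>i<Suc n. step_prob e ((x # w) ! i) ((x # w) ! Suc i)))
     = step_prob e x y * qexp e n (\<lambda>w. f (x # w)) y" for y
  proof -
    have "(\<Sum>w\<in>nn_paths n y. f (x # w) * (\<Prod>i<Suc n. step_prob e ((x # w) ! i) ((x # w) ! Suc i)))
        = (\<Sum>w\<in>nn_paths n y. step_prob e x y * (f (x # w) * (\<Prod>i<n. step_prob e (w ! i) (w ! Suc i))))"
      by (rule sum.cong) (simp_all add: prod.lessThan_Suc_shift nn_paths_hd del: prod.lessThan_Suc)
    then show ?thesis by (simp add: Suc.IH sum_distrib_left)
  qed
  have inj: "inj_on ((#) x) A" for A :: "int list set"
    by (rule inj_onI) simp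
  show ?case
    unfolding nn_paths.simps sum.reindex[OF inj] o_def
      sum.union_disjoint[OF finite_nn_paths finite_nn_paths disj] part
    by (simp add: step_prob_def)
qed simp

lemma takeWhile_map_upt:
  assumes "\<not> P (f k)" "\<And>i. i < k \<Longrightarrow> P (f i)"
  shows "takeWhile P (map f [0..<n]) = map f [0..<min k n]"
proof (cases "n \<le> k")
  case True
  then show ?thesis
    by (subst takeWhile_eq_all_conv[THEN iffD2]) (auto intro: assms(2))
next
  case False
  then have "[0..<n] = [0..<k] @ k # [Suc k..<n]"
    by (metis le_add_same_cancel1 not_le_imp_less upt_add_eq_append upt_conv_Cons zero_le less_imp_add_positive nat_less_le)
  then have "takeWhile P (map f [0..<n]) = takeWhile P (map f [0..<k] @ f k # map f [Suc k..<n])"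
    by simp
  also have "\<dots> = map f [0..<k]"
    using assms by (subst takeWhile_append2) auto
  finally show ?thesis
    using False by (simp add: min_def)
qed

section \<open>The annealed walk and decoupling\<close>

text \<open>What the path arguments take from regularity: no atom at 0, and a mean of rho below 1,
  which makes backtracking geometrically unlikely under the annealed law.\<close>

locale rwre_walk =
  fixes \<alpha> :: "real measure"
    and M :: "'a measure"
    and \<omega> :: "'a \<Rightarrow> int \<Rightarrow> real"
    and Z :: "nat \<Rightarrow> 'a \<Rightarrow> int"
  assumes walk: "rwre \<alpha> M \<omega> Z"
    and prob_alpha: "prob_space \<alpha>"
    and sets_alpha [measurable_cong]: "sets \<alpha> = sets borel"
    and AE_alpha: "AE p in \<alpha>. 0 < p \<and> p \<le> 1"
    and integrable_rho: "integrable \<alpha> rho"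
    and mean_rho_less_1: "(\<integral>p. rho p \<partial>\<alpha>) < 1"
begin

sublocale prob_space M
  using walk by (simp add: rwre_def)

sublocale env: prob_space "env_law \<alpha>"
  unfolding env_law_def by (intro prob_space_PiM prob_alpha)

lemma space_alpha: "space \<alpha> = UNIV"
  using sets_eq_imp_space_eq[OF sets_alpha] by simp

lemma space_env: "space (env_law \<alpha>) = UNIV"
  by (simp add: env_law_def space_PiM space_alpha)

lemma AE_env: "AE e in env_law \<alpha>. \<forall>i. 0 < e i \<and> e i \<le> 1"
  unfolding AE_all_countable env_law_def
  by (intro allI AE_PiM_component[of UNIV "\<lambda>_. \<alpha>" _ "\<lambda>p. 0 < p \<and> p \<le> 1"] prob_alpha AE_alpha) simp_all

lemma measurable_coordinate [measurable]: "(\<lambda>e. e i) \<in> borel_measurable (env_law \<alpha>)"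
  unfolding env_law_def
  using measurable_component_singleton[of i UNIV "\<lambda>_. \<alpha>"] measurable_cong_sets[OF refl sets_alpha] by auto

lemma measurable_qexp [measurable]: "(\<lambda>e. qexp e n f x) \<in> borel_measurable (env_law \<alpha>)"
  by (induction n arbitrary: f x) simp_all

lemma measurable_Z [measurable]: "Z n \<in> measurable M (count_space UNIV)"
  using walk by (simp add: rwre_def)

lemma AE_qexp_bounds:
  assumes "\<And>w. 0 \<le> f w" "\<And>w. f w \<le> 1"
  shows "AE e in env_law \<alpha>. 0 \<le> qexp e n f x \<and> qexp e n f x \<le> 1"
  using AE_env by eventually_elim (auto intro!: qexp_nonneg qexp_le_one simp: assms less_imp_le)

lemma integrable_qexp:
  assumes "\<And>w. 0 \<le> f w" "\<And>w. f w \<le> 1"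
  shows "integrable (env_law \<alpha>) (\<lambda>e. qexp e n f x)"
proof (rule env.integrable_const_bound[where B = 1])
  show "AE e in env_law \<alpha>. norm (qexp e n f x) \<le> 1"
    using AE_qexp_bounds[of f n x] assms by auto
qed simp

definition path :: "nat \<Rightarrow> 'a \<Rightarrow> int list" where
  "path n m = map (\<lambda>i. Z i m) [0..<Suc n]"

lemma measurable_map_Z:
  "(\<lambda>m. map (\<lambda>i. Z i m) [k..<n]) \<in> measurable M (count_space UNIV)"
proof (induction n)
  case (Suc n)
  have "(\<lambda>m. (\<lambda>(w, z). if k \<le> n then w @ [z] else []) (map (\<lambda>i. Z i m) [k..<n], Z n m))
      \<in> measurable M (count_space UNIV)"
    using Suc.IH by (intro measurable_compose[OF measurable_Pair, of _ _ "count_space UNIV" _ "count_space UNIV"])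
      (auto simp: pair_measure_countable)
  moreover have "(\<lambda>m. (\<lambda>(w, z). if k \<le> n then w @ [z] else []) (map (\<lambda>i. Z i m) [k..<n], Z n m)) =
      (\<lambda>m. map (\<lambda>i. Z i m) [k..<Suc n])"
    by auto
  ultimately show ?case by simp
qed simp

lemma measurable_path [measurable]: "path n \<in> measurable M (count_space UNIV)"
  unfolding path_def by (rule measurable_map_Z)

lemma length_path [simp]: "length (path n m) = Suc n"
  by (simp add: path_def)

lemma path_nth [simp]: "i \<le> n \<Longrightarrow> path n m ! i = Z i m"
  unfolding path_def by (subst nth_map) (simp_all del: upt_Suc add: less_Suc_eq_le)

lemma prob_path_eq:
  assumes "w \<in> nn_paths n 0"
  shows "\<P>(m in M. path n m = w) = (\<integral>e. (\<Prod>i<n. step_prob e (w ! i) (w ! Suc i)) \<partial>env_law \<alpha>)"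
proof -
  have "path n m = w \<longleftrightarrow> (\<forall>i\<le>n. Z i m = w ! i)" for m
    using nn_paths_length[OF assms] by (auto simp: list_eq_iff_nth_eq less_Suc_eq_le)
  then have "{m \<in> space M. path n m = w} =
      {m \<in> space M. \<omega> m \<in> space (env_law \<alpha>) \<and> (\<forall>i\<le>n. Z i m = (\<lambda>i. w ! i) i)}"
    by (simp add: space_env)
  also have "prob \<dots> = (LINT e:space (env_law \<alpha>)|env_law \<alpha>. quenched_path_prob e n (\<lambda>i. w ! i))"
    using walk sets.top unfolding rwre_def by blast
  also have "\<dots> = (\<integral>e. (\<Prod>i<n. step_prob e (w ! i) (w ! Suc i)) \<partial>env_law \<alpha>)"
    unfolding set_lebesgue_integral_def
    by (rule Bochner_Integration.integral_cong) (simp_all add: quenched_path_prob_def nn_paths_hd[OF assms])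
  finally show ?thesis .
qed

lemma integrable_step_prob:
  "integrable (env_law \<alpha>) (\<lambda>e. (\<Prod>i<n. step_prob e (z i) (z (Suc i))))"
proof (rule env.integrable_const_bound[where B = 1])
  have "(\<lambda>e. step_prob e x y) \<in> borel_measurable (env_law \<alpha>)" for x y
    unfolding step_prob_def by simp
  then show "(\<lambda>e. (\<Prod>i<n. step_prob e (z i) (z (Suc i)))) \<in> borel_measurable (env_law \<alpha>)"
    by (intro borel_measurable_prod)
  show "AE e in env_law \<alpha>. norm (\<Prod>i<n. step_prob e (z i) (z (Suc i))) \<le> 1"
    using AE_env
  proof eventually_elim
    case (elim e)
    then have "0 \<le> step_prob e x y \<and> step_prob e x y \<le> 1" for x y
      by (auto simp: step_prob_def intro: less_imp_le)
    then show ?case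
      by (auto simp: abs_prod intro!: prod_le_1)
  qed
qed

lemma prob_path_in:
  "\<P>(m in M. path n m \<in> nn_paths n 0 \<and> P (path n m)) =
    (\<integral>e. qexp e n (\<lambda>w. of_bool (P w)) 0 \<partial>env_law \<alpha>)"
proof -
  have "{m \<in> space M. path n m \<in> nn_paths n 0 \<and> P (path n m)} =
      (\<Union>w\<in>{w \<in> nn_paths n 0. P w}. {m \<in> space M. path n m = w})"
    by auto
  also have "prob \<dots> = (\<Sum>w\<in>{w \<in> nn_paths n 0. P w}. \<P>(m in M. path n m = w))"
    by (intro finite_measure_finite_Union) (auto simp: disjoint_family_on_def)
  also have "\<dots> = (\<Sum>w\<in>{w \<in> nn_paths n 0. P w}. \<integral>e. (\<Prod>i<n. step_prob e (w ! i) (w ! Suc i)) \<partial>env_law \<alpha>)"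
    by (intro sum.cong prob_path_eq) auto
  also have "\<dots> = (\<integral>e. (\<Sum>w\<in>{w \<in> nn_paths n 0. P w}. (\<Prod>i<n. step_prob e (w ! i) (w ! Suc i))) \<partial>env_law \<alpha>)"
    by (intro Bochner_Integration.integral_sum[symmetric] integrable_step_prob)
  also have "\<dots> = (\<integral>e. qexp e n (\<lambda>w. of_bool (P w)) 0 \<partial>env_law \<alpha>)"
    unfolding qexp_eq_sum
    by (intro Bochner_Integration.integral_cong refl sum.mono_neutral_cong_left) auto
  finally show ?thesis .
qed

lemma AE_path: "AE m in M. path n m \<in> nn_paths n 0"
proof -
  have "\<P>(m in M. path n m \<in> nn_paths n 0) = 1"
    using prob_path_in[of n "\<lambda>_. True"] by (simp add: env.prob_space)
  then show ?thesis
    by (subst (asm) prob_Collect_eq_1) auto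
qed

lemma prob_path:
  "\<P>(m in M. P (path n m)) = (\<integral>e. qexp e n (\<lambda>w. of_bool (P w)) 0 \<partial>env_law \<alpha>)"
  unfolding prob_path_in[symmetric] using AE_path[of n]
  by (intro finite_measure_eq_AE) auto

section \<open>Stationarity and independence of the environment\<close>

lemma env_shift:
  fixes F :: "(int \<Rightarrow> real) \<Rightarrow> real"
  assumes "F \<in> borel_measurable (env_law \<alpha>)"
  shows "(\<integral>e. F (\<lambda>i. e (i + b)) \<partial>env_law \<alpha>) = (\<integral>e. F e \<partial>env_law \<alpha>)"
proof -
  have d: "distr (env_law \<alpha>) (env_law \<alpha>) (\<lambda>e i. e (i + b)) = env_law \<alpha>"
    using distr_PiM_reindex[of UNIV "\<lambda>_. \<alpha>" "\<lambda>i::int. i + b" UNIV] prob_alpha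
    by (simp add: env_law_def restrict_UNIV)
  have m: "(\<lambda>e i. e (i + b)) \<in> measurable (env_law \<alpha>) (env_law \<alpha>)"
    unfolding env_law_def by (rule measurable_PiM_single') (auto simp: space_alpha space_PiM)
  have "(\<integral>e. F e \<partial>env_law \<alpha>) = (\<integral>e. F e \<partial>distr (env_law \<alpha>) (env_law \<alpha>) (\<lambda>e i. e (i + b)))"
    by (simp add: d)
  also have "\<dots> = (\<integral>e. F (\<lambda>i. e (i + b)) \<partial>env_law \<alpha>)"
    by (rule integral_distr[OF m assms])
  finally show ?thesis ..
qed

lemma indep_vars_coordinates: "env.indep_vars (\<lambda>_. \<alpha>) (\<lambda>i e. e i) (UNIV :: int set)"
proof -
  have c: "distr (Pi\<^sub>M UNIV (\<lambda>_. \<alpha>)) \<alpha> (\<lambda>e. e i) = \<alpha>" for i :: int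
    by (rule distr_PiM_component) (auto intro: prob_alpha)
  have m: "(\<lambda>e. e i) \<in> measurable (env_law \<alpha>) \<alpha>" for i :: int
    unfolding env_law_def by simp
  show ?thesis
    using m by (subst env.indep_vars_iff_distr_eq_PiM) (simp_all add: restrict_UNIV env_law_def c distr_id2)
qed

lemma integral_mult_disjoint:
  fixes g h :: "(int \<Rightarrow> real) \<Rightarrow> real"
  assumes [measurable]: "g \<in> borel_measurable (env_law \<alpha>)" "h \<in> borel_measurable (env_law \<alpha>)"
    and int: "integrable (env_law \<alpha>) g" "integrable (env_law \<alpha>) h"
    and local: "\<And>e e'. (\<And>i. i \<in> S \<Longrightarrow> e i = e' i) \<Longrightarrow> g e = g e'"
      "\<And>e e'. (\<And>i. i \<in> T \<Longrightarrow> e i = e' i) \<Longrightarrow> h e = h e'"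
    and "S \<inter> T = {}"
  shows "(\<integral>e. g e * h e \<partial>env_law \<alpha>) = (\<integral>e. g e \<partial>env_law \<alpha>) * (\<integral>e. h e \<partial>env_law \<alpha>)"
proof -
  let ?K = "\<lambda>b. if b then S else T"
  \<comment> \<open>The filling value 1 is arbitrary: by locality it does not change g or h, but it
    turns them into functions of the environment restricted to S or T, to which independence of
    disjoint blocks of coordinates applies.\<close>
  let ?ext = "\<lambda>A e i. if i \<in> A then e i else (1 :: real)"
  have coord: "(\<lambda>e. if i \<in> A then e i else 1) \<in> measurable (PiM A (\<lambda>_. \<alpha>)) \<alpha>" for A and i :: int
    by (cases "i \<in> A") (simp_all add: space_alpha)
  have extend: "?ext A \<in> measurable (PiM A (\<lambda>_. \<alpha>)) (env_law \<alpha>)" for A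
    unfolding env_law_def by (rule measurable_PiM_single') (use coord in \<open>auto simp: space_alpha space_PiM\<close>)
  have "env.indep_vars (\<lambda>j. PiM (?K j) (\<lambda>_. \<alpha>)) (\<lambda>j e. restrict e (?K j)) UNIV"
    using \<open>S \<inter> T = {}\<close>
    by (intro env.indep_vars_restrict[OF indep_vars_coordinates]) (auto simp: disjoint_family_on_def)
  then have "env.indep_vars (\<lambda>_. borel) (\<lambda>j. (\<lambda>e. if j then g (?ext S e) else h (?ext T e)) \<circ> (\<lambda>e. restrict e (?K j))) UNIV"
    using extend by (intro env.indep_vars_compose) (auto split: if_splits)
  moreover have "(\<lambda>j. (\<lambda>e. if j then g (?ext S e) else h (?ext T e)) \<circ> (\<lambda>e. restrict e (?K j))) =
      (\<lambda>j. if j then g else h)"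
    by (intro ext) (auto intro!: local)
  ultimately have "env.indep_vars (\<lambda>_. borel) (\<lambda>j. if j then g else h) UNIV"
    by (simp only:)
  then have "env.indep_vars (\<lambda>_. borel) (\<lambda>j e. (if j then g else h) e) UNIV"
    by simp
  from env.indep_vars_lebesgue_integral[OF _ this] show ?thesis
    using int by (simp add: UNIV_bool mult.commute)
qed


section \<open>The annealed backtracking bound\<close>

lemma integral_prod_rho:
  assumes "finite I"
  shows "integrable (env_law \<alpha>) (\<lambda>e. \<Prod>i\<in>I. rho (e i))"
    and "(\<integral>e. (\<Prod>i\<in>I. rho (e i)) \<partial>env_law \<alpha>) = (\<integral>p. rho p \<partial>\<alpha>) ^ card I"
proof -
  have c: "distr (env_law \<alpha>) \<alpha> (\<lambda>e. e i) = \<alpha>" for i :: int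
    unfolding env_law_def by (rule distr_PiM_component) (auto intro: prob_alpha)
  have m: "(\<lambda>e. e i) \<in> measurable (env_law \<alpha>) \<alpha>" for i :: int
    unfolding env_law_def by simp
  have r: "rho \<in> borel_measurable \<alpha>"
    using integrable_rho by simp
  have int: "integrable (env_law \<alpha>) (\<lambda>e. rho (e i))" for i
    by (rule integrable_distr[OF m]) (simp add: c integrable_rho)
  have eq: "(\<integral>e. rho (e i) \<partial>env_law \<alpha>) = (\<integral>p. rho p \<partial>\<alpha>)" for i
    using integral_distr[OF m r, of i] by (simp add: c)
  have "env.indep_vars (\<lambda>_. borel) (\<lambda>i. rho \<circ> (\<lambda>e. e i)) I"
    by (rule env.indep_vars_compose[OF env.indep_vars_subset[OF indep_vars_coordinates]]) (auto simp: r)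
  then have ind: "env.indep_vars (\<lambda>_. borel) (\<lambda>i e. rho (e i)) I"
    by (simp add: o_def)
  show "integrable (env_law \<alpha>) (\<lambda>e. \<Prod>i\<in>I. rho (e i))"
    by (rule env.indep_vars_integrable[OF assms ind int])
  show "(\<integral>e. (\<Prod>i\<in>I. rho (e i)) \<partial>env_law \<alpha>) = (\<integral>p. rho p \<partial>\<alpha>) ^ card I"
    by (subst env.indep_vars_lebesgue_integral[OF assms ind int]) (simp add: eq)
qed

text \<open>The geometric series of q^(r + j) over j >= 0 with q the mean of rho, that is, the
  annealed value at 0 of the harmonic bound without truncation. It bounds the probability of ever
  going down by r, uniformly in the horizon.\<close>

definition back_bound :: "int \<Rightarrow> real" where
  "back_bound r = (\<integral>p. rho p \<partial>\<alpha>) ^ nat r / (1 - (\<integral>p. rho p \<partial>\<alpha>))"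

lemma mean_rho_nonneg: "0 \<le> (\<integral>p. rho p \<partial>\<alpha>)"
  using AE_alpha by (intro integral_nonneg_AE) (auto simp: rho_def elim: eventually_mono)

lemma back_bound_nonneg: "0 \<le> back_bound r"
  unfolding back_bound_def using mean_rho_nonneg mean_rho_less_1 by simp

lemma qexp_backtrack_annealed:
  assumes "0 \<le> r"
  shows "(\<integral>e. qexp e t (\<lambda>z. of_bool (\<exists>y\<in>set z. y \<le> - r)) 0 \<partial>env_law \<alpha>) \<le> back_bound r"
proof -
  let ?q = "\<integral>p. rho p \<partial>\<alpha>"
  have "(\<integral>e. qexp e t (\<lambda>z. of_bool (\<exists>y\<in>set z. y \<le> - r)) 0 \<partial>env_law \<alpha>)
      \<le> (\<integral>e. (\<Sum>j=0..int t. \<Prod>i\<in>{-r<..j}. rho (e i)) \<partial>env_law \<alpha>)"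
  proof (rule integral_mono_AE)
    show "AE e in env_law \<alpha>. qexp e t (\<lambda>z. of_bool (\<exists>y\<in>set z. y \<le> - r)) 0
        \<le> (\<Sum>j=0..int t. \<Prod>i\<in>{-r<..j}. rho (e i))"
      using AE_env by eventually_elim (rule qexp_backtrack, use assms in auto)
  qed (simp_all add: integrable_qexp integral_prod_rho)
  also have "\<dots> = (\<Sum>j=0..int t. ?q ^ nat (j + r))"
    by (simp add: integral_prod_rho)
  also have "\<dots> = (\<Sum>j<Suc t. ?q ^ nat r * ?q ^ j)"
    using assms by (intro sum.reindex_bij_witness[of _ int nat])
      (auto simp: nat_add_distrib power_add less_Suc_eq_le)
  also have "\<dots> = ?q ^ nat r * ((1 - ?q ^ Suc t) / (1 - ?q))"
    using mean_rho_less_1 by (simp only: sum_distrib_left[symmetric]) (simp add: sum_gp_strict del: sum.lessThan_Suc power_Suc)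
  also have "\<dots> \<le> ?q ^ nat r * (1 / (1 - ?q))"
    using mean_rho_less_1 mean_rho_nonneg by (intro mult_left_mono divide_right_mono) auto
  finally show ?thesis by (simp add: back_bound_def)
qed

section \<open>Hitting times and the almost sure properties of paths\<close>

definition T :: "int \<Rightarrow> 'a \<Rightarrow> nat" where
  "T b m = (LEAST k. b \<le> Z k m)"

lemma measurable_T [measurable]: "T b \<in> measurable M (count_space UNIV)"
  unfolding T_def by measurable

definition before_hit :: "int \<Rightarrow> 'a \<Rightarrow> int list" where
  "before_hit b m = map (\<lambda>i. Z i m) [0..<T b m]"

definition after_hit :: "int \<Rightarrow> nat \<Rightarrow> 'a \<Rightarrow> int list" where
  "after_hit b t m = map (\<lambda>i. Z (T b m + i) m - b) [0..<Suc t]"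

lemma measurable_before_hit [measurable]: "before_hit b \<in> measurable M (count_space UNIV)"
proof -
  have "(\<lambda>m. (\<lambda>k m. map (\<lambda>i. Z i m) [0..<k]) (T b m) m) \<in> measurable M (count_space UNIV)"
    by (rule measurable_compose_countable[OF measurable_map_Z measurable_T])
  then show ?thesis by (simp add: before_hit_def[abs_def])
qed

lemma measurable_after_hit [measurable]: "after_hit b t \<in> measurable M (count_space UNIV)"
proof -
  have eq: "map (\<lambda>i. Z (k + i) m - b) [0..<Suc t] = map (\<lambda>x. x - b) (map (\<lambda>i. Z i m) [k..<k + Suc t])" for k m
    by (rule nth_equalityI) (simp_all del: upt_Suc)
  have "(\<lambda>m. (\<lambda>k m. map (\<lambda>i. Z (k + i) m - b) [0..<Suc t]) (T b m) m) \<in> measurable M (count_space UNIV)"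
    unfolding eq
    by (rule measurable_compose_countable[OF measurable_compose[OF measurable_map_Z] measurable_T]) simp
  then show ?thesis by (simp add: after_hit_def[abs_def])
qed

text \<open>Collects what holds outside one null set, so that the combinatorics of hitting times is
  deterministic. On a path that never reaches \<open>b\<close>, the \<open>LEAST\<close> in
  \<open>T\<close> is an unspecified number; reaching all levels rules this out.\<close>

definition good :: "'a \<Rightarrow> bool" where
  "good m \<longleftrightarrow> (\<forall>n. path n m \<in> nn_paths n 0) \<and> (\<forall>b. \<exists>k. b \<le> Z k m)"

lemma good_Z0:
  assumes "good m"
  shows "Z 0 m = 0"
proof -
  have "path 0 m \<in> nn_paths 0 0"
    using assms unfolding good_def by blast
  then show ?thesis by (simp add: path_def)
qed

lemma good_step: "good m \<Longrightarrow> Z (Suc i) m = Z i m + 1 \<or> Z (Suc i) m = Z i m - 1"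
  using nn_paths_step[of "path (Suc i) m" "Suc i" 0 i] path_nth[of _ "Suc i" m]
  unfolding good_def by (metis le_Suc_eq lessI order_refl)

lemma good_reach: "good m \<Longrightarrow> b \<le> Z (T b m) m"
  unfolding T_def good_def by (metis LeastI_ex)

lemma less_T: "k < T b m \<Longrightarrow> Z k m < b"
  unfolding T_def using not_less_Least[of k "\<lambda>k. b \<le> Z k m"] by auto

lemma T_le: "b \<le> Z k m \<Longrightarrow> T b m \<le> k"
  unfolding T_def by (rule Least_le)

lemma T_mono: "good m \<Longrightarrow> a \<le> b \<Longrightarrow> T a m \<le> T b m"
  using good_reach[of m b] by (intro T_le) simp

lemma takeWhile_map_Z:
  assumes "good m"
  shows "takeWhile (\<lambda>x. x < b) (map (\<lambda>i. Z i m) [0..<n]) = map (\<lambda>i. Z i m) [0..<min (T b m) n]"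
  using good_reach[OF assms, of b] by (intro takeWhile_map_upt) (auto intro: less_T)

lemma hit_len_path: "good m \<Longrightarrow> hit_len b (path n m) = min (T b m) (Suc n)"
  unfolding hit_len_def path_def takeWhile_map_Z by simp

lemma takeWhile_before_hit:
  "good m \<Longrightarrow> a \<le> b \<Longrightarrow> takeWhile (\<lambda>x. x < a) (before_hit b m) = before_hit a m"
  unfolding before_hit_def takeWhile_map_Z using T_mono[of m a b] by (simp add: min_def)

lemma path_split:
  assumes "good m" "T b m \<le> K"
  shows "takeWhile (\<lambda>x. x < b) (path (K + t) m) = before_hit b m"
    and "map (\<lambda>y. y - b) (take (Suc t) (dropWhile (\<lambda>x. x < b) (path (K + t) m))) = after_hit b t m"
proof -
  show tw: "takeWhile (\<lambda>x. x < b) (path (K + t) m) = before_hit b m"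
    using assms unfolding path_def takeWhile_map_Z[OF assms(1)] before_hit_def by (simp add: min_def)
  have "dropWhile (\<lambda>x. x < b) (path (K + t) m) = drop (T b m) (path (K + t) m)"
    unfolding dropWhile_eq_drop tw by (simp add: before_hit_def)
  then show "map (\<lambda>y. y - b) (take (Suc t) (dropWhile (\<lambda>x. x < b) (path (K + t) m))) = after_hit b t m"
    using assms(2) by (intro nth_equalityI) (simp_all add: after_hit_def del: upt_Suc)
qed

end

text \<open>Kept apart from \<open>rwre_walk\<close> because transience is itself derived there,
  from tightness of the walk around n v with v > 0.\<close>

locale transient_rwre = rwre_walk +
  assumes AE_reach: "AE m in M. \<forall>b. \<exists>k. b \<le> Z k m"
begin

lemma AE_good: "AE m in M. good m"
  using AE_reach AE_path by (auto simp: good_def AE_all_countable)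

text \<open>The Markov property is quenched: both factors stand under one integral over the
  environment, since past and future may visit the same sites. Annealed independence has to wait
  until the sites are separated.\<close>

lemma prob_strong_markov:
  assumes "0 \<le> b"
  shows "\<P>(m in M. T b m \<le> K \<and> G (before_hit b m) \<and> H (after_hit b t m)) =
    (\<integral>e. qexp e K (\<lambda>z. of_bool (hit_len b z \<le> K \<and> G (takeWhile (\<lambda>y. y < b) z))) 0 *
         qexp e t (\<lambda>w. of_bool (H (map (\<lambda>y. y - b) w))) b \<partial>env_law \<alpha>)"
proof -
  define P where "P z \<longleftrightarrow> hit_len b z \<le> K \<and> G (takeWhile (\<lambda>y. y < b) z) \<and>
      H (map (\<lambda>y. y - b) (take (Suc t) (dropWhile (\<lambda>x. x < b) z)))" for z
  have "\<P>(m in M. T b m \<le> K \<and> G (before_hit b m) \<and> H (after_hit b t m)) =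
      \<P>(m in M. P (path (K + t) m))"
  proof (rule finite_measure_eq_AE)
    show "AE m in M. m \<in> {m \<in> space M. T b m \<le> K \<and> G (before_hit b m) \<and> H (after_hit b t m)} \<longleftrightarrow>
        m \<in> {m \<in> space M. P (path (K + t) m)}"
      using AE_good
    proof eventually_elim
      case (elim m)
      then show ?case
        using path_split[of m b K t] by (auto simp: P_def hit_len_path)
    qed
  qed measurable
  also have "\<dots> = (\<integral>e. qexp e (K + t) (\<lambda>w. of_bool (P w)) 0 \<partial>env_law \<alpha>)"
    by (rule prob_path)
  also have "\<dots> = (\<integral>e. qexp e K (\<lambda>z. of_bool (hit_len b z \<le> K \<and> G (takeWhile (\<lambda>y. y < b) z))) 0 *
         qexp e t (\<lambda>w. of_bool (H (map (\<lambda>y. y - b) w))) b \<partial>env_law \<alpha>)"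
  proof (rule Bochner_Integration.integral_cong[OF refl])
    fix e
    have P: "(\<lambda>w. of_bool (P w)) = (\<lambda>z. if hit_len b z \<le> K then of_bool (G (takeWhile (\<lambda>y. y < b) z)) *
        of_bool (H (map (\<lambda>y. y - b) (take (Suc t) (dropWhile (\<lambda>y. y < b) z)))) else (0::real))"
      by (auto simp: P_def fun_eq_iff)
    have G: "(\<lambda>z. if hit_len b z \<le> K then of_bool (G (takeWhile (\<lambda>y. y < b) z)) else (0::real)) =
        (\<lambda>z. of_bool (hit_len b z \<le> K \<and> G (takeWhile (\<lambda>y. y < b) z)))"
      by (auto simp: fun_eq_iff)
    show "qexp e (K + t) (\<lambda>w. of_bool (P w)) 0 =
        qexp e K (\<lambda>z. of_bool (hit_len b z \<le> K \<and> G (takeWhile (\<lambda>y. y < b) z))) 0 *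
        qexp e t (\<lambda>w. of_bool (H (map (\<lambda>y. y - b) w))) b"
      unfolding P using qexp_strong_markov[OF assms, of e K t "\<lambda>z. of_bool (G z)" "\<lambda>w. of_bool (H (map (\<lambda>y. y - b) w))"]
      unfolding G by simp
  qed
  finally show ?thesis .
qed

lemma integral_qexp_shift:
  "(\<integral>e. qexp e t (\<lambda>w. of_bool (H (map (\<lambda>y. y - b) w))) b \<partial>env_law \<alpha>) =
   (\<integral>e. qexp e t (\<lambda>w. of_bool (H w)) 0 \<partial>env_law \<alpha>)"
  using env_shift[of "\<lambda>e. qexp e t (\<lambda>w. of_bool (H w)) 0" b]
    qexp_shift[of _ t "\<lambda>w. of_bool (H w)" b 0] by simp

text \<open>Removes the deadline that finite words impose: \<open>T b m\<close> is always a natural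
  number, so the events with deadline K increase to the event itself.\<close>

lemma prob_hit_le_limit:
  assumes "\<And>K. \<P>(m in M. T b m \<le> K \<and> P m) \<le> c"
    and [measurable]: "Measurable.pred M P"
  shows "\<P>(m in M. P m) \<le> c"
proof -
  have "(\<lambda>K. \<P>(m in M. T b m \<le> K \<and> P m)) \<longlonglongrightarrow> prob (\<Union>K. {m \<in> space M. T b m \<le> K \<and> P m})"
    by (rule finite_Lim_measure_incseq) (auto simp: incseq_def)
  also have "(\<Union>K. {m \<in> space M. T b m \<le> K \<and> P m}) = {m \<in> space M. P m}"
    by auto
  finally show ?thesis
    using assms(1) by (intro LIMSEQ_le_const2) auto
qed

text \<open>The quenched factor of the past is at most 1, and the shifted environment has the same
  law. Only this direction is needed to compare increments of delays with the delays from the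
  start.\<close>

lemma prob_after_hit_le:
  assumes "0 \<le> b"
  shows "\<P>(m in M. H (after_hit b t m)) \<le> \<P>(m in M. H (path t m))"
proof (rule prob_hit_le_limit)
  fix K
  have "\<P>(m in M. T b m \<le> K \<and> H (after_hit b t m)) =
     (\<integral>e. qexp e K (\<lambda>z. of_bool (hit_len b z \<le> K \<and> True)) 0 *
         qexp e t (\<lambda>w. of_bool (H (map (\<lambda>y. y - b) w))) b \<partial>env_law \<alpha>)"
    using prob_strong_markov[OF assms, of K "\<lambda>_. True" H t] by simp
  also have "\<dots> \<le> (\<integral>e. qexp e t (\<lambda>w. of_bool (H (map (\<lambda>y. y - b) w))) b \<partial>env_law \<alpha>)"
  proof (rule integral_mono_AE')
    show "integrable (env_law \<alpha>) (\<lambda>e. qexp e t (\<lambda>w. of_bool (H (map (\<lambda>y. y - b) w))) b)"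
      by (rule integrable_qexp) auto
    show "AE e in env_law \<alpha>. qexp e K (\<lambda>z. of_bool (hit_len b z \<le> K \<and> True)) 0 *
         qexp e t (\<lambda>w. of_bool (H (map (\<lambda>y. y - b) w))) b \<le> qexp e t (\<lambda>w. of_bool (H (map (\<lambda>y. y - b) w))) b"
      using AE_qexp_bounds[of "\<lambda>z. of_bool (hit_len b z \<le> K \<and> True)" K 0]
        AE_qexp_bounds[of "\<lambda>w. of_bool (H (map (\<lambda>y. y - b) w))" t b]
      by (auto elim!: eventually_elim2 simp: mult_left_le_one_le)
    show "AE e in env_law \<alpha>. 0 \<le> qexp e t (\<lambda>w. of_bool (H (map (\<lambda>y. y - b) w))) b"
      using AE_qexp_bounds[of "\<lambda>w. of_bool (H (map (\<lambda>y. y - b) w))" t b] by auto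
  qed
  also have "\<dots> = \<P>(m in M. H (path t m))"
    unfolding integral_qexp_shift prob_path ..
  finally show "\<P>(m in M. T b m \<le> K \<and> H (after_hit b t m)) \<le> \<P>(m in M. H (path t m))" .
qed measurable

text \<open>The environment to the left of \<open>a\<close> determines the quenched probability of the past event, and the
  environment to the right of \<open>a\<close> that of the future event without backtracking below \<open>a\<close>.\<close>

lemma prob_decouple:
  assumes "0 \<le> b" "a \<le> b"
  shows "\<P>(m in M. G (before_hit a m) \<and> H (after_hit b t m)) \<le>
    \<P>(m in M. G (before_hit a m)) * \<P>(m in M. H (path t m)) + back_bound (b - a)"
proof (rule prob_hit_le_limit)
  fix K
  define gb where "gb e = qexp e K (\<lambda>z. of_bool (hit_len b z \<le> K \<and> G (takeWhile (\<lambda>y. y < a) z))) 0" for e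
  \<comment> \<open>Replacing the deadline for b by one for the lower level a only enlarges the
    event, and makes it depend on sites to the left of a alone.\<close>
  define g where "g e = qexp e K (\<lambda>z. of_bool (hit_len a z \<le> K \<and> G (takeWhile (\<lambda>y. y < a) z))) 0" for e
  define h where "h e = qexp e t (\<lambda>w. of_bool (H (map (\<lambda>y. y - b) w))) b" for e
  \<comment> \<open>The indicator vanishes as soon as the path steps below a, so sites left of a
    have no influence; the paths lost in this way are counted by h2.\<close>
  define h1 where "h1 e = qexp e t (\<lambda>w. of_bool (H (map (\<lambda>y. y - b) w) \<and> (\<forall>y\<in>set w. a \<le> y))) b" for e
  define h2 where "h2 e = qexp e t (\<lambda>w. of_bool (\<exists>y\<in>set (map (\<lambda>y. y - b) w). y \<le> - (b - a))) b" for e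
  have [measurable]: "g \<in> borel_measurable (env_law \<alpha>)" "h1 \<in> borel_measurable (env_law \<alpha>)"
    "h2 \<in> borel_measurable (env_law \<alpha>)"
    unfolding g_def h1_def h2_def by measurable
  have int: "integrable (env_law \<alpha>) g" "integrable (env_law \<alpha>) h" "integrable (env_law \<alpha>) h1" "integrable (env_law \<alpha>) h2"
    unfolding g_def h_def h1_def h2_def by (rule integrable_qexp; simp)+
  have bounds: "AE e in env_law \<alpha>. 0 \<le> gb e \<and> gb e \<le> g e \<and> g e \<le> 1 \<and> 0 \<le> h1 e \<and> h1 e \<le> h e \<and>
      0 \<le> h2 e \<and> h e \<le> h1 e + h2 e \<and> h1 e \<le> 1"
    using AE_env
  proof eventually_elim
    case (elim e)
    then have e: "0 \<le> e i \<and> e i \<le> 1" for i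
      by (auto intro: less_imp_le)
    have mono: "hit_len a z \<le> hit_len b z" for z
      unfolding hit_len_def using \<open>a \<le> b\<close>
      by (induction z) auto
    have "gb e \<le> g e"
      unfolding gb_def g_def using mono order_trans by (intro qexp_mono e) fastforce
    moreover have "h e \<le> h1 e + h2 e"
      unfolding h_def h1_def h2_def qexp_add[symmetric]
      by (intro qexp_mono e) (force simp: not_le)
    moreover have "h1 e \<le> h e"
      unfolding h_def h1_def by (intro qexp_mono e) auto
    ultimately show ?case
      unfolding gb_def g_def h1_def h2_def by (auto intro!: qexp_nonneg qexp_le_one e)
  qed
  have prod_int: "integrable (env_law \<alpha>) (\<lambda>e. g e * h1 e)"
  proof (rule env.integrable_const_bound[where B = 1])
    show "AE e in env_law \<alpha>. norm (g e * h1 e) \<le> 1"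
      using bounds by eventually_elim (auto intro!: mult_le_one simp: abs_mult)
  qed simp
  have "\<P>(m in M. T b m \<le> K \<and> G (before_hit a m) \<and> H (after_hit b t m)) =
      \<P>(m in M. T b m \<le> K \<and> G (takeWhile (\<lambda>y. y < a) (before_hit b m)) \<and> H (after_hit b t m))"
    using AE_good by (intro finite_measure_eq_AE) (auto simp: takeWhile_before_hit[OF _ \<open>a \<le> b\<close>])
  also have "\<dots> = (\<integral>e. gb e * h e \<partial>env_law \<alpha>)"
  proof -
    have tw: "takeWhile (\<lambda>y. y < a) (takeWhile (\<lambda>y. y < b) z) = takeWhile (\<lambda>y. y < a) z" for z :: "int list"
      using \<open>a \<le> b\<close> by (induction z) auto
    show ?thesis
      using prob_strong_markov[OF \<open>0 \<le> b\<close>, of K "\<lambda>z. G (takeWhile (\<lambda>y. y < a) z)" H t]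
      by (simp add: tw gb_def h_def)
  qed
  also have "\<dots> \<le> (\<integral>e. g e * h1 e + h2 e \<partial>env_law \<alpha>)"
  proof (rule integral_mono_AE')
    show "AE e in env_law \<alpha>. gb e * h e \<le> g e * h1 e + h2 e"
      using bounds
    proof eventually_elim
      case (elim e)
      then have "gb e * h e \<le> g e * (h1 e + h2 e)"
        by (intro mult_mono) auto
      also have "g e * h2 e \<le> 1 * h2 e"
        using elim by (intro mult_right_mono) auto
      then have "g e * (h1 e + h2 e) \<le> g e * h1 e + h2 e"
        by (simp add: algebra_simps)
      finally show ?case .
    qed
    show "AE e in env_law \<alpha>. 0 \<le> g e * h1 e + h2 e"
      using bounds by eventually_elim auto
  qed (use prod_int int in simp)
  also have "\<dots> = (\<integral>e. g e * h1 e \<partial>env_law \<alpha>) + (\<integral>e. h2 e \<partial>env_law \<alpha>)"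
    by (rule Bochner_Integration.integral_add[OF prod_int int(4)])
  also have "(\<integral>e. g e * h1 e \<partial>env_law \<alpha>) = (\<integral>e. g e \<partial>env_law \<alpha>) * (\<integral>e. h1 e \<partial>env_law \<alpha>)"
  proof (rule integral_mult_disjoint[where S = "{..<a}" and T = "{a..}"])
    fix e e' :: "int \<Rightarrow> real"
    assume eq: "\<And>i. i \<in> {..<a} \<Longrightarrow> e i = e' i"
    show "g e = g e'"
      unfolding g_def
    proof (rule qexp_local[OF eq])
      fix z u w :: "int list" assume "\<exists>y\<in>set z. y \<notin> {..<a}"
      then have "takeWhile (\<lambda>y. y < a) (z @ u) = takeWhile (\<lambda>y. y < a) (z @ w)"
        by (auto simp: takeWhile_append1)
      then show "of_bool (hit_len a (z @ u) \<le> K \<and> G (takeWhile (\<lambda>y. y < a) (z @ u))) =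
          (of_bool (hit_len a (z @ w) \<le> K \<and> G (takeWhile (\<lambda>y. y < a) (z @ w))) :: real)"
        by (simp add: hit_len_def)
    qed
  next
    fix e e' :: "int \<Rightarrow> real"
    assume eq: "\<And>i. i \<in> {a..} \<Longrightarrow> e i = e' i"
    show "h1 e = h1 e'"
      unfolding h1_def
    proof (rule qexp_local[OF eq])
      fix z u w :: "int list" assume "\<exists>y\<in>set z. y \<notin> {a..}"
      then show "of_bool (H (map (\<lambda>y. y - b) (z @ u)) \<and> (\<forall>y\<in>set (z @ u). a \<le> y)) =
          (of_bool (H (map (\<lambda>y. y - b) (z @ w)) \<and> (\<forall>y\<in>set (z @ w). a \<le> y)) :: real)"
        by auto
    qed
  qed (use int in auto)
  also have "\<dots> \<le> \<P>(m in M. G (before_hit a m)) * \<P>(m in M. H (path t m))"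
  proof (rule mult_mono)
    have "(\<integral>e. g e \<partial>env_law \<alpha>) = \<P>(m in M. hit_len a (path K m) \<le> K \<and> G (takeWhile (\<lambda>y. y < a) (path K m)))"
      unfolding g_def
      by (rule prob_path[of "\<lambda>z. hit_len a z \<le> K \<and> G (takeWhile (\<lambda>y. y < a) z)" K, symmetric])
    also have "\<dots> \<le> \<P>(m in M. G (before_hit a m))"
    proof (rule finite_measure_mono_AE)
      show "AE m in M. m \<in> {m \<in> space M. hit_len a (path K m) \<le> K \<and> G (takeWhile (\<lambda>y. y < a) (path K m))} \<longrightarrow>
          m \<in> {m \<in> space M. G (before_hit a m)}"
        using AE_good
      proof eventually_elim
        case (elim m)
        then show ?case
          using path_split(1)[of m a K 0] by (auto simp: hit_len_path)
      qed
    qed measurable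
    finally show "(\<integral>e. g e \<partial>env_law \<alpha>) \<le> \<P>(m in M. G (before_hit a m))" .
    have "(\<integral>e. h1 e \<partial>env_law \<alpha>) \<le> (\<integral>e. h e \<partial>env_law \<alpha>)"
      using bounds by (intro integral_mono_AE int) auto
    then show "(\<integral>e. h1 e \<partial>env_law \<alpha>) \<le> \<P>(m in M. H (path t m))"
      unfolding h_def integral_qexp_shift prob_path .
    show "0 \<le> (\<integral>e. h1 e \<partial>env_law \<alpha>)"
      using bounds by (intro integral_nonneg_AE) auto
  qed simp
  also have "(\<integral>e. h2 e \<partial>env_law \<alpha>) \<le> back_bound (b - a)"
    unfolding h2_def integral_qexp_shift[of t "\<lambda>w. \<exists>y\<in>set w. y \<le> - (b - a)"]
    using \<open>a \<le> b\<close> by (intro qexp_backtrack_annealed) simp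
  finally show "\<P>(m in M. T b m \<le> K \<and> G (before_hit a m) \<and> H (after_hit b t m)) \<le>
    \<P>(m in M. G (before_hit a m)) * \<P>(m in M. H (path t m)) + back_bound (b - a)"
    by simp
qed measurable

end

section \<open>Maximal inequalities for block delays\<close>

text \<open>One interface for the slow side, the fast side and both together. Subadditivity is what
  the maximal inequalities use. The last clause says that the truth of y < c x no longer depends on
  x once x exceeds y; so a hitting time may be cut off at a horizon without changing the
  event.\<close>

definition gauge_fun :: "(real \<Rightarrow> real) \<Rightarrow> bool" where
  "gauge_fun c \<longleftrightarrow> c \<in> borel_measurable borel \<and> c 0 = 0 \<and> (\<forall>x y. c (x + y) \<le> c x + c y) \<and>
    (\<forall>x x' y. 0 \<le> y \<longrightarrow> y < x \<longrightarrow> y < x' \<longrightarrow> (y < c x \<longleftrightarrow> y < c x'))"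

lemma gauge_fun_id: "gauge_fun (\<lambda>x. x)"
  and gauge_fun_uminus: "gauge_fun uminus"
  and gauge_fun_abs: "gauge_fun abs"
  by (auto simp: gauge_fun_def)

lemma gauge_fun_add: "gauge_fun c \<Longrightarrow> c (x + y) \<le> c x + c y"
  and gauge_fun_0: "gauge_fun c \<Longrightarrow> c 0 = 0"
  and gauge_fun_cut: "gauge_fun c \<Longrightarrow> 0 \<le> y \<Longrightarrow> y < x \<Longrightarrow> y < x' \<Longrightarrow> y < c x \<longleftrightarrow> y < c x'"
  and gauge_fun_measurable: "gauge_fun c \<Longrightarrow> c \<in> borel_measurable borel"
  unfolding gauge_fun_def by blast+

context transient_rwre
begin

lemma prob_cong_good:
  assumes "\<And>m. good m \<Longrightarrow> P m \<longleftrightarrow> P' m"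
    and [measurable]: "Measurable.pred M P" "Measurable.pred M P'"
  shows "\<P>(m in M. P m) = \<P>(m in M. P' m)"
  using AE_good by (intro finite_measure_eq_AE) (auto elim!: eventually_mono simp: assms(1))

lemma prob_mono_good:
  assumes "\<And>m. m \<in> space M \<Longrightarrow> good m \<Longrightarrow> P m \<Longrightarrow> m \<in> A" and "A \<in> sets M"
  shows "\<P>(m in M. P m) \<le> prob A"
proof (rule finite_measure_mono_AE)
  show "AE m in M. m \<in> {m \<in> space M. P m} \<longrightarrow> m \<in> A"
    using AE_good AE_space by eventually_elim (auto intro: assms(1))
qed (rule assms(2))

lemma good_T_0: "good m \<Longrightarrow> T 0 m = 0"
  using T_le[of 0 0 m] good_Z0 by simp

lemma hit_len_before_hit: "good m \<Longrightarrow> a \<le> b \<Longrightarrow> hit_len a (before_hit b m) = T a m"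
  unfolding hit_len_def takeWhile_before_hit by (simp add: before_hit_def)

lemma hit_len_after_hit:
  assumes "good m" "0 \<le> c"
  shows "hit_len c (after_hit b t m) = min (T (b + c) m - T b m) (Suc t)"
proof -
  have le: "T b m \<le> T (b + c) m"
    using assms by (intro T_mono) auto
  have "takeWhile (\<lambda>x. x < c) (after_hit b t m) =
      map (\<lambda>i. Z (T b m + i) m - b) [0..<min (T (b + c) m - T b m) (Suc t)]"
    unfolding after_hit_def
  proof (rule takeWhile_map_upt)
    show "\<not> Z (T b m + (T (b + c) m - T b m)) m - b < c"
      using le good_reach[OF assms(1), of "b + c"] by simp
    show "Z (T b m + i) m - b < c" if "i < T (b + c) m - T b m" for i
    proof -
      have "T b m + i < T (b + c) m" using that by simp
      from less_T[OF this] show ?thesis by simp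
    qed
  qed
  then show ?thesis by (simp add: hit_len_def)
qed

section \<open>Block delays as functionals of finite paths\<close>

definition delay :: "real \<Rightarrow> nat \<Rightarrow> nat \<Rightarrow> 'a \<Rightarrow> real" where
  "delay \<mu> l j m = real (T (int (j * l)) m) - real (j * l) * \<mu>"

lemma measurable_delay [measurable]: "delay \<mu> l j \<in> borel_measurable M"
  unfolding delay_def
  by (intro borel_measurable_diff borel_measurable_const measurable_compose[OF measurable_T]) simp

lemma delay_0: "good m \<Longrightarrow> delay \<mu> l 0 m = 0"
  by (simp add: delay_def good_T_0)

lemma delay_diff:
  assumes "good m"
  shows "delay \<mu> l (i + k) m - delay \<mu> l i m =
    real (T (int (i * l) + int (k * l)) m - T (int (i * l)) m) - real (k * l) * \<mu>"
  using T_mono[OF assms, of "int (i * l)" "int (i * l) + int (k * l)"]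
  by (simp add: delay_def of_nat_diff algebra_simps)

text \<open>The horizon is so late that a hitting time cut off there is still above y after
  centring, as is the true one. This is the situation of \<open>gauge_fun_cut\<close>.\<close>

lemma delay_horizon:
  assumes "finite S"
  obtains t :: nat where "\<And>k. k \<in> S \<Longrightarrow> real (k * l) * \<mu> + y < real (Suc t)"
proof -
  have "\<exists>t. \<forall>k\<in>S. real (k * l) * \<mu> + y < real (Suc t)"
    using assms
  proof (induction S)
    case (insert j S)
    then obtain t where t: "\<forall>k\<in>S. real (k * l) * \<mu> + y < real (Suc t)" by blast
    obtain u where "real (j * l) * \<mu> + y < real u"
      using reals_Archimedean2 by blast
    then show ?case
      using t by (intro exI[of _ "t + u"]) fastforce
  qed simp
  then show ?thesis using that by blast
qed

lemma list_event_after_hit: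
  assumes "gauge_fun c" "0 \<le> y" "good m"
    and t: "\<And>k. k \<in> S \<Longrightarrow> real (k * l) * \<mu> + y < real (Suc t)"
  shows "(\<exists>k\<in>S. y < c (real (hit_len (int (k * l)) (after_hit (int (i * l)) t m)) - real (k * l) * \<mu>)) \<longleftrightarrow>
      (\<exists>k\<in>S. y < c (delay \<mu> l (i + k) m - delay \<mu> l i m))"
proof (rule bex_cong[OF refl])
  fix k assume "k \<in> S"
  let ?\<Delta> = "T (int (i * l) + int (k * l)) m - T (int (i * l)) m"
  show "y < c (real (hit_len (int (k * l)) (after_hit (int (i * l)) t m)) - real (k * l) * \<mu>) \<longleftrightarrow>
      y < c (delay \<mu> l (i + k) m - delay \<mu> l i m)"
  proof (cases "?\<Delta> \<le> Suc t")
    case True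
    then show ?thesis
      by (simp only: delay_diff[OF assms(3)] hit_len_after_hit[OF assms(3)] of_nat_0_le_iff min_absorb1)
  next
    case False
    then show ?thesis
      unfolding delay_diff[OF assms(3)] hit_len_after_hit[OF assms(3) of_nat_0_le_iff]
      using t[OF \<open>k \<in> S\<close>] by (intro gauge_fun_cut[OF assms(1,2)]) auto
  qed
qed

lemma list_event_path:
  assumes "gauge_fun c" "0 \<le> y" "good m"
    and t: "\<And>k. k \<in> S \<Longrightarrow> real (k * l) * \<mu> + y < real (Suc t)"
  shows "(\<exists>k\<in>S. y < c (real (hit_len (int (k * l)) (path t m)) - real (k * l) * \<mu>)) \<longleftrightarrow>
      (\<exists>k\<in>S. y < c (delay \<mu> l k m))"
proof (rule bex_cong[OF refl])
  fix k assume "k \<in> S"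
  show "y < c (real (hit_len (int (k * l)) (path t m)) - real (k * l) * \<mu>) \<longleftrightarrow> y < c (delay \<mu> l k m)"
  proof (cases "T (int (k * l)) m \<le> Suc t")
    case True
    then show ?thesis
      by (simp only: delay_def hit_len_path[OF assms(3)] min_absorb1)
  next
    case False
    then show ?thesis
      unfolding delay_def hit_len_path[OF assms(3)]
      using t[OF \<open>k \<in> S\<close>] by (intro gauge_fun_cut[OF assms(1,2)]) auto
  qed
qed

lemma prob_delay_shift_le:
  assumes c: "gauge_fun c" and y: "0 \<le> y" and "finite S"
  shows "\<P>(m in M. \<exists>k\<in>S. y < c (delay \<mu> l (i + k) m - delay \<mu> l i m)) \<le>
    \<P>(m in M. \<exists>k\<in>S. y < c (delay \<mu> l k m))"
proof -
  note [measurable] = gauge_fun_measurable[OF c] and [simp] = \<open>finite S\<close>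
  obtain t where t: "\<And>k. k \<in> S \<Longrightarrow> real (k * l) * \<mu> + y < real (Suc t)"
    using delay_horizon[OF \<open>finite S\<close>] by blast
  let ?H = "\<lambda>w. \<exists>k\<in>S. y < c (real (hit_len (int (k * l)) w) - real (k * l) * \<mu>)"
  have "\<P>(m in M. \<exists>k\<in>S. y < c (delay \<mu> l (i + k) m - delay \<mu> l i m)) =
      \<P>(m in M. ?H (after_hit (int (i * l)) t m))"
    by (rule prob_cong_good, rule list_event_after_hit[OF c y _ t, symmetric]) measurable
  also have "\<dots> \<le> \<P>(m in M. ?H (path t m))"
    by (rule prob_after_hit_le) simp
  also have "\<dots> = \<P>(m in M. \<exists>k\<in>S. y < c (delay \<mu> l k m))"
    by (rule prob_cong_good, rule list_event_path[OF c y _ t]) measurable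
  finally show ?thesis .
qed

section \<open>First exceedances and tails of the maximal delay\<close>

definition first_exceed :: "(real \<Rightarrow> real) \<Rightarrow> real \<Rightarrow> nat \<Rightarrow> real \<Rightarrow> nat \<Rightarrow> 'a \<Rightarrow> bool" where
  "first_exceed c \<mu> l y i m \<longleftrightarrow> y < c (delay \<mu> l i m) \<and> (\<forall>k<i. c (delay \<mu> l k m) \<le> y)"

lemma measurable_first_exceed:
  assumes "gauge_fun c"
  shows "Measurable.pred M (first_exceed c \<mu> l y i)"
proof -
  note [measurable] = gauge_fun_measurable[OF assms]
  show ?thesis unfolding first_exceed_def[abs_def] by measurable
qed

text \<open>A first exceedance at i is determined before the walk hits i l, whereas the increments
  are read off after it hits (i + 1) l. To couple the two, the walk would have to return across the
  whole block in between.\<close>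

lemma prob_first_exceed_decouple:
  assumes c: "gauge_fun c" and y: "0 \<le> y" and "finite S"
  shows "\<P>(m in M. first_exceed c \<mu> l x i m \<and>
      (\<exists>k\<in>S. y < c (delay \<mu> l (Suc i + k) m - delay \<mu> l (Suc i) m))) \<le>
    \<P>(m in M. first_exceed c \<mu> l x i m) * \<P>(m in M. \<exists>k\<in>S. y < c (delay \<mu> l k m))
      + back_bound (int l)"
proof -
  note [measurable] = gauge_fun_measurable[OF c] measurable_first_exceed[OF c] and [simp] = \<open>finite S\<close>
  obtain t where t: "\<And>k. k \<in> S \<Longrightarrow> real (k * l) * \<mu> + y < real (Suc t)"
    using delay_horizon[OF \<open>finite S\<close>] by blast
  let ?H = "\<lambda>w. \<exists>k\<in>S. y < c (real (hit_len (int (k * l)) w) - real (k * l) * \<mu>)"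
  let ?d = "\<lambda>k w. real (hit_len (int (k * l)) w) - real (k * l) * \<mu>"
  let ?G = "\<lambda>w. x < c (?d i w) \<and> (\<forall>k<i. c (?d k w) \<le> x)"
  have G: "?G (before_hit (int (i * l)) m) \<longleftrightarrow> first_exceed c \<mu> l x i m" if "good m" for m
  proof -
    have "?d k (before_hit (int (i * l)) m) = delay \<mu> l k m" if "k \<le> i" for k
    proof -
      have "int (k * l) \<le> int (i * l)"
        using that by (simp only: of_nat_le_iff mult_le_mono1)
      from hit_len_before_hit[OF \<open>good m\<close> this] show ?thesis
        by (simp only: delay_def)
    qed
    then show ?thesis by (auto simp: first_exceed_def)
  qed
  have "\<P>(m in M. first_exceed c \<mu> l x i m \<and>
      (\<exists>k\<in>S. y < c (delay \<mu> l (Suc i + k) m - delay \<mu> l (Suc i) m))) =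
      \<P>(m in M. ?G (before_hit (int (i * l)) m) \<and> ?H (after_hit (int (Suc i * l)) t m))"
    by (rule prob_cong_good, rule conj_cong[OF G[symmetric] list_event_after_hit[OF c y _ t, symmetric]]) measurable
  also have "\<dots> \<le> \<P>(m in M. ?G (before_hit (int (i * l)) m)) * \<P>(m in M. ?H (path t m))
      + back_bound (int (Suc i * l) - int (i * l))"
    by (rule prob_decouple) auto
  also have "\<P>(m in M. ?G (before_hit (int (i * l)) m)) = \<P>(m in M. first_exceed c \<mu> l x i m)"
    by (rule prob_cong_good, rule G) measurable
  also have "\<P>(m in M. ?H (path t m)) = \<P>(m in M. \<exists>k\<in>S. y < c (delay \<mu> l k m))"
    by (rule prob_cong_good, rule list_event_path[OF c y _ t]) measurable
  finally show ?thesis by (simp add: algebra_simps)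
qed

definition max_tail :: "(real \<Rightarrow> real) \<Rightarrow> real \<Rightarrow> nat \<Rightarrow> nat \<Rightarrow> real \<Rightarrow> real" where
  "max_tail c \<mu> l N y = \<P>(m in M. \<exists>j\<in>{..N}. y < c (delay \<mu> l j m))"

lemma max_tail_nonneg: "0 \<le> max_tail c \<mu> l N y"
  by (simp add: max_tail_def)

lemma sum_prob_first_exceed:
  assumes c: "gauge_fun c" and "n \<le> Suc N"
  shows "(\<Sum>i<n. \<P>(m in M. first_exceed c \<mu> l y i m)) \<le> max_tail c \<mu> l N y"
proof -
  note [measurable] = gauge_fun_measurable[OF c] measurable_first_exceed[OF c]
  have "(\<Sum>i<n. \<P>(m in M. first_exceed c \<mu> l y i m)) =
      prob (\<Union>i<n. {m \<in> space M. first_exceed c \<mu> l y i m})"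
  proof (rule finite_measure_finite_Union[symmetric])
    have less: "\<not> first_exceed c \<mu> l y j m" if "i < j" "first_exceed c \<mu> l y i m" for i j m
    proof -
      have "y < c (delay \<mu> l i m)"
        using that(2) by (simp add: first_exceed_def)
      then show ?thesis
        using that(1) unfolding first_exceed_def not_le[symmetric] by blast
    qed
    have "\<not> (first_exceed c \<mu> l y i m \<and> first_exceed c \<mu> l y j m)" if "i \<noteq> j" for i j m
      using that less[of i j m] less[of j i m] by linarith
    then show "disjoint_family_on (\<lambda>i. {m \<in> space M. first_exceed c \<mu> l y i m}) {..<n}"
      unfolding disjoint_family_on_def by blast
  qed auto
  also have "\<dots> \<le> max_tail c \<mu> l N y"
    unfolding max_tail_def using \<open>n \<le> Suc N\<close>
    by (intro finite_measure_mono subsetI) (auto simp: first_exceed_def intro!: bexI)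
  finally show ?thesis .
qed

definition jump_prob :: "(real \<Rightarrow> real) \<Rightarrow> real \<Rightarrow> nat \<Rightarrow> real \<Rightarrow> real" where
  "jump_prob c \<mu> l z = \<P>(m in M. z < c (delay \<mu> l 1 m))"

lemma prob_some_jump_le:
  assumes c: "gauge_fun c" and "0 \<le> z"
  shows "\<P>(m in M. \<exists>j\<in>{..<N}. z < c (delay \<mu> l (Suc j) m - delay \<mu> l j m)) \<le>
    real N * jump_prob c \<mu> l z"
proof -
  note [measurable] = gauge_fun_measurable[OF c]
  have "{m \<in> space M. \<exists>j\<in>{..<N}. z < c (delay \<mu> l (Suc j) m - delay \<mu> l j m)} =
      (\<Union>j<N. {m \<in> space M. z < c (delay \<mu> l (Suc j) m - delay \<mu> l j m)})"
    by auto
  also have "prob \<dots> \<le> (\<Sum>j<N. \<P>(m in M. z < c (delay \<mu> l (Suc j) m - delay \<mu> l j m)))"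
    by (intro finite_measure_subadditive_finite) auto
  also have "\<dots> \<le> (\<Sum>j<N. jump_prob c \<mu> l z)"
  proof (rule sum_mono)
    fix j
    show "\<P>(m in M. z < c (delay \<mu> l (Suc j) m - delay \<mu> l j m)) \<le> jump_prob c \<mu> l z"
      using prob_delay_shift_le[OF c \<open>0 \<le> z\<close>, of "{1}" \<mu> l j] by (simp add: jump_prob_def)
  qed
  finally show ?thesis by simp
qed

text \<open>The index set may vary with i so that both maximal inequalities can use it: the doubling
  inequality allows every k up to N, Ottaviani's only the k that leads to the last block.\<close>

lemma prob_first_exceed_union_le:
  assumes c: "gauge_fun c" and y: "0 \<le> y" and S: "\<And>i. S i \<subseteq> {..N}"
    and p: "\<And>i. i < N \<Longrightarrow> \<P>(m in M. \<exists>k\<in>S i. y < c (delay \<mu> l k m)) \<le> p"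
    and "0 \<le> p"
  shows "prob (\<Union>i<N. {m \<in> space M. first_exceed c \<mu> l x i m \<and>
      (\<exists>k\<in>S i. y < c (delay \<mu> l (Suc i + k) m - delay \<mu> l (Suc i) m))}) \<le>
    max_tail c \<mu> l N x * p + real N * back_bound (int l)"
proof -
  note [measurable] = gauge_fun_measurable[OF c] measurable_first_exceed[OF c]
  have [simp]: "finite (S i)" for i
    using S finite_subset by blast
  have "prob (\<Union>i<N. {m \<in> space M. first_exceed c \<mu> l x i m \<and>
      (\<exists>k\<in>S i. y < c (delay \<mu> l (Suc i + k) m - delay \<mu> l (Suc i) m))}) \<le>
    (\<Sum>i<N. \<P>(m in M. first_exceed c \<mu> l x i m \<and>
      (\<exists>k\<in>S i. y < c (delay \<mu> l (Suc i + k) m - delay \<mu> l (Suc i) m))))"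
    by (intro finite_measure_subadditive_finite) auto
  also have "\<dots> \<le> (\<Sum>i<N. \<P>(m in M. first_exceed c \<mu> l x i m) * p + back_bound (int l))"
  proof (rule sum_mono)
    fix i assume "i \<in> {..<N}"
    then show "\<P>(m in M. first_exceed c \<mu> l x i m \<and>
        (\<exists>k\<in>S i. y < c (delay \<mu> l (Suc i + k) m - delay \<mu> l (Suc i) m))) \<le>
      \<P>(m in M. first_exceed c \<mu> l x i m) * p + back_bound (int l)"
      using prob_first_exceed_decouple[OF c y, of "S i" \<mu> l x i] p[of i]
      by (smt (verit) \<open>finite (S i)\<close> lessThan_iff measure_nonneg mult_left_mono)
  qed
  also have "\<dots> = (\<Sum>i<N. \<P>(m in M. first_exceed c \<mu> l x i m)) * p + real N * back_bound (int l)"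
    by (simp add: sum.distrib sum_distrib_right)
  also have "\<dots> \<le> max_tail c \<mu> l N x * p + real N * back_bound (int l)"
    using sum_prob_first_exceed[OF c, of N N \<mu> l x] \<open>0 \<le> p\<close> by (simp add: mult_right_mono)
  finally show ?thesis .
qed

text \<open>A Hoffmann-Jorgensen inequality for the block delays: after the first exceedance of \<open>y\<close>, one block is
  skipped in order to decouple the future from the past.\<close>

theorem max_tail_doubling:
  assumes c: "gauge_fun c" and y: "0 \<le> y" and z: "0 \<le> z" and "0 < y + z"
  shows "max_tail c \<mu> l N (2 * y + 2 * z) \<le>
    (max_tail c \<mu> l N y)\<^sup>2 + real N * jump_prob c \<mu> l z + real N * back_bound (int l)"
proof -
  note [measurable] = gauge_fun_measurable[OF c] measurable_first_exceed[OF c]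
  let ?D = "delay \<mu> l"
  let ?J = "{m \<in> space M. \<exists>j\<in>{..<N}. z < c (?D (Suc j) m - ?D j m)}"
  let ?B = "\<Union>i<N. {m \<in> space M. first_exceed c \<mu> l y i m \<and> (\<exists>k\<in>{..N}. y < c (?D (Suc i + k) m - ?D (Suc i) m))}"
  have incl: "m \<in> ?J \<union> ?B"
    if m: "m \<in> space M" "good m" and big: "\<exists>j\<in>{..N}. 2 * y + 2 * z < c (?D j m)" for m
  proof (cases "m \<in> ?J")
    case False
    then have jump: "c (?D (Suc j) m - ?D j m) \<le> z" if "j < N" for j
      using m that by (auto simp: not_less)
    obtain j where j: "j \<le> N" "2 * y + 2 * z < c (?D j m)"
      using big by auto
    define i where "i = (LEAST i. y < c (?D i m))"
    have j': "y < c (?D j m)" using j y z by simp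
    have i: "y < c (?D i m)" and "i \<le> j"
      unfolding i_def using j' by (rule LeastI, intro Least_le)
    have before: "c (?D k m) \<le> y" if "k < i" for k
      using not_less_Least[OF that[unfolded i_def]] by simp
    have "i \<noteq> 0"
      using i y delay_0[OF m(2)] gauge_fun_0[OF c] by (metis not_less)
    then obtain i' where i': "i = Suc i'" by (cases i) auto
    \<comment> \<open>The budget 2 y + 2 z: y before the exceedance, z for the overshoot, z for the
      skipped block; more than y is left for the remaining blocks. As 0 < y + z, the overshoot alone
      cannot reach the target, so i is strictly before j.\<close>
    have "c (?D i m) \<le> c (?D i' m) + c (?D i m - ?D i' m)"
      using gauge_fun_add[OF c, of "?D i' m" "?D i m - ?D i' m"] by simp
    also have "\<dots> \<le> y + z"
      using before[of i'] jump[of i'] i' \<open>i \<le> j\<close> j(1) by (intro add_mono) auto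
    finally have ci: "c (?D i m) \<le> y + z" .
    with j \<open>0 < y + z\<close> have "i \<noteq> j" by auto
    with \<open>i \<le> j\<close> have "i < j" by simp
    have "c (?D (Suc i) m) \<le> c (?D i m) + c (?D (Suc i) m - ?D i m)"
      using gauge_fun_add[OF c, of "?D i m" "?D (Suc i) m - ?D i m"] by simp
    with ci jump[of i] \<open>i < j\<close> j(1) have "c (?D (Suc i) m) \<le> y + 2 * z" by simp
    moreover have "c (?D j m) \<le> c (?D (Suc i) m) + c (?D j m - ?D (Suc i) m)"
      using gauge_fun_add[OF c, of "?D (Suc i) m" "?D j m - ?D (Suc i) m"] by simp
    ultimately have "y < c (?D (Suc i + (j - Suc i)) m - ?D (Suc i) m)"
      using j \<open>i < j\<close> by simp
    moreover have "first_exceed c \<mu> l y i m"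
      using i before by (simp add: first_exceed_def)
    ultimately show ?thesis
      using m \<open>i < j\<close> j(1) by (intro UnI2 UN_I[of i]) (auto intro!: bexI[of _ "j - Suc i"])
  qed simp
  have "max_tail c \<mu> l N (2 * y + 2 * z) \<le> prob (?J \<union> ?B)"
    unfolding max_tail_def by (rule prob_mono_good, rule incl) measurable
  also have "\<dots> \<le> prob ?J + prob ?B"
    by (intro measure_Un_le) auto
  also have "\<dots> \<le> real N * jump_prob c \<mu> l z + (max_tail c \<mu> l N y * max_tail c \<mu> l N y + real N * back_bound (int l))"
    by (intro add_mono prob_some_jump_le[OF c z] prob_first_exceed_union_le[OF c y]) (auto simp: max_tail_def)
  finally show ?thesis by (simp add: power2_eq_square)
qed

text \<open>Ottaviani's maximal inequality, again with one block skipped.\<close>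

theorem max_tail_le_endpoint:
  assumes y: "0 \<le> y" and z: "0 \<le> z"
    and half: "\<And>k. k \<le> N \<Longrightarrow> \<P>(m in M. y < \<bar>delay \<mu> l k m\<bar>) \<le> 1 / 2"
  shows "max_tail abs \<mu> l N (2 * y + z) \<le> 2 * \<P>(m in M. y < \<bar>delay \<mu> l N m\<bar>)
    + 2 * real N * jump_prob abs \<mu> l z + 2 * real N * back_bound (int l)"
proof -
  note c = gauge_fun_abs
  note [measurable] = measurable_first_exceed[OF c]
  let ?D = "delay \<mu> l"
  let ?x = "2 * y + z"
  let ?E = "{m \<in> space M. y < \<bar>?D N m\<bar>}"
  let ?J = "{m \<in> space M. \<exists>j\<in>{..<N}. z < \<bar>?D (Suc j) m - ?D j m\<bar>}"
  let ?B = "\<Union>i<N. {m \<in> space M. first_exceed abs \<mu> l ?x i m \<and> (\<exists>k\<in>{N - Suc i}. y < \<bar>?D (Suc i + k) m - ?D (Suc i) m\<bar>)}"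
  have incl: "m \<in> ?E \<union> ?J \<union> ?B"
    if m: "m \<in> space M" and big: "\<exists>j\<in>{..N}. ?x < \<bar>?D j m\<bar>" for m
  proof (cases "m \<in> ?E \<union> ?J")
    case False
    then have jump: "\<bar>?D (Suc j) m - ?D j m\<bar> \<le> z" if "j < N" for j
      using m that by (auto simp: not_less)
    have last: "\<bar>?D N m\<bar> \<le> y"
      using False m by (auto simp: not_less)
    obtain j where j: "j \<le> N" "?x < \<bar>?D j m\<bar>"
      using big by auto
    define i where "i = (LEAST i. ?x < \<bar>?D i m\<bar>)"
    have i: "?x < \<bar>?D i m\<bar>" and "i \<le> j"
      unfolding i_def using j(2) by (rule LeastI, intro Least_le)
    have before: "\<bar>?D k m\<bar> \<le> ?x" if "k < i" for k
      using not_less_Least[OF that[unfolded i_def]] by simp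
    have "i \<noteq> N" using i last y z by auto
    then have "i < N" using \<open>i \<le> j\<close> j(1) by simp
    \<comment> \<open>From more than 2 y + z, the skipped block takes at most z and the small
      endpoint at most y.\<close>
    have "y < \<bar>?D (Suc i + (N - Suc i)) m - ?D (Suc i) m\<bar>"
      using jump[OF \<open>i < N\<close>] i last \<open>i < N\<close> by simp
    moreover have "first_exceed abs \<mu> l ?x i m"
      using i before by (simp add: first_exceed_def)
    ultimately show ?thesis
      using m \<open>i < N\<close> by (intro UnI2 UN_I[of i]) auto
  qed simp
  have "max_tail abs \<mu> l N ?x \<le> prob (?E \<union> ?J \<union> ?B)"
    unfolding max_tail_def by (rule prob_mono_good, rule incl) measurable
  also have "\<dots> \<le> prob ?E + prob ?J + prob ?B"
    by (intro measure_Un_le[THEN order_trans] add_right_mono measure_Un_le) auto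
  also have "\<dots> \<le> prob ?E + real N * jump_prob abs \<mu> l z + (max_tail abs \<mu> l N ?x * (1 / 2) + real N * back_bound (int l))"
    by (intro add_mono order_refl prob_some_jump_le[OF c z] prob_first_exceed_union_le[OF c y]) (use half in simp_all)
  \<comment> \<open>The maximal tail itself stands on the right with weight 1 / 2. Absorbing it to
    the left produces the factors 2.\<close>
  finally show ?thesis by simp
qed

end

section \<open>Comparison of the walk with its hitting times\<close>

lemma power_times_geometric_tendsto_0:
  fixes q :: real
  assumes "0 \<le> q" "q < 1"
  shows "(\<lambda>k. real k ^ d * q ^ k) \<longlonglongrightarrow> 0"
proof (cases "q = 0")
  case True
  have "eventually (\<lambda>k. real k ^ d * q ^ k = 0) sequentially"
    using eventually_gt_at_top[of 0] by eventually_elim (simp add: True)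
  then show ?thesis by (rule tendsto_eventually)
next
  case False
  then have "0 < q" using assms by simp
  have "(\<lambda>k. real k ^ d * exp (real k * ln q)) \<longlonglongrightarrow> 0"
    using ln_less_zero[OF \<open>0 < q\<close> \<open>q < 1\<close>] by real_asymp
  then show ?thesis
    using \<open>0 < q\<close> by (simp add: exp_of_nat_mult)
qed

text \<open>The square of a sum of three terms is at most 3 times the sum of squares, and each
  constant reproduces its own term: 3 a^2 <= a / 20 if a <= 1 / 60; 3 * 18^2 \<kappa>^2 = 972
  \<kappa>^2 <= \<kappa>; 3 * (2 \<eta>)^2 <= \<eta>. The two contributions \<kappa> / 9^i add up to
  18 \<kappa> / 9^(i+1), the two \<eta> to 2 \<eta>. The point of the rate 20 is that it exceeds 9,
  so the first term is summable against the weights 9^i.\<close>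

lemma square_recursion_bound:
  fixes s :: "nat \<Rightarrow> real"
  assumes s0: "s 0 \<le> 1 / 60" and nonneg: "\<And>i. 0 \<le> s i"
    and step: "\<And>i. i < n \<Longrightarrow> s (Suc i) \<le> (s i)\<^sup>2 + \<kappa> / 9 ^ i + \<eta>"
    and \<kappa>: "0 \<le> \<kappa>" "\<kappa> \<le> 1 / 1000" and \<eta>: "0 \<le> \<eta>" "\<eta> \<le> 1 / 12"
    and "i \<le> n"
  shows "s i \<le> 1 / 60 / 20 ^ i + 18 * \<kappa> / 9 ^ i + 2 * \<eta>"
  using \<open>i \<le> n\<close>
proof (induction i)
  case 0
  then show ?case using s0 \<kappa> \<eta> by simp
next
  case (Suc i)
  let ?a = "1 / 60 / 20 ^ i :: real" and ?b = "18 * \<kappa> / 9 ^ i" and ?c = "2 * \<eta>"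
  have "s i \<le> ?a + ?b + ?c"
    using Suc by simp
  then have "(s i)\<^sup>2 \<le> (?a + ?b + ?c)\<^sup>2"
    using nonneg by (intro power_mono) auto
  also have "\<dots> \<le> 3 * ?a\<^sup>2 + 3 * ?b\<^sup>2 + 3 * ?c\<^sup>2"
  proof -
    have "(a + b + c)\<^sup>2 \<le> 3 * a\<^sup>2 + 3 * b\<^sup>2 + 3 * c\<^sup>2" for a b c :: real
    proof -
      have "0 \<le> (a - b)\<^sup>2 + (b - c)\<^sup>2 + (a - c)\<^sup>2" by simp
      then show ?thesis by (simp add: power2_eq_square algebra_simps)
    qed
    then show ?thesis .
  qed
  also have "3 * ?a\<^sup>2 \<le> ?a / 20"
  proof -
    have "?a \<le> 1 / 60" by (simp add: divide_simps)
    then have "?a * ?a \<le> 1 / 60 * ?a" by (intro mult_right_mono) auto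
    then show ?thesis by (simp add: power2_eq_square)
  qed
  also have "3 * ?b\<^sup>2 \<le> \<kappa> / 9 ^ i"
  proof -
    have "\<kappa> / 9 ^ i \<le> \<kappa> / 1"
      using \<kappa> by (intro divide_left_mono) auto
    then have "\<kappa> / 9 ^ i \<le> 1 / 1000"
      using \<kappa> by linarith
    then have "(\<kappa> / 9 ^ i) * (\<kappa> / 9 ^ i) \<le> 1 / 1000 * (\<kappa> / 9 ^ i)"
      using \<kappa> by (intro mult_right_mono) auto
    moreover have "3 * ?b\<^sup>2 = 972 * ((\<kappa> / 9 ^ i) * (\<kappa> / 9 ^ i))"
      by (simp add: power2_eq_square)
    moreover have "0 \<le> \<kappa> / 9 ^ i"
      using \<kappa> by simp
    ultimately show ?thesis by linarith
  qed
  also have "3 * ?c\<^sup>2 \<le> \<eta>"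
  proof -
    have "\<eta> * \<eta> \<le> 1 / 12 * \<eta>" using \<eta> by (intro mult_right_mono) auto
    then show ?thesis by (simp add: power2_eq_square)
  qed
  finally have "(s i)\<^sup>2 \<le> ?a / 20 + \<kappa> / 9 ^ i + \<eta>" by simp
  with step[of i] Suc.prems have "s (Suc i) \<le> ?a / 20 + \<kappa> / 9 ^ i + \<eta> + \<kappa> / 9 ^ i + \<eta>"
    by simp
  also have "\<dots> = 1 / 60 / 20 ^ Suc i + 18 * \<kappa> / 9 ^ Suc i + 2 * \<eta>"
    by (simp add: field_simps)
  finally show ?case .
qed

lemma power_3_between:
  fixes r :: real
  assumes "1 \<le> r"
  obtains I :: nat where "r \<le> 3 ^ I" "3 ^ I \<le> 3 * r" "real I \<le> log 3 r + 1"
proof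
  let ?I = "nat \<lceil>log 3 r\<rceil>"
  have "0 \<le> log 3 r" using assms by simp
  then have I: "log 3 r \<le> real ?I" "real ?I \<le> log 3 r + 1"
    by (simp_all add: of_nat_nat)
  show "real ?I \<le> log 3 r + 1" by (fact I)
  have "r = 3 powr (log 3 r)" using assms by simp
  also have "\<dots> \<le> 3 powr real ?I" using I by (intro powr_mono) auto
  finally show "r \<le> 3 ^ ?I" by (simp add: powr_realpow)
  have "3 powr real ?I \<le> 3 powr (log 3 r + 1)" using I by (intro powr_mono) auto
  also have "\<dots> = 3 * r" using assms by (simp add: powr_add)
  finally show "3 ^ ?I \<le> 3 * r" by (simp add: powr_realpow)
qed

locale rwre_tails = transient_rwre +
  fixes v K :: real
  assumes v_pos: "0 < v" and v_le_1: "v \<le> 1"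
    and K_nonneg: "0 \<le> K"
    and tight: "\<And>\<delta>. 0 < \<delta> \<Longrightarrow> \<exists>C n0. \<forall>n\<ge>n0.
      \<P>(m in M. C * sqrt (real n * ln (real n)) < \<bar>real_of_int (Z n m) - real n * v\<bar>) \<le> \<delta>"
    and tail: "\<And>\<epsilon>. 0 < \<epsilon> \<Longrightarrow> \<exists>n0. \<forall>n\<ge>n0.
      \<forall>x\<in>{sqrt (real n) * ln (real n) ^ 3 .. real n * v - ln (real n)}.
        \<bar>\<P>(m in M. real_of_int (Z n m) - real n * v < - x) - K * ((real n * v - x) / x\<^sup>2)\<bar>
          \<le> \<epsilon> * ((real n * v - x) / x\<^sup>2)"
begin

section \<open>Blocks, the diffusive scale and the backtracking error\<close>

definition W :: "nat \<Rightarrow> 'a \<Rightarrow> real" where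
  "W n m = real_of_int (Z n m) - real n * v"

definition scale :: "nat \<Rightarrow> real" where
  "scale n = sqrt (real n * ln (real n))"

definition block :: "nat \<Rightarrow> nat" where
  "block n = nat \<lfloor>sqrt (real n)\<rfloor>"

text \<open>With l the integer part of sqrt n, the product l * l may miss n by up to 2 l. Three
  further blocks give l (l + 3) >= (l + 1)^2 > n, so a walk of n steps stays within the
  blocks.\<close>

definition blocks :: "nat \<Rightarrow> nat" where
  "blocks n = block n + 3"

abbreviation \<mu> :: real where "\<mu> \<equiv> 1 / v"

abbreviation del :: "nat \<Rightarrow> nat \<Rightarrow> 'a \<Rightarrow> real" where "del n \<equiv> delay \<mu> (block n)"

abbreviation jump :: "(real \<Rightarrow> real) \<Rightarrow> nat \<Rightarrow> real \<Rightarrow> real" where "jump c n \<equiv> jump_prob c \<mu> (block n)"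

abbreviation mtail :: "(real \<Rightarrow> real) \<Rightarrow> nat \<Rightarrow> real \<Rightarrow> real" where "mtail c n \<equiv> max_tail c \<mu> (block n) (blocks n)"

definition err :: "nat \<Rightarrow> real" where
  "err n = real (blocks n) * back_bound (int (block n))"

lemma measurable_W [measurable]: "W n \<in> borel_measurable M"
  unfolding W_def
  by (intro borel_measurable_diff borel_measurable_const measurable_compose[OF measurable_Z]) simp

lemma block_le: "real (block n) \<le> sqrt (real n)"
  and block_ge: "sqrt (real n) - 1 < real (block n)"
  unfolding block_def by (simp_all add: of_nat_nat)

lemma block_gt_0: "1 \<le> n \<Longrightarrow> 0 < block n"
  unfolding block_def by (simp add: le_floor_iff zero_less_nat_eq)

lemma blocks_block_le: "9 \<le> n \<Longrightarrow> real (blocks n * block n) \<le> 2 * real n"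
proof -
  assume n: "9 \<le> n"
  have "real (blocks n * block n) = real (block n) * real (block n) + 3 * real (block n)"
    by (simp add: blocks_def algebra_simps)
  also have "\<dots> \<le> sqrt (real n) * sqrt (real n) + sqrt (real n) * sqrt (real n)"
  proof (intro add_mono mult_mono)
    show "3 \<le> sqrt (real n)" using n by (simp add: real_le_rsqrt)
  qed (use block_le in auto)
  finally show ?thesis by simp
qed

lemma le_blocks_block: "1 \<le> n \<Longrightarrow> real n / real (block n) \<le> real (blocks n)"
proof -
  assume n: "1 \<le> n"
  have "real n = sqrt (real n) * sqrt (real n)" by simp
  also have "\<dots> \<le> (real (block n) + 1) * (real (block n) + 1)"
    using block_ge[of n] by (intro mult_mono) auto
  also have "\<dots> \<le> real (blocks n) * real (block n)"
    using block_gt_0[OF n] by (simp add: blocks_def algebra_simps)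
  finally show ?thesis
    using block_gt_0[OF n] by (simp add: divide_simps)
qed

lemma filterlim_block: "filterlim block at_top sequentially"
proof -
  have "filterlim (\<lambda>n. sqrt (real n) - 1) at_top sequentially" by real_asymp
  then have "filterlim (\<lambda>n. real (block n)) at_top sequentially"
    by (rule filterlim_at_top_mono) (auto intro: always_eventually less_imp_le block_ge)
  then show ?thesis by (simp add: filterlim_sequentially_iff_filterlim_real)
qed

lemma err_nonneg: "0 \<le> err n"
  unfolding err_def by (simp add: back_bound_nonneg)

lemma back_bound_le_err: "back_bound (int (block n)) \<le> err n"
  unfolding err_def blocks_def using back_bound_nonneg[of "int (block n)"] by (simp add: algebra_simps)

text \<open>The factor n^2 is the largest weight that a second moment can put on the error, since |W
  n| <= 2 n.\<close>

lemma err_tendsto: "(\<lambda>n. err n * real n ^ 2) \<longlonglongrightarrow> 0"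
proof -
  let ?q = "\<integral>p. rho p \<partial>\<alpha>"
  \<comment> \<open>The exponent 5: the number of blocks is at most 4 l, and n^2 is at most (2 l)^4,
    which also explains the 64 below.\<close>
  have "(\<lambda>k. real k ^ 5 * ?q ^ k) \<longlonglongrightarrow> 0"
    by (rule power_times_geometric_tendsto_0[OF mean_rho_nonneg mean_rho_less_1])
  then have "(\<lambda>n. real (block n) ^ 5 * ?q ^ block n) \<longlonglongrightarrow> 0"
    by (rule filterlim_compose[OF _ filterlim_block])
  then have lim: "(\<lambda>n. 64 / (1 - ?q) * (real (block n) ^ 5 * ?q ^ block n)) \<longlonglongrightarrow> 0"
    by (rule tendsto_mult_right_zero)
  show ?thesis
  proof (rule tendsto_sandwich[OF _ _ tendsto_const lim])
    show "\<forall>\<^sub>F n in sequentially. 0 \<le> err n * real n ^ 2"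
      by (simp add: err_nonneg)
    show "\<forall>\<^sub>F n in sequentially. err n * real n ^ 2 \<le> 64 / (1 - ?q) * (real (block n) ^ 5 * ?q ^ block n)"
      using eventually_ge_at_top[of 1]
    proof eventually_elim
      case (elim n)
      let ?l = "real (block n)"
      have l: "1 \<le> ?l" using block_gt_0[OF elim] by simp
      have "real n = sqrt (real n) ^ 2" by simp
      also have "\<dots> \<le> (2 * ?l) ^ 2"
        using block_ge[of n] l by (intro power_mono) auto
      finally have n: "real n \<le> (2 * ?l) ^ 2" .
      have "real (blocks n) * real n ^ 2 \<le> (4 * ?l) * ((2 * ?l) ^ 2) ^ 2"
        using l n by (intro mult_mono power_mono) (auto simp: blocks_def)
      also have "\<dots> = 64 * ?l ^ 5" by (simp add: power_mult_distrib eval_nat_numeral)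
      finally have "real (blocks n) * real n ^ 2 * (?q ^ block n / (1 - ?q)) \<le> 64 * ?l ^ 5 * (?q ^ block n / (1 - ?q))"
        using mean_rho_nonneg mean_rho_less_1 by (intro mult_right_mono) auto
      then show ?case by (simp add: err_def back_bound_def field_simps)
    qed
  qed
qed

lemma err_tendsto_0: "err \<longlonglongrightarrow> 0"
proof (rule tendsto_sandwich[OF _ _ tendsto_const err_tendsto])
  show "\<forall>\<^sub>F n in sequentially. err n \<le> err n * real n ^ 2"
    using eventually_ge_at_top[of 1]
  proof eventually_elim
    case (elim n)
    then have "1 \<le> real n ^ 2" by simp
    from mult_left_mono[OF this err_nonneg[of n]] show ?case by simp
  qed
qed (simp add: err_nonneg)

section \<open>From deviations of the walk to block delays\<close>

lemma abs_Z_le: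
  assumes "good m"
  shows "\<bar>Z n m\<bar> \<le> int n"
proof (induction n)
  case (Suc n)
  then show ?case using good_step[OF assms, of n] by auto
qed (simp add: good_Z0[OF assms])

lemma abs_W_le:
  assumes "good m"
  shows "\<bar>W n m\<bar> \<le> 2 * real n"
proof -
  have "\<bar>real_of_int (Z n m)\<bar> \<le> real n"
    using abs_Z_le[OF assms, of n] by linarith
  moreover have "\<bar>real n * v\<bar> \<le> real n"
    using v_pos v_le_1 by (simp add: abs_mult mult_left_le)
  ultimately show ?thesis by (simp add: W_def)
qed

lemma prob_return_le:
  assumes "0 \<le> b"
  shows "\<P>(m in M. T b m \<le> n \<and> Z n m \<le> b - int l) \<le> back_bound (int l)"
proof -
  let ?H = "\<lambda>w. \<exists>y\<in>set w. y \<le> - int l"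
  have "\<P>(m in M. T b m \<le> n \<and> Z n m \<le> b - int l) \<le> \<P>(m in M. ?H (after_hit b n m))"
  proof (rule finite_measure_mono)
    show "{m \<in> space M. T b m \<le> n \<and> Z n m \<le> b - int l} \<subseteq> {m \<in> space M. ?H (after_hit b n m)}"
    proof safe
      fix m assume m: "T b m \<le> n" "Z n m \<le> b - int l"
      then have "Z n m - b \<in> set (after_hit b n m)"
        unfolding after_hit_def by (auto simp: image_iff intro!: bexI[of _ "n - T b m"] simp del: upt_Suc)
      then show "?H (after_hit b n m)" using m by (intro bexI) auto
    qed
  qed measurable
  also have "\<dots> \<le> \<P>(m in M. ?H (path n m))"
    by (rule prob_after_hit_le[OF assms])
  also have "\<dots> \<le> back_bound (int l)"
    unfolding prob_path[of ?H] by (rule qexp_backtrack_annealed) simp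
  finally show ?thesis .
qed

text \<open>Having reached n v + x, the walk has hit the block boundary just below it by time n,
  which makes that hitting time early. Rounding down to a boundary costs less than l < x / 2, so
  half of x survives; \<mu> converts space into time.\<close>

lemma prob_right_le:
  assumes "1 \<le> n" and x: "2 * real (block n) < x"
  shows "\<P>(m in M. x < W n m) \<le> mtail uminus n (x * \<mu> / 2)"
  unfolding max_tail_def
proof (rule prob_mono_good)
  fix m assume m: "m \<in> space M" "good m" "x < W n m"
  let ?l = "block n"
  have l: "0 < ?l" by (rule block_gt_0) fact
  define j where "j = nat \<lfloor>(real n * v + x) / real ?l\<rfloor>"
  have nonneg: "0 \<le> (real n * v + x) / real ?l"
    using v_pos x by simp
  have j: "real j \<le> (real n * v + x) / real ?l" "(real n * v + x) / real ?l < real j + 1"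
    using nonneg by (simp_all add: j_def of_nat_nat)
  then have jl: "real (j * ?l) \<le> real n * v + x" "real n * v + x < real (j * ?l) + real ?l"
    using l by (simp_all add: field_simps)
  have Zm: "real n * v + x < real_of_int (Z n m)"
    using m(3) by (simp add: W_def)
  then have "real (j * ?l) \<le> real_of_int (Z n m)" using jl by simp
  then have "int (j * ?l) \<le> Z n m" by linarith
  then have T: "T (int (j * ?l)) m \<le> n" by (rule T_le)
  have "real_of_int (Z n m) \<le> real n" using abs_Z_le[OF m(2), of n] by linarith
  then have "(real n * v + x) / real ?l \<le> real n / real ?l"
    using Zm by (intro divide_right_mono) auto
  with j(1) le_blocks_block[OF assms(1)] have "j \<le> blocks n" by simp
  moreover have "x * \<mu> / 2 < - del n j m"
  proof -
    have "real n * v + x / 2 < real (j * ?l)" using jl x by simp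
    then have "(real n * v + x / 2) * \<mu> < real (j * ?l) * \<mu>"
      using v_pos by (intro mult_strict_right_mono) auto
    then have "real n + x * \<mu> / 2 < real (j * ?l) * \<mu>"
      using v_pos by (simp add: field_simps)
    moreover have "del n j m \<le> real n - real (j * ?l) * \<mu>"
      unfolding delay_def using T by simp
    ultimately show ?thesis by simp
  qed
  ultimately show "m \<in> {m \<in> space M. \<exists>j\<in>{..blocks n}. x * \<mu> / 2 < - del n j m}"
    using m by auto
qed measurable

text \<open>Unlike on the right, a low position at time n need not come from a late hitting time, as
  the walk may have hit the boundary below n v - x / 2 and returned. Rounding and a return over one
  block cost 2 l in all, which fits into the other x / 2 because 4 l < x.\<close>

lemma prob_left_le:
  assumes "1 \<le> n" and x: "4 * real (block n) < x" "x \<le> real n * v"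
  shows "\<P>(m in M. W n m < - x) \<le> mtail (\<lambda>x. x) n (x * \<mu> / 2) + back_bound (int (block n))"
proof -
  let ?l = "block n"
  have l: "0 < ?l" by (rule block_gt_0) fact
  define j where "j = nat \<lfloor>(real n * v - x / 2) / real ?l\<rfloor>"
  have "0 < real n * v" using assms(1) v_pos by simp
  then have nonneg: "0 \<le> (real n * v - x / 2) / real ?l"
    using x by (intro divide_nonneg_nonneg) auto
  have j: "real j \<le> (real n * v - x / 2) / real ?l" "(real n * v - x / 2) / real ?l < real j + 1"
    using nonneg by (simp_all add: j_def of_nat_nat)
  then have jl: "real (j * ?l) \<le> real n * v - x / 2" "real n * v - x / 2 < real (j * ?l) + real ?l"
    using l by (simp_all add: field_simps)
  let ?A = "{m \<in> space M. \<exists>j\<in>{..blocks n}. x * \<mu> / 2 < del n j m}"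
  let ?B = "{m \<in> space M. T (int (j * ?l)) m \<le> n \<and> Z n m \<le> int (j * ?l) - int ?l}"
  have "\<P>(m in M. W n m < - x) \<le> prob (?A \<union> ?B)"
  proof (rule prob_mono_good)
    fix m assume m: "m \<in> space M" "good m" "W n m < - x"
    show "m \<in> ?A \<union> ?B"
    proof (cases "T (int (j * ?l)) m \<le> n")
      case True
      have "real_of_int (Z n m) \<le> real (j * ?l) - real ?l"
        using m(3) jl x by (simp add: W_def)
      then have "Z n m \<le> int (j * ?l) - int ?l" by linarith
      then show ?thesis using m True by simp
    next
      case False
      have "(real n * v) * 1 \<le> real n * 1"
        using v_le_1 by (simp add: mult_left_le)
      then have "(real n * v - x / 2) / real ?l \<le> real n / real ?l"
        using x l by (intro divide_right_mono) auto
      with j(1) le_blocks_block[OF assms(1)] have "j \<le> blocks n" by simp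
      moreover have "x * \<mu> / 2 < del n j m"
      proof -
        have "real (j * ?l) * \<mu> \<le> (real n * v - x / 2) * \<mu>"
          using jl v_pos by (intro mult_right_mono) auto
        also have "\<dots> = real n - x * \<mu> / 2"
          using v_pos by (simp add: field_simps)
        finally show ?thesis
          unfolding delay_def using False by simp
      qed
      ultimately show ?thesis using m by auto
    qed
  qed measurable
  also have "\<dots> \<le> prob ?A + prob ?B"
    by (intro measure_Un_le) measurable
  also have "prob ?B \<le> back_bound (int ?l)"
    by (rule prob_return_le) simp
  finally show ?thesis by (simp add: max_tail_def)
qed


section \<open>Tightness of the walk and of the delays on the diffusive scale\<close>

lemma scale_pos: "2 \<le> n \<Longrightarrow> 0 < scale n"
  unfolding scale_def by simp

lemma scale_nonneg: "1 \<le> n \<Longrightarrow> 0 \<le> scale n"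
  unfolding scale_def by simp

lemma scale_sq: "1 \<le> n \<Longrightarrow> (scale n)\<^sup>2 = real n * ln (real n)"
  unfolding scale_def by simp

lemma eventually_scale_bounds:
  "\<forall>\<^sub>F n in sequentially. 1 \<le> n \<and> C \<le> scale n \<and> C * sqrt (real n) \<le> scale n \<and> C * scale n \<le> real n"
proof -
  have "\<forall>\<^sub>F n in sequentially. C \<le> sqrt (real n * ln (real n))" by real_asymp
  moreover have "\<forall>\<^sub>F n in sequentially. C * sqrt (real n) \<le> sqrt (real n * ln (real n))" by real_asymp
  moreover have "\<forall>\<^sub>F n in sequentially. C * sqrt (real n * ln (real n)) \<le> real n" by real_asymp
  ultimately show ?thesis
    using eventually_ge_at_top[of 1] unfolding scale_def by eventually_elim auto
qed

lemma eventually_scale_mult_le: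
  assumes "1 \<le> \<gamma>"
  shows "\<forall>\<^sub>F n in sequentially. \<forall>n'. real n' \<le> \<gamma> * real n \<longrightarrow> scale n' \<le> sqrt (2 * \<gamma>) * scale n"
proof -
  have "\<forall>\<^sub>F n in sequentially. ln (\<gamma> * real n) \<le> 2 * ln (real n)"
    using assms by real_asymp
  then show ?thesis
    using eventually_ge_at_top[of 1]
  proof eventually_elim
    case (elim n)
    show ?case
    proof safe
      fix n' assume n': "real n' \<le> \<gamma> * real n"
      show "scale n' \<le> sqrt (2 * \<gamma>) * scale n"
      proof (cases "n' = 0")
        case True
        then show ?thesis using elim assms by (simp add: scale_def)
      next
        case False
        then have "ln (real n') \<le> 2 * ln (real n)"
          using n' elim by (smt (verit) ln_le_cancel_iff of_nat_0_less_iff gr0I)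
        then have "real n' * ln (real n') \<le> (\<gamma> * real n) * (2 * ln (real n))"
          using n' False elim by (intro mult_mono) (auto simp: Suc_le_eq)
        then have "sqrt (real n' * ln (real n')) \<le> sqrt ((2 * \<gamma>) * (real n * ln (real n)))"
          by (simp add: algebra_simps)
        then show ?thesis by (simp add: scale_def real_sqrt_mult)
      qed
    qed
  qed
qed

text \<open>Hitting times are inverted at times other than n, so tightness is needed for all n' <=
  \<gamma> n on the scale of n. Finitely many small n' escape the limit theorem; there |W n'| <= 2
  n' is below the scale.\<close>

lemma uniform_tight:
  assumes "0 < \<delta>" "1 \<le> \<gamma>"
  shows "\<exists>C. \<forall>\<^sub>F n in sequentially. \<forall>n'. real n' \<le> \<gamma> * real n \<longrightarrow>
    \<P>(m in M. C * scale n < \<bar>W n' m\<bar>) \<le> \<delta>"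
proof -
  obtain C n0 where C: "\<And>n. n \<ge> n0 \<Longrightarrow> \<P>(m in M. C * scale n < \<bar>W n m\<bar>) \<le> \<delta>"
    using tight[OF \<open>0 < \<delta>\<close>] unfolding scale_def W_def by blast
  let ?C = "max 1 (max 0 C * sqrt (2 * \<gamma>))"
  have "\<forall>\<^sub>F n in sequentially. \<forall>n'. real n' \<le> \<gamma> * real n \<longrightarrow>
      \<P>(m in M. ?C * scale n < \<bar>W n' m\<bar>) \<le> \<delta>"
    using eventually_scale_mult_le[OF \<open>1 \<le> \<gamma>\<close>] eventually_scale_bounds[of "2 * real n0"] eventually_ge_at_top[of 1]
  proof eventually_elim
    case (elim n)
    show ?case
    proof (intro allI impI)
      fix n' assume n': "real n' \<le> \<gamma> * real n"
      show "\<P>(m in M. ?C * scale n < \<bar>W n' m\<bar>) \<le> \<delta>"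
      proof (cases "n0 \<le> n'")
        case True
        have "C * scale n' \<le> ?C * scale n"
        proof (cases "n' = 0")
          case True
          then show ?thesis using scale_nonneg[OF elim(3)] by (simp add: scale_def)
        next
          case False
          have "C * scale n' \<le> max 0 C * scale n'"
            using scale_nonneg[of n'] False by (intro mult_right_mono) auto
          also have "\<dots> \<le> max 0 C * (sqrt (2 * \<gamma>) * scale n)"
            using elim(1) n' by (intro mult_left_mono) auto
          also have "\<dots> \<le> ?C * scale n"
            using scale_nonneg[OF elim(3)] by (simp only: mult.assoc[symmetric]) (intro mult_right_mono, auto)
          finally show ?thesis .
        qed
        then have "\<P>(m in M. ?C * scale n < \<bar>W n' m\<bar>) \<le> \<P>(m in M. C * scale n' < \<bar>W n' m\<bar>)"
          by (intro finite_measure_mono) auto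
        with C[OF True] show ?thesis by simp
      next
        case False
        have "2 * real n' \<le> 2 * real n0" using False by simp
        also have "\<dots> \<le> scale n" using elim(2) by simp
        also have "\<dots> \<le> ?C * scale n"
          using mult_right_mono[of 1 ?C "scale n"] scale_nonneg[OF elim(3)] by simp
        finally have "2 * real n' \<le> ?C * scale n" .
        then have "\<P>(m in M. ?C * scale n < \<bar>W n' m\<bar>) \<le> prob {}"
          by (intro prob_mono_good) (use abs_W_le[of _ n'] in fastforce)+
        then show ?thesis using \<open>0 < \<delta>\<close> by simp
      qed
    qed
  qed
  then show ?thesis by blast
qed

lemma \<mu>_ge_1: "1 \<le> \<mu>"
  using v_pos v_le_1 by simp

text \<open>Inversion of the walk: a late hit of c puts the walk below c at the earlier time n1; an
  early hit puts it near or above c at n2, unless it has walked back over a block.\<close>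

lemma delay_tight:
  assumes "0 < \<delta>"
  shows "\<exists>C\<ge>1. \<forall>\<^sub>F n in sequentially. \<forall>k\<le>blocks n. \<P>(m in M. C * scale n < \<bar>del n k m\<bar>) \<le> \<delta>"
proof -
  \<comment> \<open>Sites are at most 2 n, and the deviation \<open>C * scale n\<close> is
    eventually at most n, so the times n1 and n2 are at most (2 \<mu> + 1) n.\<close>
  let ?\<gamma> = "2 * \<mu> + 1"
  have "0 < \<delta> / 3" "1 \<le> ?\<gamma>" using assms \<mu>_ge_1 by linarith+
  then obtain C' where C': "\<forall>\<^sub>F n in sequentially. \<forall>n'. real n' \<le> ?\<gamma> * real n \<longrightarrow>
      \<P>(m in M. C' * scale n < \<bar>W n' m\<bar>) \<le> \<delta> / 3"
    using uniform_tight by blast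
  \<comment> \<open>A deviation y in time is y v in space. The additional 2 pays for rounding n1 to
    an integer or for the length of one block, both at most \<open>scale n\<close>.\<close>
  define C where "C = max 1 ((\<bar>C'\<bar> + 2) * \<mu>)"
  have C_ge: "1 \<le> C" "(\<bar>C'\<bar> + 2) * \<mu> \<le> C" by (simp_all add: C_def)
  then have Cv: "\<bar>C'\<bar> + 2 \<le> C * v"
    using v_pos by (simp add: field_simps)
  have "\<forall>\<^sub>F n in sequentially. \<forall>k\<le>blocks n. \<P>(m in M. C * scale n < \<bar>del n k m\<bar>) \<le> \<delta>"
    using C' eventually_scale_bounds[of C] eventually_ge_at_top[of 9] order_tendstoD(2)[OF err_tendsto_0 \<open>0 < \<delta> / 3\<close>]
  proof eventually_elim
    case (elim n)
    have n: "1 \<le> n" "9 \<le> n" using elim by auto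
    show ?case
    proof (intro allI impI)
      fix k assume k: "k \<le> blocks n"
      define c where "c = k * block n"
      have "real c \<le> real (blocks n * block n)"
        using k unfolding c_def by (simp only: of_nat_le_iff mult_le_mono1)
      with blocks_block_le[OF n(2)] have c_le: "real c \<le> 2 * real n" by simp
      let ?y = "C * scale n"
      have y: "1 \<le> scale n" "sqrt (real n) \<le> scale n" "?y \<le> real n" "0 \<le> ?y"
      proof -
        have "1 * sqrt (real n) \<le> C * sqrt (real n)"
          using C_ge by (intro mult_right_mono) auto
        then show "sqrt (real n) \<le> scale n" using elim(2) by linarith
        show "0 \<le> ?y"
          using C_ge scale_nonneg[OF n(1)] by (intro mult_nonneg_nonneg) auto
      qed (use elim C_ge in auto)
      have yv: "(\<bar>C'\<bar> + 2) * scale n \<le> ?y * v"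
        using mult_right_mono[OF Cv, of "scale n"] y(1) by (simp add: algebra_simps)
      have c\<mu>: "real c * \<mu> \<le> 2 * real n * \<mu>"
        using c_le v_pos by (intro mult_right_mono) auto
      have C'_le: "C' * scale n \<le> \<bar>C'\<bar> * scale n"
        using y(1) by (intro mult_right_mono) auto
      define n1 where "n1 = nat \<lfloor>real c * \<mu> + ?y\<rfloor>"
      define n2 where "n2 = nat \<lfloor>real c * \<mu> - ?y\<rfloor>"
      have pos: "0 \<le> real c * \<mu>" using v_pos by (intro mult_nonneg_nonneg) auto
      have n1: "real n1 \<le> real c * \<mu> + ?y" "real c * \<mu> + ?y < real n1 + 1"
        using pos y(4) unfolding n1_def by (simp_all add: of_nat_nat)
      let ?A1 = "{m \<in> space M. C' * scale n < \<bar>W n1 m\<bar>}"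
      let ?A2 = "{m \<in> space M. C' * scale n < \<bar>W n2 m\<bar>}"
      let ?B = "{m \<in> space M. T (int c) m \<le> n2 \<and> Z n2 m \<le> int c - int (block n)}"
      have "\<P>(m in M. ?y < \<bar>del n k m\<bar>) \<le> prob (?A1 \<union> (?A2 \<union> ?B))"
      proof (rule prob_mono_good)
        fix m assume m: "m \<in> space M" "good m" "?y < \<bar>del n k m\<bar>"
        have d: "del n k m = real (T (int c) m) - real c * \<mu>"
          by (simp add: delay_def c_def)
        show "m \<in> ?A1 \<union> (?A2 \<union> ?B)"
        proof (cases "0 \<le> del n k m")
          case True
          then have "real n1 < real (T (int c) m)"
            using m(3) n1 d by simp
          then have "Z n1 m < int c" by (intro less_T) simp
          then have "W n1 m < real c - real n1 * v" by (simp add: W_def)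
          moreover have "(real c * \<mu> + ?y - 1) * v < real n1 * v"
            using n1 v_pos by (intro mult_strict_right_mono) auto
          moreover have "(real c * \<mu> + ?y - 1) * v = real c + ?y * v - v"
            using v_pos by (simp add: field_simps)
          ultimately have "W n1 m < v - ?y * v" by simp
          then have "W n1 m < - (\<bar>C'\<bar> * scale n)"
            using yv v_le_1 y(1) by (simp add: algebra_simps)
          then show ?thesis using m C'_le by auto
        next
          case False
          then have le: "real (T (int c) m) < real c * \<mu> - ?y"
            using m(3) d by simp
          then have n2: "real n2 \<le> real c * \<mu> - ?y" "real c * \<mu> - ?y < real n2 + 1"
            unfolding n2_def using of_nat_0_le_iff[of "T (int c) m"] by (auto simp: of_nat_nat)
          have "T (int c) m \<le> n2"
            using le n2 by linarith
          show ?thesis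
          proof (cases "Z n2 m \<le> int c - int (block n)")
            case True
            then show ?thesis using m \<open>T (int c) m \<le> n2\<close> by simp
          next
            case False
            then have "real c - real (block n) < real_of_int (Z n2 m)" by linarith
            then have "real c - real (block n) - real n2 * v < W n2 m" by (simp add: W_def)
            moreover have "real n2 * v \<le> (real c * \<mu> - ?y) * v"
              using n2 v_pos by (intro mult_right_mono) auto
            moreover have "(real c * \<mu> - ?y) * v = real c - ?y * v"
              using v_pos by (simp add: field_simps)
            ultimately have "?y * v - real (block n) < W n2 m" by simp
            then have "\<bar>C'\<bar> * scale n < W n2 m"
              using yv block_le[of n] y(1,2) by (simp add: algebra_simps)
            then show ?thesis using m C'_le by auto
          qed
        qed
      qed measurable
      also have "\<dots> \<le> prob ?A1 + (prob ?A2 + prob ?B)"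
        by (intro measure_Un_le[THEN order_trans] add_left_mono measure_Un_le) measurable
      also have "\<dots> \<le> \<delta> / 3 + (\<delta> / 3 + \<delta> / 3)"
      proof (intro add_mono)
        have "real n1 \<le> ?\<gamma> * real n"
          using n1 c\<mu> y(3) by (simp add: algebra_simps)
        then show "prob ?A1 \<le> \<delta> / 3" using elim(1) by blast
        have "real n2 \<le> ?\<gamma> * real n"
        proof -
          have "real n2 \<le> real c * \<mu> + ?y"
            using pos y(4) unfolding n2_def by (auto simp: nat_le_iff le_nat_iff intro: order_trans[of _ "max 0 (real c * \<mu> - ?y)"])
              linarith+
          then show ?thesis using c\<mu> y(3) by (simp add: algebra_simps)
        qed
        then show "prob ?A2 \<le> \<delta> / 3" using elim(1) by blast
        have "prob ?B \<le> back_bound (int (block n))"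
          by (rule prob_return_le) simp
        with back_bound_le_err[of n] elim(4) show "prob ?B \<le> \<delta> / 3" by simp
      qed
      finally show "\<P>(m in M. ?y < \<bar>del n k m\<bar>) \<le> \<delta>" by simp
    qed
  qed
  with C_ge(1) show ?thesis by blast
qed

text \<open>Only slow blocks matter: since \<mu> l <= scale n <= z and hitting times are
  nonnegative, a delay below - z cannot occur, so \<open>abs\<close> costs nothing. The upper limit
  z <= n makes ln n' smaller than l, as the range of the tail asymptotics demands.\<close>

lemma jump_bound:
  "\<exists>C\<ge>0. \<forall>\<^sub>F n in sequentially. \<forall>z. scale n \<le> z \<longrightarrow> z \<le> real n \<longrightarrow> jump abs n z \<le> C * real (block n) / z\<^sup>2"
proof -
  obtain n0 where n0: "\<And>n x. n \<ge> n0 \<Longrightarrow> x \<in> {sqrt (real n) * ln (real n) ^ 3 .. real n * v - ln (real n)} \<Longrightarrow>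
      \<bar>\<P>(m in M. W n m < - x) - K * ((real n * v - x) / x\<^sup>2)\<bar> \<le> 1 * ((real n * v - x) / x\<^sup>2)"
    using tail[OF zero_less_one] unfolding W_def by blast
  \<comment> \<open>As l <= z, the time n' is at most l \<mu> + z <= \<beta> z; so the lower end of
    the tail range for n' is of smaller order than z.\<close>
  define \<beta> where "\<beta> = 1 + \<mu>"
  have \<beta>: "2 \<le> \<beta>" using \<mu>_ge_1 by (simp add: \<beta>_def)
  have "\<forall>\<^sub>F z::real in at_top. sqrt (\<beta> * z) * ln (\<beta> * z) ^ 3 \<le> z * v / 2"
    using \<beta> v_pos by real_asymp
  then obtain z0 where z0: "\<And>z. z \<ge> z0 \<Longrightarrow> sqrt (\<beta> * z) * ln (\<beta> * z) ^ 3 \<le> z * v / 2"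
    unfolding eventually_at_top_linorder by blast
  have ln_le: "\<forall>\<^sub>F n in sequentially. ln (\<beta> * real n) \<le> sqrt (real n) - 1"
    using \<beta> by real_asymp
  let ?C = "4 * (K + 1) / v\<^sup>2"
  have "\<forall>\<^sub>F n in sequentially. \<forall>z. scale n \<le> z \<longrightarrow> z \<le> real n \<longrightarrow> jump abs n z \<le> ?C * real (block n) / z\<^sup>2"
    using ln_le eventually_scale_bounds[of "max \<mu> (max z0 (real n0 + 2))"] eventually_ge_at_top[of 9]
  proof eventually_elim
    case (elim n)
    have n: "1 \<le> n" using elim by auto
    show ?case
    proof (intro allI impI)
      fix z assume z: "scale n \<le> z" "z \<le> real n"
      let ?l = "real (block n)"
      have "\<mu> * ?l \<le> \<mu> * sqrt (real n)"
        using v_pos by (intro mult_left_mono block_le) auto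
      also have "\<dots> \<le> max \<mu> (max z0 (real n0 + 2)) * sqrt (real n)"
        by (intro mult_right_mono) auto
      also have "\<dots> \<le> scale n" using elim(2) by blast
      also have "\<dots> \<le> z" by (rule z)
      finally have lz: "\<mu> * ?l \<le> z" .
      have zz: "z0 \<le> z" "real n0 + 2 \<le> z" "0 < z"
        using elim z by auto
      define n' where "n' = nat \<lfloor>?l * \<mu> + z\<rfloor>"
      have "0 \<le> ?l * \<mu> + z" using v_pos zz by (intro add_nonneg_nonneg mult_nonneg_nonneg) auto
      then have n': "real n' \<le> ?l * \<mu> + z" "?l * \<mu> + z < real n' + 1"
        unfolding n'_def by (simp_all add: of_nat_nat)
      have l\<mu>: "0 \<le> ?l * \<mu>" using v_pos by (intro mult_nonneg_nonneg) auto
      have n'_ge: "n0 \<le> n'" "1 \<le> n'" using n' zz l\<mu> by linarith+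
      have l1: "1 \<le> ?l" using block_gt_0[OF n] by simp
      have "?l * 1 \<le> ?l * \<mu>" using v_pos v_le_1 by (intro mult_left_mono) auto
      have lz': "?l \<le> z" using lz \<open>?l * 1 \<le> ?l * \<mu>\<close> by (simp add: mult.commute)
      have n'_le: "real n' \<le> \<beta> * z"
      proof -
        have "?l * \<mu> \<le> z * \<mu>"
          using lz' v_pos by (intro mult_right_mono) auto
        then show ?thesis using n' by (simp add: \<beta>_def algebra_simps)
      qed
      \<comment> \<open>With this x the numerator n' v - x of the tail asymptotics is exactly l,
        while x stays above z v / 2 and controls the denominator.\<close>
      define x where "x = real n' * v - ?l"
      have x: "z * v / 2 \<le> x"
      proof -
        have "(?l * \<mu> + z - 1) * v \<le> real n' * v"
          using n' v_pos by (intro mult_right_mono) auto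
        moreover have "(?l * \<mu> + z - 1) * v = ?l + z * v - v"
          using v_pos by (simp add: field_simps)
        moreover have "v \<le> z * v / 2"
          using zz v_pos by simp
        ultimately show ?thesis unfolding x_def by linarith
      qed
      have x_pos: "0 < x"
      proof -
        have "0 < z * v / 2" using zz v_pos by simp
        with x show ?thesis by linarith
      qed
      have ln1: "ln (real n') \<le> ln (\<beta> * z)"
        using n'_le n'_ge by simp
      have "sqrt (real n') * ln (real n') ^ 3 \<le> sqrt (\<beta> * z) * ln (\<beta> * z) ^ 3"
        using n'_le n'_ge ln1 by (intro mult_mono power_mono) auto
      then have x_low: "sqrt (real n') * ln (real n') ^ 3 \<le> x"
        using z0[OF zz(1)] x by linarith
      have "\<beta> * z \<le> \<beta> * real n" using z \<beta> by (intro mult_left_mono) auto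
      then have "ln (\<beta> * z) \<le> ln (\<beta> * real n)"
        using zz \<beta> by simp
      with ln1 elim(1) block_ge[of n] have "ln (real n') \<le> ?l" by linarith
      then have x_in: "x \<in> {sqrt (real n') * ln (real n') ^ 3 .. real n' * v - ln (real n')}"
        using x_low by (simp add: x_def)
      have "jump abs n z \<le> \<P>(m in M. W n' m < - x)"
        unfolding jump_prob_def
      proof (rule prob_mono_good)
        fix m assume m: "m \<in> space M" "good m" "z < \<bar>del n 1 m\<bar>"
        have d: "del n 1 m = real (T (int (block n)) m) - ?l * \<mu>"
          by (simp add: delay_def)
        have "?l * \<mu> + z < real (T (int (block n)) m)"
        proof (cases "0 \<le> del n 1 m")
          case True
          then show ?thesis using m(3) d by simp
        next
          case False
          then have "real (T (int (block n)) m) < ?l * \<mu> - z" using m(3) d by simp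
          then show ?thesis using lz of_nat_0_le_iff[of "T (int (block n)) m"] by (simp add: mult.commute)
        qed
        then have "n' < T (int (block n)) m" using n' by simp
        then have "Z n' m < int (block n)" by (rule less_T)
        then show "m \<in> {m \<in> space M. W n' m < - x}" using m by (simp add: W_def x_def)
      qed measurable
      also have "\<dots> \<le> (K + 1) * ((real n' * v - x) / x\<^sup>2)"
        using n0[OF n'_ge(1) x_in] by (simp only: ring_distribs)
      also have "\<dots> = (K + 1) * (?l / x\<^sup>2)" by (simp add: x_def)
      also have "\<dots> \<le> (K + 1) * (?l / (z * v / 2)\<^sup>2)"
        using x x_pos zz v_pos K_nonneg by (intro mult_left_mono divide_left_mono power_mono mult_pos_pos zero_less_power) auto
      also have "\<dots> = ?C * ?l / z\<^sup>2"
        using v_pos zz by (simp add: field_simps power2_eq_square)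
      finally show "jump abs n z \<le> ?C * ?l / z\<^sup>2" .
    qed
  qed
  moreover have "0 \<le> ?C" using K_nonneg by simp
  ultimately show ?thesis by blast
qed

end

section \<open>Truncated second moments of the tails\<close>

text \<open>Three behaviours against the weight 9^i: the ratio 9 / 20 leaves a geometric tail
  governed by the first level, the middle term contributes the same at every level, and the constant
  is dominated by the last level.\<close>

lemma sum_geometric_weights:
  fixes k h :: real
  assumes "0 \<le> k" "0 \<le> h"
  shows "(\<Sum>i=j..I. (3 ^ i)\<^sup>2 * (1 / 60 / 20 ^ i + k / 9 ^ i + h)) \<le> (9 / 20) ^ j + k * (real I + 1) + 2 * h * (3 ^ I) ^ 2"
proof -
  have sq: "(3 ^ i)\<^sup>2 = (9 :: real) ^ i" for i
    by (simp add: power2_eq_square power_mult_distrib[symmetric])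
  have "(\<Sum>i=j..I. (3 ^ i)\<^sup>2 * (1 / 60 / 20 ^ i + k / 9 ^ i + h)) =
      (\<Sum>i=j..I. (9 / 20) ^ i) / 60 + (\<Sum>i=j..I. k) + h * (\<Sum>i=j..I. 9 ^ i)"
    unfolding sum_distrib_left sum_divide_distrib sum.distrib[symmetric]
    by (rule sum.cong) (simp_all add: sq field_simps power_divide)
  also have "\<dots> \<le> (9 / 20) ^ j + k * (real I + 1) + h * (2 * (3 ^ I) ^ 2)"
  proof (intro add_mono mult_left_mono)
    have "(\<Sum>i=j..I. (9 / 20 :: real) ^ i) \<le> 2 * (9 / 20) ^ j"
      by (subst sum_gp) (simp add: field_simps)
    moreover have "0 \<le> (9 / 20 :: real) ^ j" by simp
    ultimately show "(\<Sum>i=j..I. (9 / 20 :: real) ^ i) / 60 \<le> (9 / 20) ^ j" by linarith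
    show "(\<Sum>i=j..I. k) \<le> k * (real I + 1)"
      using assms by (auto simp: mult.commute intro!: mult_left_mono)
    have "(\<Sum>i=j..I. (9 :: real) ^ i) \<le> 2 * 9 ^ I"
      by (subst sum_gp) (simp add: field_simps)
    then show "(\<Sum>i=j..I. (9 :: real) ^ i) \<le> 2 * (3 ^ I) ^ 2"
      by (simp add: sq)
  qed (use assms in auto)
  finally show ?thesis by (simp add: algebra_simps)
qed

lemma between_powers_of_3:
  fixes x :: real
  assumes "L * 3 ^ j < x" "x \<le> L * 3 ^ Suc I" "j \<le> I"
  shows "\<exists>i\<in>{j..I}. L * 3 ^ i < x \<and> x \<le> L * 3 ^ Suc i"
  using assms(3,2)
proof (induction I rule: dec_induct)
  case base
  then show ?case using assms(1) by auto
next
  case (step I)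
  show ?case
  proof (cases "x \<le> L * 3 ^ Suc I")
    case True
    then obtain i where "i \<in> {j..I}" "L * 3 ^ i < x \<and> x \<le> L * 3 ^ Suc i"
      using step.IH by blast
    then show ?thesis by (intro bexI[of _ i]) auto
  next
    case False
    then show ?thesis using step by (intro bexI[of _ "Suc I"]) auto
  qed
qed

text \<open>On the shell between two consecutive levels the square is at most 9 times the square of
  the lower level; the event of the shell is then enlarged to the tail event.\<close>

lemma (in prob_space) truncated_second_moment_le:
  assumes [measurable]: "X \<in> borel_measurable M" and "0 < L"
  shows "(\<integral>m. (X m)\<^sup>2 * of_bool (L * 3 ^ j < X m \<and> X m \<le> L * 3 ^ Suc I) \<partial>M) \<le>
    (\<Sum>i=j..I. 9 * (L * 3 ^ i) ^ 2 * \<P>(m in M. L * 3 ^ i < X m))"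
proof (cases "j \<le> I")
  case True
  have "(\<integral>m. (X m)\<^sup>2 * of_bool (L * 3 ^ j < X m \<and> X m \<le> L * 3 ^ Suc I) \<partial>M) \<le>
      (\<integral>m. (\<Sum>i=j..I. 9 * (L * 3 ^ i) ^ 2 * indicat_real {m \<in> space M. L * 3 ^ i < X m} m) \<partial>M)"
  proof (rule integral_mono')
    show "integrable M (\<lambda>m. \<Sum>i=j..I. 9 * (L * 3 ^ i) ^ 2 * indicat_real {m \<in> space M. L * 3 ^ i < X m} m)"
      by (intro Bochner_Integration.integrable_sum integrable_mult_right integrable_real_indicator)
        (auto simp: emeasure_eq_measure)
  next
    fix m assume m: "m \<in> space M"
    let ?f = "\<lambda>i. 9 * (L * 3 ^ i) ^ 2 * indicat_real {m \<in> space M. L * 3 ^ i < X m} m"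
    show "(X m)\<^sup>2 * of_bool (L * 3 ^ j < X m \<and> X m \<le> L * 3 ^ Suc I) \<le> (\<Sum>i=j..I. ?f i)"
    proof (cases "L * 3 ^ j < X m \<and> X m \<le> L * 3 ^ Suc I")
      case True
      then obtain i where i: "i \<in> {j..I}" "L * 3 ^ i < X m" "X m \<le> L * 3 ^ Suc i"
        using between_powers_of_3[of L j "X m" I] \<open>j \<le> I\<close> by blast
      have "0 < L * 3 ^ i" using \<open>0 < L\<close> by simp
      then have "(X m)\<^sup>2 \<le> (L * 3 ^ Suc i)\<^sup>2"
        using i by (intro power_mono) auto
      also have "\<dots> = ?f i"
        using i m by (simp add: power_mult_distrib)
      also have "\<dots> \<le> (\<Sum>i=j..I. ?f i)"
        using i by (intro member_le_sum) auto
      finally show ?thesis using True by simp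
    qed (auto intro!: sum_nonneg)
  qed (auto intro!: sum_nonneg)
  also have "\<dots> = (\<Sum>i=j..I. 9 * (L * 3 ^ i) ^ 2 * \<P>(m in M. L * 3 ^ i < X m))"
    by (subst Bochner_Integration.integral_sum)
      (auto intro!: integrable_mult_right integrable_real_indicator simp: emeasure_eq_measure)
  finally show ?thesis .
next
  case False
  then have "L * 3 ^ Suc I \<le> L * 3 ^ j"
    using \<open>0 < L\<close> by (intro mult_left_mono power_increasing) auto
  then have "(\<lambda>m. (X m)\<^sup>2 * of_bool (L * 3 ^ j < X m \<and> X m \<le> L * 3 ^ Suc I)) = (\<lambda>_. 0)"
    by (intro ext) (simp del: power_Suc)
  then show ?thesis using False by (simp del: power_Suc)
qed

context rwre_tails
begin

section \<open>Decay of the maximal tails along powers of 3\<close>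

lemma max_tail_le_abs:
  assumes c: "gauge_fun c" and "\<And>x. c x \<le> \<bar>x\<bar>"
  shows "max_tail c \<mu> l N y \<le> max_tail abs \<mu> l N y"
  unfolding max_tail_def
  by (intro finite_measure_mono) (auto intro: less_le_trans[OF _ assms(2)])

lemma jump_prob_le_abs:
  "jump_prob (\<lambda>x. x) \<mu> l z \<le> jump_prob abs \<mu> l z"
  unfolding jump_prob_def by (intro finite_measure_mono) auto

text \<open>A block takes a nonnegative time, so it cannot be ahead by more than its mean crossing
  time.\<close>

lemma jump_prob_uminus:
  assumes "real l * \<mu> \<le> z"
  shows "jump_prob uminus \<mu> l z = 0"
proof -
  have "\<not> z < - delay \<mu> l 1 m" for m
    using assms unfolding delay_def by simp
  then show ?thesis by (simp add: jump_prob_def)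
qed

text \<open>Tightness and Ottaviani's inequality give level 0; the doubling inequality with z = y /
  2 leads from each level to the next. On the fast side z >= \<mu> l, so there is no jump term. On
  the slow side the blocks have total length at most 2 n, and n / y^2 is 1 / (B^2 ln n 9^i) at level
  i. The restriction to levels up to n is inherited from \<open>jump_bound\<close>.\<close>

lemma mtail_decay:
  "\<exists>B>0. \<exists>k\<ge>0. \<forall>\<^sub>F n in sequentially. \<forall>i.
    mtail uminus n (B * scale n * 3 ^ i) \<le> 1 / 60 / 20 ^ i + 2 * err n \<and>
    (B * scale n * 3 ^ i \<le> real n \<longrightarrow>
      mtail (\<lambda>x. x) n (B * scale n * 3 ^ i) \<le> 1 / 60 / 20 ^ i + 18 * (k / ln (real n)) / 9 ^ i + 2 * err n)"
proof -
  \<comment> \<open>The start value 1 / 60 is shared out in Ottaviani's inequality: 2 / 240 for the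
    endpoint, 2 / 480 for the jumps and 2 / 480 for backtracking.\<close>
  obtain C where C: "1 \<le> C" and ev_C: "\<forall>\<^sub>F n in sequentially. \<forall>k\<le>blocks n. \<P>(m in M. C * scale n < \<bar>del n k m\<bar>) \<le> 1 / 240"
    using delay_tight[of "1 / 240"] by auto
  obtain J where J: "0 \<le> J" and ev_J: "\<forall>\<^sub>F n in sequentially. \<forall>z. scale n \<le> z \<longrightarrow> z \<le> real n \<longrightarrow>
      jump abs n z \<le> J * real (block n) / z\<^sup>2"
    using jump_bound by blast
  define B where "B = 3 * C"
  \<comment> \<open>From the jump term at z = y / 2: 2 J n / (y / 2)^2 = 8 J n / y^2. The 3 in B is
    2 y + z with y = z = \<open>C * scale n\<close>.\<close>
  define k where "k = 8 * J / B\<^sup>2"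
  have B: "3 \<le> B" using C by (simp add: B_def)
  have k: "0 \<le> k" using J by (simp add: k_def)
  have ev_k: "\<forall>\<^sub>F n in sequentially. k / ln (real n) \<le> 1 / 1000" by real_asymp
  have ev_J': "\<forall>\<^sub>F n in sequentially. 4 * J / ln (real n) \<le> 1 / 240" by real_asymp
  have "\<forall>\<^sub>F n in sequentially. \<forall>i.
    mtail uminus n (B * scale n * 3 ^ i) \<le> 1 / 60 / 20 ^ i + 2 * err n \<and>
    (B * scale n * 3 ^ i \<le> real n \<longrightarrow>
      mtail (\<lambda>x. x) n (B * scale n * 3 ^ i) \<le> 1 / 60 / 20 ^ i + 18 * (k / ln (real n)) / 9 ^ i + 2 * err n)"
    using ev_C ev_J ev_k ev_J' eventually_scale_bounds[of "max C (2 * \<mu>)"] eventually_ge_at_top[of 9]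
      order_tendstoD(2)[OF err_tendsto_0, of "1 / 480", simplified]
  proof eventually_elim
    case (elim n)
    have n: "1 \<le> n" "2 \<le> n" "9 \<le> n" using elim by auto
    have s: "0 < scale n" "scale n ^ 2 = real n * ln (real n)"
      using scale_pos[OF n(2)] scale_sq[OF n(1)] by auto
    have ln: "0 < ln (real n)" using n by simp
    have jump_blocks: "real (blocks n) * jump abs n z \<le> 2 * J * real n / z\<^sup>2"
      if "scale n \<le> z" "z \<le> real n" for z
    proof -
      have "real (blocks n) * jump abs n z \<le> real (blocks n) * (J * real (block n) / z\<^sup>2)"
        using elim(2) that by (intro mult_left_mono) auto
      also have "\<dots> = J * real (blocks n * block n) / z\<^sup>2" by simp
      also have "\<dots> \<le> J * (2 * real n) / z\<^sup>2"
        using blocks_block_le[OF n(3)] J by (intro divide_right_mono mult_left_mono) auto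
      finally show ?thesis by (simp add: mult_ac)
    qed
    have "C * scale n \<le> max C (2 * \<mu>) * scale n"
      using s by (intro mult_right_mono) auto
    with elim(5) have Cn: "C * scale n \<le> real n" by linarith
    have Cs: "scale n \<le> C * scale n" using C s by simp
    have base: "mtail abs n (B * scale n) \<le> 1 / 60"
    proof -
      let ?y = "C * scale n"
      have "mtail abs n (2 * ?y + ?y) \<le> 2 * \<P>(m in M. ?y < \<bar>del n (blocks n) m\<bar>)
          + 2 * real (blocks n) * jump abs n ?y + 2 * real (blocks n) * back_bound (int (block n))"
        using C s elim(1) by (intro max_tail_le_endpoint) (auto intro: order_trans)
      moreover have "\<P>(m in M. ?y < \<bar>del n (blocks n) m\<bar>) \<le> 1 / 240"
        using elim(1) by blast
      moreover have "real (blocks n) * jump abs n ?y \<le> 1 / 480"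
      proof -
        have "real (blocks n) * jump abs n ?y \<le> 2 * J * real n / ?y\<^sup>2"
          by (rule jump_blocks[OF Cs Cn])
        also have "\<dots> \<le> 2 * J * real n / scale n ^ 2"
          using Cs s J n by (intro divide_left_mono power_mono mult_pos_pos zero_less_power) auto
        also have "\<dots> = (4 * J / ln (real n)) / 2"
          using ln n by (simp add: s(2) field_simps)
        finally show ?thesis using elim(4) by simp
      qed
      moreover have "real (blocks n) * back_bound (int (block n)) \<le> 1 / 480"
        using elim(7) by (simp add: err_def)
      ultimately show ?thesis by (simp add: B_def algebra_simps)
    qed
    have step: "2 * y + 2 * (y / 2) = B * scale n * 3 ^ Suc i" if "y = B * scale n * 3 ^ i" for y i
      by (simp add: that)
    have y_ge: "3 * scale n \<le> B * scale n * 3 ^ i" for i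
    proof -
      have "3 * scale n * 1 \<le> B * scale n * 3 ^ i"
        using B s by (intro mult_mono) auto
      then show ?thesis by simp
    qed
    have right: "mtail uminus n (B * scale n * 3 ^ i) \<le> 1 / 60 / 20 ^ i + 18 * 0 / 9 ^ i + 2 * err n" for i
    proof (rule square_recursion_bound[where n = i])
      show "mtail uminus n (B * scale n * 3 ^ 0) \<le> 1 / 60"
        using max_tail_le_abs[OF gauge_fun_uminus abs_ge_minus_self, of "block n" "blocks n" "B * scale n"] base by simp
      fix i
      let ?y = "B * scale n * 3 ^ i"
      have "2 * \<mu> * sqrt (real n) \<le> max C (2 * \<mu>) * sqrt (real n)"
        by (intro mult_right_mono) auto
      then have "2 * \<mu> * sqrt (real n) \<le> scale n" using elim(5) by linarith
      moreover have "2 * \<mu> * real (block n) \<le> 2 * \<mu> * sqrt (real n)"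
        using v_pos by (intro mult_left_mono block_le) auto
      ultimately have "2 * \<mu> * real (block n) \<le> ?y"
        using y_ge[of i] s by linarith
      then have l: "real (block n) * \<mu> \<le> ?y / 2" by (simp add: mult_ac)
      have "mtail uminus n (2 * ?y + 2 * (?y / 2)) \<le> (mtail uminus n ?y)\<^sup>2 +
          real (blocks n) * jump uminus n (?y / 2) + real (blocks n) * back_bound (int (block n))"
        using y_ge[of i] s by (intro max_tail_doubling[OF gauge_fun_uminus]) linarith+
      then show "mtail uminus n (B * scale n * 3 ^ Suc i) \<le> (mtail uminus n ?y)\<^sup>2 + 0 / 9 ^ i + err n"
        unfolding step[OF refl] jump_prob_uminus[OF l] by (simp add: err_def)
    qed (use elim(7) err_nonneg[of n] in \<open>auto simp: max_tail_nonneg\<close>)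
    have left: "mtail (\<lambda>x. x) n (B * scale n * 3 ^ i) \<le> 1 / 60 / 20 ^ i + 18 * (k / ln (real n)) / 9 ^ i + 2 * err n"
      if small: "B * scale n * 3 ^ i \<le> real n" for i
    proof (rule square_recursion_bound[where n = i])
      show "mtail (\<lambda>x. x) n (B * scale n * 3 ^ 0) \<le> 1 / 60"
        using max_tail_le_abs[OF gauge_fun_id abs_ge_self, of "block n" "blocks n" "B * scale n"] base by simp
      fix i' assume "i' < i"
      let ?y = "B * scale n * 3 ^ i'"
      have "?y \<le> B * scale n * 3 ^ i"
        using \<open>i' < i\<close> B s by (intro mult_left_mono power_increasing) auto
      with small have y: "scale n \<le> ?y / 2" "?y / 2 \<le> real n"
        using y_ge[of i'] s by auto
      have "real (blocks n) * jump (\<lambda>x. x) n (?y / 2) \<le> real (blocks n) * jump abs n (?y / 2)"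
        by (intro mult_left_mono jump_prob_le_abs) auto
      also have "\<dots> \<le> 2 * J * real n / (?y / 2)\<^sup>2"
        by (rule jump_blocks[OF y])
      also have "(?y / 2)\<^sup>2 = B\<^sup>2 * (real n * ln (real n)) * (3 ^ i')\<^sup>2 / 4"
        by (simp add: power_mult_distrib power_divide s(2))
      also have "(3 ^ i')\<^sup>2 = (9 :: real) ^ i'"
        by (simp add: power2_eq_square power_mult_distrib[symmetric])
      also have "2 * J * real n / (B\<^sup>2 * (real n * ln (real n)) * 9 ^ i' / 4) = k / ln (real n) / 9 ^ i'"
        using ln n B by (simp add: k_def field_simps)
      finally have jmp: "real (blocks n) * jump (\<lambda>x. x) n (?y / 2) \<le> k / ln (real n) / 9 ^ i'" .
      have "mtail (\<lambda>x. x) n (2 * ?y + 2 * (?y / 2)) \<le> (mtail (\<lambda>x. x) n ?y)\<^sup>2 +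
          real (blocks n) * jump (\<lambda>x. x) n (?y / 2) + real (blocks n) * back_bound (int (block n))"
        using y s by (intro max_tail_doubling[OF gauge_fun_id]) linarith+
      with jmp show "mtail (\<lambda>x. x) n (B * scale n * 3 ^ Suc i') \<le> (mtail (\<lambda>x. x) n ?y)\<^sup>2 + k / ln (real n) / 9 ^ i' + err n"
        unfolding step[OF refl] by (simp add: err_def)
    qed (use elim(3,7) err_nonneg[of n] k ln in \<open>auto simp: max_tail_nonneg\<close>)
    show ?case using right left by auto
  qed
  moreover have "0 < B" using B by simp
  ultimately show ?thesis using k by blast
qed

section \<open>Second moments between the diffusive scale and the far tail\<close>

lemma small_power:
  assumes "0 < \<epsilon>"
  shows "\<exists>j. D * (9 / 20 :: real) ^ j \<le> \<epsilon>"
proof -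
  have "(\<lambda>j. D * (9 / 20 :: real) ^ j) \<longlonglongrightarrow> D * 0"
    by (intro tendsto_mult_left LIMSEQ_realpow_zero) auto
  then have "\<forall>\<^sub>F j in sequentially. D * (9 / 20 :: real) ^ j < \<epsilon>"
    using assms by (intro order_tendstoD) auto
  then show ?thesis
    by (auto simp: eventually_sequentially intro: less_imp_le)
qed

text \<open>Without a jump term the levels may run all the way up to order n, where |W n| <= 2 n
  ends the sum; what remains is the geometric tail from level j and the backtracking error times
  n^2.\<close>

lemma right_tail_moment:
  assumes "0 < \<epsilon>"
  shows "\<exists>c>0. \<forall>\<^sub>F n in sequentially. (\<integral>m. W n m ^ 2 * of_bool (c * scale n < W n m) \<partial>M) \<le> \<epsilon> * scale n ^ 2"
proof -
  obtain B where B: "0 < B" and ev: "\<forall>\<^sub>F n in sequentially. \<forall>i. mtail uminus n (B * scale n * 3 ^ i) \<le> 1 / 60 / 20 ^ i + 2 * err n"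
    using mtail_decay unfolding all_conj_distrib eventually_conj_iff by blast
  \<comment> \<open>D is 9 L^2 divided by the squared scale, where the spatial level L = 2 v B scale
    n corresponds to the delay level B scale n through x \<mu> / 2 in
    \<open>prob_right_le\<close>.\<close>
  define D where "D = 36 * v\<^sup>2 * B\<^sup>2"
  have D: "0 < D" using B v_pos by (simp add: D_def)
  obtain j where j: "D * (9 / 20 :: real) ^ j \<le> \<epsilon> / 2"
    using small_power[of "\<epsilon> / 2" D] assms by auto
  have "(\<lambda>n. D * 36 * (err n * real n ^ 2)) \<longlonglongrightarrow> 0"
    by (intro tendsto_mult_right_zero err_tendsto)
  then have ev_err: "\<forall>\<^sub>F n in sequentially. D * 36 * (err n * real n ^ 2) < \<epsilon> / 2"
    using assms by (intro order_tendstoD(2)) auto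
  define c where "c = 2 * v * B * 3 ^ j"
  have "\<forall>\<^sub>F n in sequentially. (\<integral>m. W n m ^ 2 * of_bool (c * scale n < W n m) \<partial>M) \<le> \<epsilon> * scale n ^ 2"
    using ev ev_err eventually_scale_bounds[of "2 / (v * B)"] eventually_ge_at_top[of 2]
  proof eventually_elim
    case (elim n)
    have n: "1 \<le> n" using elim by simp
    have s: "0 < scale n" by (rule scale_pos) (use elim in simp)
    define L where "L = 2 * v * B * scale n"
    have L: "0 < L" using v_pos B s by (simp add: L_def)
    have "2 \<le> v * B * scale n" "2 * sqrt (real n) \<le> v * B * scale n"
      using elim(3) v_pos B by (auto simp: field_simps)
    then have L_ge: "4 \<le> L" "4 * sqrt (real n) \<le> L" unfolding L_def by linarith+
    obtain I where I: "real n \<le> 3 ^ I" "3 ^ I \<le> 3 * real n"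
      using power_3_between[of "real n"] n by (metis of_nat_1 of_nat_le_iff)
    have "(\<integral>m. W n m ^ 2 * of_bool (c * scale n < W n m) \<partial>M) =
        (\<integral>m. W n m ^ 2 * of_bool (L * 3 ^ j < W n m \<and> W n m \<le> L * 3 ^ Suc I) \<partial>M)"
    proof (rule integral_cong_AE)
      have "2 * real n \<le> L * 3 ^ Suc I"
        using mult_mono[of 4 L "real n" "3 ^ I"] L_ge I by simp
      then have le: "W n m \<le> L * 3 ^ Suc I" if "good m" for m
        using abs_W_le[OF that, of n] by linarith
      have cL: "c * scale n = L * 3 ^ j" by (simp add: c_def L_def)
      show "AE m in M. W n m ^ 2 * of_bool (c * scale n < W n m) =
          W n m ^ 2 * of_bool (L * 3 ^ j < W n m \<and> W n m \<le> L * 3 ^ Suc I)"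
        using AE_good by eventually_elim (simp add: cL le del: power_Suc)
    qed measurable
    also have "\<dots> \<le> (\<Sum>i=j..I. 9 * (L * 3 ^ i) ^ 2 * \<P>(m in M. L * 3 ^ i < W n m))"
      by (rule truncated_second_moment_le[OF measurable_W L])
    also have "\<dots> \<le> (\<Sum>i=j..I. 9 * (L * 3 ^ i) ^ 2 * (1 / 60 / 20 ^ i + 0 / 9 ^ i + 2 * err n))"
    proof (intro sum_mono mult_left_mono)
      fix i
      have "L * 1 \<le> L * 3 ^ i" using L by (intro mult_left_mono) auto
      moreover have "0 < sqrt (real n)" using n by simp
      ultimately have "2 * real (block n) < L * 3 ^ i"
        using L_ge block_le[of n] by linarith
      from prob_right_le[OF n this] have "\<P>(m in M. L * 3 ^ i < W n m) \<le> mtail uminus n (L * 3 ^ i * \<mu> / 2)" .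
      also have "L * 3 ^ i * \<mu> / 2 = B * scale n * 3 ^ i"
        using v_pos by (simp add: L_def)
      finally show "\<P>(m in M. L * 3 ^ i < W n m) \<le> 1 / 60 / 20 ^ i + 0 / 9 ^ i + 2 * err n"
        using elim(1) by (smt (verit, best) div_0)
    qed simp
    also have "\<dots> = 9 * L\<^sup>2 * (\<Sum>i=j..I. (3 ^ i)\<^sup>2 * (1 / 60 / 20 ^ i + 0 / 9 ^ i + 2 * err n))"
      unfolding sum_distrib_left by (simp only: power_mult_distrib mult.assoc)
    also have "\<dots> \<le> 9 * L\<^sup>2 * ((9 / 20) ^ j + 0 * (real I + 1) + 2 * (2 * err n) * (3 ^ I) ^ 2)"
      using err_nonneg[of n] by (intro mult_left_mono sum_geometric_weights) auto
    also have "\<dots> \<le> 9 * L\<^sup>2 * ((9 / 20) ^ j + 36 * (err n * real n ^ 2))"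
    proof -
      have "(3 ^ I) ^ 2 \<le> (3 * real n)\<^sup>2" using I by (intro power_mono) auto
      then have "4 * err n * (3 ^ I) ^ 2 \<le> 4 * err n * (3 * real n)\<^sup>2"
        using err_nonneg[of n] by (intro mult_left_mono) auto
      also have "\<dots> = 36 * (err n * real n ^ 2)" by (simp add: power_mult_distrib)
      finally show ?thesis by (intro mult_left_mono) auto
    qed
    also have "9 * L\<^sup>2 = D * scale n ^ 2" by (simp add: L_def D_def power_mult_distrib)
    also have "D * scale n ^ 2 * ((9 / 20) ^ j + 36 * (err n * real n ^ 2)) =
        (D * (9 / 20) ^ j + D * 36 * (err n * real n ^ 2)) * scale n ^ 2"
      by (simp add: algebra_simps)
    also have "\<dots> \<le> \<epsilon> * scale n ^ 2"
      using j elim(2) by (intro mult_right_mono) auto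
    finally show ?case .
  qed
  moreover have "0 < c" using v_pos B by (simp add: c_def)
  ultimately show ?thesis by blast
qed

definition far :: "nat \<Rightarrow> real" where
  "far n = sqrt (real n) * ln (real n) ^ 3"

text \<open>Here each level adds order 1 / ln n, so the number of levels matters. Stopping at
  \<open>far\<close> leaves about log (ln n ^ 3) of them, hence a vanishing total; summing on to
  order n would leave a contribution of order one, for which the crude bound is replaced by the
  exact asymptotics.\<close>

lemma left_tail_moment:
  assumes "0 < \<epsilon>"
  shows "\<exists>c>0. \<forall>\<^sub>F n in sequentially.
    (\<integral>m. W n m ^ 2 * of_bool (W n m < - (c * scale n) \<and> - far n \<le> W n m) \<partial>M) \<le> \<epsilon> * scale n ^ 2"
proof -
  obtain B k where B: "0 < B" and k: "0 \<le> k" and ev: "\<forall>\<^sub>F n in sequentially. \<forall>i. B * scale n * 3 ^ i \<le> real n \<longrightarrow>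
      mtail (\<lambda>x. x) n (B * scale n * 3 ^ i) \<le> 1 / 60 / 20 ^ i + 18 * (k / ln (real n)) / 9 ^ i + 2 * err n"
    using mtail_decay unfolding all_conj_distrib eventually_conj_iff by blast
  define D where "D = 36 * v\<^sup>2 * B\<^sup>2"
  have D: "0 < D" using B v_pos by (simp add: D_def)
  obtain j where j: "D * (9 / 20 :: real) ^ j \<le> \<epsilon> / 3"
    using small_power[of "\<epsilon> / 3" D] assms by auto
  have "(\<lambda>n. D * 54 * (err n * real n ^ 2)) \<longlonglongrightarrow> 0"
    by (intro tendsto_mult_right_zero err_tendsto)
  then have ev_err: "\<forall>\<^sub>F n in sequentially. D * 54 * (err n * real n ^ 2) < \<epsilon> / 3"
    using assms by (intro order_tendstoD(2)) auto
  have "(\<lambda>n. D * (18 * (k / ln (real n)) * (log 3 (ln (real n) ^ 3) + 2))) \<longlonglongrightarrow> 0"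
    unfolding log_def by real_asymp
  then have ev_log: "\<forall>\<^sub>F n in sequentially. D * (18 * (k / ln (real n)) * (log 3 (ln (real n) ^ 3) + 2)) < \<epsilon> / 3"
    using assms by (intro order_tendstoD(2)) auto
  have ev_ln: "\<forall>\<^sub>F n in sequentially. 1 \<le> ln (real n) ^ 3" by real_asymp
  have ev_ln': "\<forall>\<^sub>F n in sequentially. ln (real n) ^ 3 \<le> real n" by real_asymp
  \<comment> \<open>Keeps every level up to I below n / 2. This lies in the range of the slow side
    recursion, and after the factor 2 v it gives x <= n v, as \<open>prob_left_le\<close>
    requires.\<close>
  have ev_small: "\<forall>\<^sub>F n in sequentially. B * sqrt (real n * ln (real n)) * (3 * ln (real n) ^ 3) \<le> real n / 2"
    by real_asymp
  define c where "c = 2 * v * B * 3 ^ j"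
  have "\<forall>\<^sub>F n in sequentially.
    (\<integral>m. W n m ^ 2 * of_bool (W n m < - (c * scale n) \<and> - far n \<le> W n m) \<partial>M) \<le> \<epsilon> * scale n ^ 2"
    using ev ev_err ev_log ev_ln ev_ln' ev_small[folded scale_def] eventually_scale_bounds[of "4 / (v * B)"] eventually_ge_at_top[of 2]
  proof eventually_elim
    case (elim n)
    have n: "1 \<le> n" using elim by simp
    have s: "0 < scale n" by (rule scale_pos) (use elim in simp)
    have ln: "0 < ln (real n)" using elim by simp
    define L where "L = 2 * v * B * scale n"
    have L: "0 < L" using v_pos B s by (simp add: L_def)
    have "4 \<le> v * B * scale n" "4 * sqrt (real n) \<le> v * B * scale n"
      using elim(7) v_pos B by (auto simp: field_simps)
    then have L_ge: "8 * sqrt (real n) \<le> L" unfolding L_def by linarith+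
    obtain I where I: "ln (real n) ^ 3 \<le> 3 ^ I" "3 ^ I \<le> 3 * ln (real n) ^ 3" "real I \<le> log 3 (ln (real n) ^ 3) + 1"
      using power_3_between[OF elim(4)] by blast
    have "(\<integral>m. W n m ^ 2 * of_bool (W n m < - (c * scale n) \<and> - far n \<le> W n m) \<partial>M) \<le>
        (\<integral>m. (- W n m) ^ 2 * of_bool (L * 3 ^ j < - W n m \<and> - W n m \<le> L * 3 ^ Suc I) \<partial>M)"
    proof (rule integral_mono_AE')
      have "8 * sqrt (real n) * ln (real n) ^ 3 \<le> L * 3 ^ I"
        using L_ge I elim(4) L ln by (intro mult_mono) auto
      moreover have "0 \<le> sqrt (real n) * ln (real n) ^ 3" using ln by simp
      ultimately have "far n \<le> L * 3 ^ Suc I"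
        unfolding far_def power_Suc by linarith
      then have le: "- x \<le> L * 3 ^ Suc I" if "- far n \<le> x" for x
        using that by linarith
      have cL: "c * scale n = L * 3 ^ j" by (simp add: c_def L_def)
      show "AE m in M. W n m ^ 2 * of_bool (W n m < - (c * scale n) \<and> - far n \<le> W n m) \<le>
          (- W n m) ^ 2 * of_bool (L * 3 ^ j < - W n m \<and> - W n m \<le> L * 3 ^ Suc I)"
        by (rule AE_I2) (auto simp: cL le simp del: power_Suc)
      show "integrable M (\<lambda>m. (- W n m) ^ 2 * of_bool (L * 3 ^ j < - W n m \<and> - W n m \<le> L * 3 ^ Suc I))"
      proof (rule integrable_const_bound[where B = "(2 * real n)\<^sup>2"])
        show "AE m in M. norm ((- W n m) ^ 2 * of_bool (L * 3 ^ j < - W n m \<and> - W n m \<le> L * 3 ^ Suc I)) \<le> (2 * real n)\<^sup>2"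
          using AE_good
        proof eventually_elim
          case (elim m)
          have "\<bar>W n m\<bar>\<^sup>2 \<le> (2 * real n)\<^sup>2"
            by (intro power_mono abs_W_le[OF elim]) auto
          then show ?case by auto
        qed
      qed measurable
    qed auto
    also have "\<dots> \<le> (\<Sum>i=j..I. 9 * (L * 3 ^ i) ^ 2 * \<P>(m in M. L * 3 ^ i < - W n m))"
      by (rule truncated_second_moment_le[OF _ L]) measurable
    \<comment> \<open>Two \<open>err\<close> come from the recursion, the third from the return
      probability in \<open>prob_left_le\<close>.\<close>
    also have "\<dots> \<le> (\<Sum>i=j..I. 9 * (L * 3 ^ i) ^ 2 * (1 / 60 / 20 ^ i + 18 * (k / ln (real n)) / 9 ^ i + 3 * err n))"
    proof (intro sum_mono mult_left_mono)
      fix i assume i: "i \<in> {j..I}"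
      have "L * 1 \<le> L * 3 ^ i" using L by (intro mult_left_mono) auto
      moreover have "0 < sqrt (real n)" using n by simp
      ultimately have x1: "4 * real (block n) < L * 3 ^ i"
        using L_ge block_le[of n] by linarith
      have "(3 :: real) ^ i \<le> 3 ^ I" using i by (intro power_increasing) auto
      with I have "3 ^ i \<le> 3 * ln (real n) ^ 3" by linarith
      then have "B * scale n * 3 ^ i \<le> B * scale n * (3 * ln (real n) ^ 3)"
        using B s by (intro mult_left_mono) auto
      with elim(6) have small: "B * scale n * 3 ^ i \<le> real n / 2" by linarith
      then have "2 * v * (B * scale n * 3 ^ i) \<le> 2 * v * (real n / 2)"
        using v_pos by (intro mult_left_mono) auto
      then have x2: "L * 3 ^ i \<le> real n * v" by (simp add: L_def mult_ac)
      have "\<P>(m in M. L * 3 ^ i < - W n m) = \<P>(m in M. W n m < - (L * 3 ^ i))"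
        by (rule arg_cong[of _ _ prob]) auto
      also have "\<dots> \<le> mtail (\<lambda>x. x) n (L * 3 ^ i * \<mu> / 2) + back_bound (int (block n))"
        by (rule prob_left_le[OF n x1 x2])
      also have "L * 3 ^ i * \<mu> / 2 = B * scale n * 3 ^ i"
        using v_pos by (simp add: L_def)
      also have "mtail (\<lambda>x. x) n (B * scale n * 3 ^ i) + back_bound (int (block n)) \<le>
          (1 / 60 / 20 ^ i + 18 * (k / ln (real n)) / 9 ^ i + 2 * err n) + err n"
        using elim(1) small n by (intro add_mono back_bound_le_err) auto
      finally show "\<P>(m in M. L * 3 ^ i < - W n m) \<le> 1 / 60 / 20 ^ i + 18 * (k / ln (real n)) / 9 ^ i + 3 * err n"
        by simp
    qed simp
    also have "\<dots> = 9 * L\<^sup>2 * (\<Sum>i=j..I. (3 ^ i)\<^sup>2 * (1 / 60 / 20 ^ i + 18 * (k / ln (real n)) / 9 ^ i + 3 * err n))"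
      unfolding sum_distrib_left by (simp only: power_mult_distrib mult.assoc)
    also have "\<dots> \<le> 9 * L\<^sup>2 * ((9 / 20) ^ j + 18 * (k / ln (real n)) * (real I + 1) + 2 * (3 * err n) * (3 ^ I) ^ 2)"
      using err_nonneg[of n] k ln by (intro mult_left_mono sum_geometric_weights) auto
    also have "\<dots> \<le> 9 * L\<^sup>2 * ((9 / 20) ^ j + 18 * (k / ln (real n)) * (log 3 (ln (real n) ^ 3) + 2) + 54 * (err n * real n ^ 2))"
    proof -
      have "3 ^ I \<le> 3 * real n" using I elim(5) by linarith
      then have "(3 ^ I) ^ 2 \<le> (3 * real n)\<^sup>2" by (intro power_mono) auto
      then have "2 * (3 * err n) * (3 ^ I) ^ 2 \<le> 2 * (3 * err n) * (3 * real n)\<^sup>2"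
        using err_nonneg[of n] by (intro mult_left_mono) auto
      also have "\<dots> = 54 * (err n * real n ^ 2)" by (simp add: power_mult_distrib)
      finally have e: "2 * (3 * err n) * (3 ^ I) ^ 2 \<le> 54 * (err n * real n ^ 2)" .
      have "18 * (k / ln (real n)) * (real I + 1) \<le> 18 * (k / ln (real n)) * (log 3 (ln (real n) ^ 3) + 2)"
        using I k ln by (intro mult_left_mono) auto
      with e show ?thesis by (intro mult_left_mono) auto
    qed
    also have "9 * L\<^sup>2 = D * scale n ^ 2" by (simp add: L_def D_def power_mult_distrib)
    also have "D * scale n ^ 2 * ((9 / 20) ^ j + 18 * (k / ln (real n)) * (log 3 (ln (real n) ^ 3) + 2) + 54 * (err n * real n ^ 2)) =
        (D * (9 / 20) ^ j + D * (18 * (k / ln (real n)) * (log 3 (ln (real n) ^ 3) + 2)) + D * 54 * (err n * real n ^ 2)) * scale n ^ 2"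
      by (simp only: ring_distribs mult_ac)
    also have "\<dots> \<le> \<epsilon> * scale n ^ 2"
      using j elim(2,3) by (intro mult_right_mono) auto
    finally show ?case .
  qed
  moreover have "0 < c" using v_pos B by (simp add: c_def)
  ultimately show ?thesis by blast
qed

end

section \<open>The far left tail\<close>

lemma (in prob_space) integral_of_bool:
  assumes [measurable]: "Measurable.pred M P"
  shows "(\<integral>m. of_bool (P m) \<partial>M) = \<P>(m in M. P m)"
proof -
  have "(\<integral>m. of_bool (P m) \<partial>M) = (\<integral>m. indicat_real {m \<in> space M. P m} m \<partial>M)"
    by (rule Bochner_Integration.integral_cong) auto
  then show ?thesis by simp
qed

text \<open>The tail will be known only on {a..b}. Hence V is capped at b, and starting the integral
  of 2 x at a instead of 0 produces the boundary term with a^2. Fubini over x and m gives the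
  identity.\<close>

lemma (in prob_space) truncated_layer_cake:
  fixes V :: "'a \<Rightarrow> real"
  assumes [measurable]: "V \<in> borel_measurable M" and ab: "0 \<le> a" "a \<le> b"
  shows "integrable lborel (\<lambda>x. 2 * x * \<P>(m in M. x < V m) * indicator {a..b} x)"
    and "(\<integral>m. (min (V m) b)\<^sup>2 * of_bool (a < V m) \<partial>M) =
      a\<^sup>2 * \<P>(m in M. a < V m) + (\<integral>x. 2 * x * \<P>(m in M. x < V m) * indicator {a..b} x \<partial>lborel)"
proof -
  interpret P: pair_sigma_finite lborel M ..
  define f where "f x m = 2 * x * indicator {a..b} x * (of_bool (x < V m) :: real)" for x m
  have [measurable]: "(\<lambda>(x, m). f x m) \<in> borel_measurable (lborel \<Otimes>\<^sub>M M)"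
    unfolding f_def by measurable
  have inner: "(\<integral>m. f x m \<partial>M) = 2 * x * \<P>(m in M. x < V m) * indicator {a..b} x" for x
    unfolding f_def by (simp add: integral_of_bool)
  have "integrable lborel (\<lambda>x. \<integral>m. norm (f x m) \<partial>M)"
  proof (rule Bochner_Integration.integrable_bound)
    show "integrable lborel (\<lambda>x. 2 * b * indicator {a..b} x)"
      using ab by (intro integrable_mult_right integrable_real_indicator) auto
    show "AE x in lborel. norm (\<integral>m. norm (f x m) \<partial>M) \<le> norm (2 * b * indicator {a..b} x)"
    proof (rule AE_I2)
      fix x
      have "norm (f x m) = f x m" for m
        using ab by (auto simp: f_def indicator_def)
      then have "(\<integral>m. norm (f x m) \<partial>M) = 2 * x * \<P>(m in M. x < V m) * indicator {a..b} x"
        by (simp add: inner)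
      also have "norm \<dots> \<le> norm (2 * b * indicator {a..b} x)"
        using ab mult_mono[of x b "\<P>(m in M. x < V m)" 1]
        by (auto simp: indicator_def abs_mult)
      finally show "norm (\<integral>m. norm (f x m) \<partial>M) \<le> norm (2 * b * indicator {a..b} x)" .
    qed
  qed measurable
  then have int: "integrable (lborel \<Otimes>\<^sub>M M) (\<lambda>(x, m). f x m)"
  proof (intro P.Fubini_integrable)
    show "AE x in lborel. integrable M (\<lambda>m. (case (x, m) of (x, m) \<Rightarrow> f x m))"
    proof (rule AE_I2)
      fix x
      show "integrable M (\<lambda>m. (case (x, m) of (x, m) \<Rightarrow> f x m))"
        unfolding prod.case f_def
        by (intro integrable_mult_right integrable_const_bound[where B = 1]) auto
    qed
  qed auto
  then show integ: "integrable lborel (\<lambda>x. 2 * x * \<P>(m in M. x < V m) * indicator {a..b} x)"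
    using P.integrable_fst[OF int] by (simp add: inner)
  have outer: "(\<integral>x. f x m \<partial>lborel) = (min (V m) b)\<^sup>2 * of_bool (a < V m) - a\<^sup>2 * of_bool (a < V m)" for m
  proof (cases "a < V m")
    case True
    have "(\<integral>x. f x m \<partial>lborel) = (\<integral>x. 2 * x * indicator {a..min (V m) b} x \<partial>lborel)"
    proof (rule integral_cong_AE)
      show "AE x in lborel. f x m = 2 * x * indicator {a..min (V m) b} x"
        using AE_lborel_singleton[of "V m"] by eventually_elim (auto simp: f_def indicator_def)
    qed (auto simp: f_def)
    also have "\<dots> = (min (V m) b)\<^sup>2 - a\<^sup>2"
    proof (rule integral_FTC_Icc_real)
      show "((\<lambda>x. x\<^sup>2) has_real_derivative 2 * x) (at x)" for x :: real
        by (auto intro!: derivative_eq_intros)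
    qed (use True ab in auto)
    finally show ?thesis using True by simp
  next
    case False
    then have "f x m = 0" for x
      by (auto simp: f_def indicator_def)
    then show ?thesis using False by simp
  qed
  have "(\<integral>x. 2 * x * \<P>(m in M. x < V m) * indicator {a..b} x \<partial>lborel) = (\<integral>m. (\<integral>x. f x m \<partial>lborel) \<partial>M)"
    using P.Fubini_integral[OF int] by (simp add: inner)
  also have "\<dots> = (\<integral>m. (min (V m) b)\<^sup>2 * of_bool (a < V m) \<partial>M) - (\<integral>m. a\<^sup>2 * of_bool (a < V m) \<partial>M)"
    unfolding outer
  proof (rule Bochner_Integration.integral_diff)
    show "integrable M (\<lambda>m. (min (V m) b)\<^sup>2 * of_bool (a < V m))"
    proof (rule integrable_const_bound[where B = "b\<^sup>2"])
      have "norm ((min x b)\<^sup>2 * of_bool (a < x)) \<le> b\<^sup>2" for x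
        using ab by (auto intro!: power_mono)
      then show "AE m in M. norm ((min (V m) b)\<^sup>2 * of_bool (a < V m)) \<le> b\<^sup>2" by simp
    qed measurable
    show "integrable M (\<lambda>m. a\<^sup>2 * of_bool (a < V m))"
      by (rule integrable_const_bound[where B = "a\<^sup>2"]) auto
  qed
  finally show "(\<integral>m. (min (V m) b)\<^sup>2 * of_bool (a < V m) \<partial>M) =
      a\<^sup>2 * \<P>(m in M. a < V m) + (\<integral>x. 2 * x * \<P>(m in M. x < V m) * indicator {a..b} x \<partial>lborel)"
    by (simp add: integral_of_bool)
qed

text \<open>The source of the factor log n: for a near sqrt n and b near n v up to logarithmic
  factors, ln b - ln a is about half of log n, and twice w = n v makes this n v log n.\<close>

lemma integral_tail_density:
  fixes a b c w :: real
  assumes "0 < a" "a \<le> b"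
  shows "integrable lborel (\<lambda>x. 2 * x * (c * ((w - x) / x\<^sup>2)) * indicator {a..b} x)"
    and "(\<integral>x. 2 * x * (c * ((w - x) / x\<^sup>2)) * indicator {a..b} x \<partial>lborel) = c * (2 * w * (ln b - ln a) - 2 * (b - a))"
proof -
  have "has_bochner_integral lborel (\<lambda>x. (2 * x * (c * ((w - x) / x\<^sup>2))) * indicator {a..b} x)
      (c * (2 * w * ln b - 2 * b) - c * (2 * w * ln a - 2 * a))"
  proof (rule has_bochner_integral_FTC_Icc_real)
    fix x assume x: "a \<le> x" "x \<le> b"
    then have "0 < x" using assms by simp
    then show "((\<lambda>x. c * (2 * w * ln x - 2 * x)) has_real_derivative 2 * x * (c * ((w - x) / x\<^sup>2))) (at x)"
      by (auto intro!: derivative_eq_intros simp: field_simps power2_eq_square)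
    show "isCont (\<lambda>x. 2 * x * (c * ((w - x) / x\<^sup>2))) x"
      using \<open>0 < x\<close> by (intro continuous_intros) auto
  qed (use assms in auto)
  then show "integrable lborel (\<lambda>x. 2 * x * (c * ((w - x) / x\<^sup>2)) * indicator {a..b} x)"
    and "(\<integral>x. 2 * x * (c * ((w - x) / x\<^sup>2)) * indicator {a..b} x \<partial>lborel) = c * (2 * w * (ln b - ln a) - 2 * (b - a))"
    by (auto simp: has_bochner_integral_iff algebra_simps)
qed

context rwre_tails
begin

lemma integrable_W_bounded:
  fixes g :: "real \<Rightarrow> real"
  assumes [measurable]: "g \<in> borel_measurable borel" and "\<And>x. \<bar>x\<bar> \<le> 2 * real n \<Longrightarrow> \<bar>g x\<bar> \<le> B"
  shows "integrable M (\<lambda>m. g (W n m))"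
proof (rule integrable_const_bound[where B = B])
  show "AE m in M. norm (g (W n m)) \<le> B"
    using AE_good by eventually_elim (use assms(2) abs_W_le in auto)
qed measurable

lemma integrable_W_sq:
  assumes [measurable]: "Measurable.pred borel P"
  shows "integrable M (\<lambda>m. W n m ^ 2 * of_bool (P (W n m)))"
proof (rule integrable_W_bounded)
  fix x :: real assume "\<bar>x\<bar> \<le> 2 * real n"
  then have "\<bar>x\<bar>\<^sup>2 \<le> (2 * real n)\<^sup>2" by (intro power_mono) auto
  then show "\<bar>x\<^sup>2 * of_bool (P x)\<bar> \<le> (2 * real n)\<^sup>2" by auto
qed measurable

lemma integrable_W: "integrable M (W n)"
  using integrable_W_bounded[of "\<lambda>x. x" n "2 * real n"] by simp

lemma integrable_W_square: "integrable M (\<lambda>m. W n m ^ 2)"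
  using integrable_W_sq[of "\<lambda>_. True" n] by simp

text \<open>The main term is I n, asymptotically v n log n. The boundary term at
  \<open>far n\<close> is at most (K + \<epsilon>) n v because its square cancels the denominator of
  the tail. Values beyond \<open>near n\<close>, with |W n| <= 2 n as the only bound, have
  probability of order ln n / n^2 and contribute O(ln n).\<close>

lemma far_left_moment:
  "(\<lambda>n. (\<integral>m. W n m ^ 2 * of_bool (W n m < - far n) \<partial>M) / scale n ^ 2) \<longlonglongrightarrow> K * v"
proof -
  define near where "near n = real n * v - ln (real n)" for n
  define I where "I n = 2 * (real n * v) * (ln (near n) - ln (far n)) - 2 * (near n - far n)" for n
  define E where "E n = (\<integral>m. W n m ^ 2 * of_bool (W n m < - far n) \<partial>M)" for n
  have ev: "\<forall>\<^sub>F n in sequentially. 0 < far n \<and> far n \<le> near n \<and> 0 < ln (real n)"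
  proof -
    have "\<forall>\<^sub>F n in sequentially. 0 < sqrt (real n) * ln (real n) ^ 3" by real_asymp
    moreover have "\<forall>\<^sub>F n in sequentially. sqrt (real n) * ln (real n) ^ 3 \<le> real n * v - ln (real n)"
      using v_pos by real_asymp
    moreover have "\<forall>\<^sub>F n in sequentially. 0 < ln (real n)" by real_asymp
    ultimately show ?thesis unfolding far_def near_def by eventually_elim auto
  qed
  have I_lim: "(\<lambda>n. I n / (real n * ln (real n))) \<longlonglongrightarrow> v"
    unfolding I_def near_def far_def using v_pos by real_asymp
  have rest_lim: "(\<lambda>n. ((real n * v - far n) + 4 * real n ^ 2 * (ln (real n) / (near n)\<^sup>2)) / (real n * ln (real n))) \<longlonglongrightarrow> 0"
    unfolding near_def far_def using v_pos by real_asymp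
  have bounds: "\<forall>\<^sub>F n in sequentially. (K - \<epsilon>) * I n \<le> E n \<and>
      E n \<le> (K + \<epsilon>) * ((real n * v - far n) + 4 * real n ^ 2 * (ln (real n) / (near n)\<^sup>2)) + (K + \<epsilon>) * I n"
    if eps: "0 < \<epsilon>" for \<epsilon>
  proof -
    obtain n0 where n0: "\<And>n x. n \<ge> n0 \<Longrightarrow> x \<in> {sqrt (real n) * ln (real n) ^ 3 .. real n * v - ln (real n)} \<Longrightarrow>
      \<bar>\<P>(m in M. real_of_int (Z n m) - real n * v < - x) - K * ((real n * v - x) / x\<^sup>2)\<bar> \<le> \<epsilon> * ((real n * v - x) / x\<^sup>2)"
      using tail[OF eps] by blast
    show ?thesis
      using ev eventually_ge_at_top[of n0]
    proof eventually_elim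
      case (elim n)
      let ?a = "far n" and ?b = "near n" and ?w = "real n * v"
      let ?p = "\<lambda>x. \<P>(m in M. x < - W n m)"
      have ab: "0 < ?a" "?a \<le> ?b" using elim by auto
      have p: "(K - \<epsilon>) * ((?w - x) / x\<^sup>2) \<le> ?p x" "?p x \<le> (K + \<epsilon>) * ((?w - x) / x\<^sup>2)"
        if "x \<in> {?a..?b}" for x
      proof -
        have "{m \<in> space M. real_of_int (Z n m) - real n * v < - x} = {m \<in> space M. x < - W n m}"
          by (auto simp: W_def)
        with n0[OF elim(2), of x] that
        have "\<bar>?p x - K * ((?w - x) / x\<^sup>2)\<bar> \<le> \<epsilon> * ((?w - x) / x\<^sup>2)"
          by (simp add: far_def near_def)
        then show "(K - \<epsilon>) * ((?w - x) / x\<^sup>2) \<le> ?p x" "?p x \<le> (K + \<epsilon>) * ((?w - x) / x\<^sup>2)"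
          unfolding left_diff_distrib distrib_right abs_le_iff by linarith+
      qed
      have mV: "(\<lambda>m. - W n m) \<in> borel_measurable M" by measurable
      note cake = truncated_layer_cake[OF mV less_imp_le[OF ab(1)] ab(2)]
      let ?J = "\<integral>x. 2 * x * ?p x * indicator {?a..?b} x \<partial>lborel"
      let ?F = "\<integral>m. (min (- W n m) ?b)\<^sup>2 * of_bool (?a < - W n m) \<partial>M"
      have J_low: "(K - \<epsilon>) * I n \<le> ?J"
        unfolding I_def integral_tail_density(2)[OF ab, symmetric]
      proof (rule integral_mono[OF integral_tail_density(1)[OF ab] cake(1)])
        fix x
        show "2 * x * ((K - \<epsilon>) * ((?w - x) / x\<^sup>2)) * indicator {?a..?b} x \<le> 2 * x * ?p x * indicator {?a..?b} x"
        proof (cases "x \<in> {?a..?b}")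
          case True
          then have "0 \<le> 2 * x" using ab by auto
          from mult_left_mono[OF p(1)[OF True] this] show ?thesis using True by simp
        qed simp
      qed
      have J_up: "?J \<le> (K + \<epsilon>) * I n"
        unfolding I_def integral_tail_density(2)[OF ab, symmetric]
      proof (rule integral_mono[OF cake(1) integral_tail_density(1)[OF ab]])
        fix x
        show "2 * x * ?p x * indicator {?a..?b} x \<le> 2 * x * ((K + \<epsilon>) * ((?w - x) / x\<^sup>2)) * indicator {?a..?b} x"
        proof (cases "x \<in> {?a..?b}")
          case True
          then have "0 \<le> 2 * x" using ab by auto
          from mult_left_mono[OF p(2)[OF True] this] show ?thesis using True by simp
        qed simp
      qed
      have E_eq: "E n = (\<integral>m. (- W n m) ^ 2 * of_bool (?a < - W n m) \<partial>M)"
        unfolding E_def by (rule Bochner_Integration.integral_cong) auto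
      have int_E: "integrable M (\<lambda>m. (- W n m) ^ 2 * of_bool (?a < - W n m))"
        using integrable_W_sq[of "\<lambda>x. ?a < - x" n] by simp
      have int_F: "integrable M (\<lambda>m. (min (- W n m) ?b)\<^sup>2 * of_bool (?a < - W n m))"
      proof (rule integrable_W_bounded[where g = "\<lambda>x. (min (- x) ?b)\<^sup>2 * of_bool (?a < - x)" and B = "?b\<^sup>2"])
        fix x
        show "\<bar>(min (- x) ?b)\<^sup>2 * of_bool (?a < - x)\<bar> \<le> ?b\<^sup>2"
          using ab by (auto intro!: power_mono)
      qed measurable
      have "?F \<le> E n"
        unfolding E_eq
      proof (rule integral_mono[OF int_F int_E])
        fix m
        show "(min (- W n m) ?b)\<^sup>2 * of_bool (?a < - W n m) \<le> (- W n m) ^ 2 * of_bool (?a < - W n m)"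
        proof (cases "?a < - W n m")
          case True
          then have "(min (- W n m) ?b)\<^sup>2 \<le> (- W n m) ^ 2"
            using ab by (intro power_mono) auto
          then show ?thesis using True by simp
        qed simp
      qed
      moreover have "?J \<le> ?F"
        using cake(2) by simp
      ultimately have low: "(K - \<epsilon>) * I n \<le> E n" using J_low by linarith
      have int_b: "integrable M (\<lambda>m. 4 * real n ^ 2 * of_bool (?b < - W n m))"
        by (rule integrable_const_bound[where B = "4 * real n ^ 2"]) auto
      have "E n \<le> (\<integral>m. (min (- W n m) ?b)\<^sup>2 * of_bool (?a < - W n m) + 4 * real n ^ 2 * of_bool (?b < - W n m) \<partial>M)"
        unfolding E_eq
      proof (rule integral_mono_AE[OF int_E])
        show "integrable M (\<lambda>m. (min (- W n m) ?b)\<^sup>2 * of_bool (?a < - W n m) + 4 * real n ^ 2 * of_bool (?b < - W n m))"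
          using int_F int_b by simp
        show "AE m in M. (- W n m) ^ 2 * of_bool (?a < - W n m) \<le>
            (min (- W n m) ?b)\<^sup>2 * of_bool (?a < - W n m) + 4 * real n ^ 2 * of_bool (?b < - W n m)"
          using AE_good
        proof eventually_elim
          case (elim m)
          show ?case
          proof (cases "?b < - W n m")
            case True
            have "\<bar>W n m\<bar>\<^sup>2 \<le> (2 * real n)\<^sup>2"
              by (intro power_mono abs_W_le[OF elim]) auto
            then show ?thesis using True ab by (auto simp: power_mult_distrib intro: add_increasing)
          next
            case False
            then show ?thesis by simp
          qed
        qed
      qed
      also have "\<dots> = ?F + 4 * real n ^ 2 * ?p ?b"
        using int_F int_b by (simp add: integral_of_bool)
      also have "?F = ?a\<^sup>2 * ?p ?a + ?J" by (rule cake(2))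
      also have "?a\<^sup>2 * ?p ?a \<le> ?a\<^sup>2 * ((K + \<epsilon>) * ((?w - ?a) / ?a\<^sup>2))"
        using p(2)[of ?a] ab by (intro mult_left_mono) auto
      also have "\<dots> = (K + \<epsilon>) * (?w - ?a)" using ab by simp
      also have "?p ?b \<le> (K + \<epsilon>) * ((?w - ?b) / ?b\<^sup>2)"
        using p(2)[of ?b] ab by auto
      also have "(?w - ?b) / ?b\<^sup>2 = ln (real n) / ?b\<^sup>2" by (simp add: near_def)
      finally have "E n \<le> (K + \<epsilon>) * (?w - ?a) + (K + \<epsilon>) * I n + 4 * real n ^ 2 * ((K + \<epsilon>) * (ln (real n) / ?b\<^sup>2))"
        using J_up by (simp add: mult_left_mono)
      with low show ?case by (simp add: algebra_simps)
    qed
  qed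
  have "(\<lambda>n. E n / (real n * ln (real n))) \<longlonglongrightarrow> K * v"
  proof (rule order_tendstoI)
    fix y assume y: "y < K * v"
    define \<epsilon> where "\<epsilon> = (K * v - y) / 2"
    have \<epsilon>: "0 < \<epsilon>" using y by (simp add: \<epsilon>_def)
    have "\<epsilon> * v \<le> \<epsilon>" using \<epsilon> v_le_1 by (simp add: mult_left_le)
    moreover have "y = K * v - 2 * \<epsilon>" by (simp add: \<epsilon>_def field_simps)
    ultimately have "y < (K - \<epsilon>) * v"
      using \<epsilon> unfolding left_diff_distrib by linarith
    moreover have "(\<lambda>n. (K - \<epsilon>) * (I n / (real n * ln (real n)))) \<longlonglongrightarrow> (K - \<epsilon>) * v"
      by (intro tendsto_mult_left I_lim)
    ultimately have "\<forall>\<^sub>F n in sequentially. y < (K - \<epsilon>) * (I n / (real n * ln (real n)))"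
      by (rule order_tendstoD(1)[rotated])
    then show "\<forall>\<^sub>F n in sequentially. y < E n / (real n * ln (real n))"
      using bounds[OF \<epsilon>] eventually_gt_at_top[of 1]
    proof eventually_elim
      case (elim n)
      then have "0 < real n * ln (real n)" by simp
      then have "(K - \<epsilon>) * I n / (real n * ln (real n)) \<le> E n / (real n * ln (real n))"
        using elim(2) by (intro divide_right_mono) auto
      then show ?case using elim(1) by simp
    qed
  next
    fix y assume y: "K * v < y"
    define \<epsilon> where "\<epsilon> = (y - K * v) / 2"
    have \<epsilon>: "0 < \<epsilon>" using y by (simp add: \<epsilon>_def)
    let ?R = "\<lambda>n. ((real n * v - far n) + 4 * real n ^ 2 * (ln (real n) / (near n)\<^sup>2)) / (real n * ln (real n))"
    have "\<epsilon> * v \<le> \<epsilon>" using \<epsilon> v_le_1 by (simp add: mult_left_le)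
    moreover have "y = K * v + 2 * \<epsilon>" by (simp add: \<epsilon>_def field_simps)
    ultimately have "(K + \<epsilon>) * 0 + (K + \<epsilon>) * v < y"
      using \<epsilon> unfolding distrib_right by linarith
    moreover have "(\<lambda>n. (K + \<epsilon>) * ?R n + (K + \<epsilon>) * (I n / (real n * ln (real n)))) \<longlonglongrightarrow> (K + \<epsilon>) * 0 + (K + \<epsilon>) * v"
      by (intro tendsto_add tendsto_mult_left I_lim rest_lim)
    ultimately have "\<forall>\<^sub>F n in sequentially. (K + \<epsilon>) * ?R n + (K + \<epsilon>) * (I n / (real n * ln (real n))) < y"
      by (rule order_tendstoD(2)[rotated])
    then show "\<forall>\<^sub>F n in sequentially. E n / (real n * ln (real n)) < y"
      using bounds[OF \<epsilon>] eventually_gt_at_top[of 1]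
    proof eventually_elim
      case (elim n)
      then have "0 < real n * ln (real n)" by simp
      then have "E n / (real n * ln (real n)) \<le> ((K + \<epsilon>) * ((real n * v - far n) + 4 * real n ^ 2 * (ln (real n) / (near n)\<^sup>2))
          + (K + \<epsilon>) * I n) / (real n * ln (real n))"
        using elim(2) by (intro divide_right_mono) auto
      then show ?case using elim(1) unfolding add_divide_distrib[of "(K + \<epsilon>) * _" "(K + \<epsilon>) * _"] times_divide_eq_right[symmetric]
        by linarith
    qed
  qed
  moreover have "\<forall>\<^sub>F n in sequentially. E n / (real n * ln (real n)) = E n / scale n ^ 2"
    using eventually_ge_at_top[of 1] by eventually_elim (simp add: scale_sq)
  ultimately show ?thesis
    unfolding E_def[symmetric] by (rule Lim_transform_eventually)
qed

end

section \<open>Convergence of mean and variance\<close>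

lemma (in prob_space) weak_conv_m_expectation:
  fixes f :: "real \<Rightarrow> real"
  assumes [measurable]: "\<And>n. X n \<in> borel_measurable M"
    and "weak_conv_m (\<lambda>n. distr M borel (X n)) N" "real_distribution N"
    and f: "\<And>x. isCont f x" "\<And>x. \<bar>f x\<bar> \<le> B"
  shows "(\<lambda>n. expectation (\<lambda>m. f (X n m))) \<longlonglongrightarrow> (\<integral>x. f x \<partial>N)"
proof -
  have dist: "real_distribution (distr M borel (X n))" for n
    by (rule real_distribution_distr) simp
  have [measurable]: "f \<in> borel_measurable borel"
    using f(1) by (intro borel_measurable_continuous_onI continuous_at_imp_continuous_on) auto
  have "(\<lambda>n. \<integral>x. f x \<partial>distr M borel (X n)) \<longlonglongrightarrow> (\<integral>x. f x \<partial>N)"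
    using weak_conv_imp_integral_bdd_continuous_conv[OF dist assms(3,2) f(1), of B] f(2) by simp
  then show ?thesis by (simp add: integral_distr)
qed

lemma std_normal_second_moment:
  "integrable std_normal_distribution (\<lambda>x. x\<^sup>2)" "(\<integral>x. x\<^sup>2 \<partial>std_normal_distribution) = 1"
  using std_normal_distribution_even_moments[of 1] by simp_all

lemma std_normal_truncated_second_moment:
  "(\<lambda>k. \<integral>x. min (x\<^sup>2) (real k ^ 2) \<partial>std_normal_distribution) \<longlonglongrightarrow> 1"
proof -
  have "(\<lambda>k. \<integral>x. min (x\<^sup>2) (real k ^ 2) \<partial>std_normal_distribution) \<longlonglongrightarrow> (\<integral>x. x\<^sup>2 \<partial>std_normal_distribution)"
  proof (rule integral_dominated_convergence[where w = "\<lambda>x. x\<^sup>2"])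
    show "AE x in std_normal_distribution. (\<lambda>k. min (x\<^sup>2) (real k ^ 2)) \<longlonglongrightarrow> x\<^sup>2"
    proof (rule AE_I2)
      fix x :: real
      obtain k0 where k0: "\<bar>x\<bar> \<le> real k0" using real_arch_simple by blast
      have "\<forall>\<^sub>F k in sequentially. min (x\<^sup>2) (real k ^ 2) = x\<^sup>2"
        using eventually_ge_at_top[of k0]
      proof eventually_elim
        case (elim k)
        then have "\<bar>x\<bar>\<^sup>2 \<le> real k ^ 2" using k0 by (intro power_mono) auto
        then show ?case by (simp add: min_def)
      qed
      then show "(\<lambda>k. min (x\<^sup>2) (real k ^ 2)) \<longlonglongrightarrow> x\<^sup>2" by (rule tendsto_eventually)
    qed
  qed (auto simp: std_normal_second_moment)
  then show ?thesis by (simp add: std_normal_second_moment)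
qed

lemma std_normal_truncated_mean:
  assumes "0 \<le> k"
  shows "(\<integral>x. max (- k) (min x k) \<partial>std_normal_distribution) = 0"
proof -
  let ?f = "\<lambda>x::real. std_normal_density x * max (- k) (min x k)"
  have "(\<integral>x. max (- k) (min x k) \<partial>std_normal_distribution) = (\<integral>x. ?f x \<partial>lborel)"
    by (subst integral_density) auto
  moreover have "(\<integral>x. ?f x \<partial>lborel) = - (\<integral>x. ?f x \<partial>lborel)"
  proof -
    have odd: "?f (- x) = - ?f x" for x
      using assms by (auto simp: std_normal_density_def min_def max_def)
    have "(\<integral>x. ?f x \<partial>lborel) = (\<integral>x. ?f (- x) \<partial>lborel)"
      using lborel_integral_real_affine[of "-1" ?f 0] by simp
    also have "\<dots> = (\<integral>x. - ?f x \<partial>lborel)"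
      by (rule Bochner_Integration.integral_cong[OF refl odd])
    finally show ?thesis by simp
  qed
  ultimately show ?thesis by simp
qed

lemma (in prob_space) weak_conv_std_normal_tight:
  assumes [measurable]: "\<And>n. X n \<in> borel_measurable M"
    and "weak_conv_m (\<lambda>n. distr M borel (X n)) std_normal_distribution"
    and "0 < \<delta>"
  shows "\<exists>C>0. \<forall>\<^sub>F n in sequentially. \<P>(m in M. C < \<bar>X n m\<bar>) \<le> \<delta>"
proof -
  define C where "C = sqrt (2 / \<delta>)"
  have C: "0 < C" "2 / C\<^sup>2 = \<delta>" using \<open>0 < \<delta>\<close> by (simp_all add: C_def)
  let ?f = "\<lambda>x. min (x\<^sup>2) (C\<^sup>2)"
  have lim: "(\<lambda>n. expectation (\<lambda>m. ?f (X n m))) \<longlonglongrightarrow> (\<integral>x. ?f x \<partial>std_normal_distribution)"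
    by (rule weak_conv_m_expectation[OF assms(1,2) real_dist_normal_dist, where B = "C\<^sup>2"])
      (auto intro!: continuous_intros)
  interpret N: prob_space std_normal_distribution
    using prob_space_normal_density[of 1 0] by simp
  have "(\<integral>x. ?f x \<partial>std_normal_distribution) \<le> (\<integral>x. x\<^sup>2 \<partial>std_normal_distribution)"
  proof (rule integral_mono)
    show "integrable std_normal_distribution ?f"
      by (rule N.integrable_const_bound[where B = "C\<^sup>2"]) auto
  qed (auto simp: std_normal_second_moment)
  then have "(\<integral>x. ?f x \<partial>std_normal_distribution) < 2"
    by (simp add: std_normal_second_moment)
  with lim have "\<forall>\<^sub>F n in sequentially. expectation (\<lambda>m. ?f (X n m)) < 2"
    by (rule order_tendstoD(2))
  then have "\<forall>\<^sub>F n in sequentially. \<P>(m in M. C < \<bar>X n m\<bar>) \<le> \<delta>"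
  proof eventually_elim
    case (elim n)
    have "C\<^sup>2 * \<P>(m in M. C < \<bar>X n m\<bar>) = expectation (\<lambda>m. C\<^sup>2 * of_bool (C < \<bar>X n m\<bar>))"
      by (simp add: integral_of_bool)
    also have "\<dots> \<le> expectation (\<lambda>m. ?f (X n m))"
    proof (rule integral_mono')
      show "integrable M (\<lambda>m. ?f (X n m))"
        by (rule integrable_const_bound[where B = "C\<^sup>2"]) auto
      fix m
      show "C\<^sup>2 * of_bool (C < \<bar>X n m\<bar>) \<le> ?f (X n m)"
        using C power_mono[of C "\<bar>X n m\<bar>" 2] by auto
    qed auto
    also have "\<dots> \<le> 2" using elim by simp
    finally have "\<P>(m in M. C < \<bar>X n m\<bar>) \<le> 2 / C\<^sup>2"
      using C by (simp add: field_simps)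
    then show ?case using C by simp
  qed
  with C show ?thesis by blast
qed

locale rwre_clt = rwre_tails +
  fixes b :: real
  assumes b_pos: "0 < b"
    and clt: "weak_conv_m (\<lambda>n. distr M borel (\<lambda>m. (real_of_int (Z n m) - real n * v) / (b * sqrt (real n * ln (real n)))))
      std_normal_distribution"
begin

definition Y :: "nat \<Rightarrow> 'a \<Rightarrow> real" where
  "Y n m = W n m / (b * scale n)"

lemma measurable_Y [measurable]: "Y n \<in> borel_measurable M"
  unfolding Y_def by measurable

lemma clt_Y: "weak_conv_m (\<lambda>n. distr M borel (Y n)) std_normal_distribution"
  using clt unfolding Y_def[abs_def] W_def scale_def .

lemma Y_bounded_conv:
  fixes f :: "real \<Rightarrow> real"
  assumes "\<And>x. isCont f x" "\<And>x. \<bar>f x\<bar> \<le> B"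
  shows "(\<lambda>n. expectation (\<lambda>m. f (Y n m))) \<longlonglongrightarrow> (\<integral>x. f x \<partial>std_normal_distribution)"
  by (rule weak_conv_m_expectation[OF measurable_Y clt_Y real_dist_normal_dist assms])

lemma prob_far_left_tendsto: "(\<lambda>n. \<P>(m in M. W n m < - far n)) \<longlonglongrightarrow> 0"
proof (rule order_tendstoI)
  fix y :: real assume "0 < y"
  then obtain C where C: "\<forall>\<^sub>F n in sequentially. \<forall>n'. real n' \<le> 1 * real n \<longrightarrow> \<P>(m in M. C * scale n < \<bar>W n' m\<bar>) \<le> y / 2"
    using uniform_tight[of "y / 2" 1] by auto
  have "\<forall>\<^sub>F n in sequentially. C * sqrt (real n * ln (real n)) \<le> sqrt (real n) * ln (real n) ^ 3"
    by real_asymp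
  with C show "\<forall>\<^sub>F n in sequentially. \<P>(m in M. W n m < - far n) < y"
  proof eventually_elim
    case (elim n)
    have "\<P>(m in M. W n m < - far n) \<le> \<P>(m in M. C * scale n < \<bar>W n m\<bar>)"
      using elim(2) by (intro finite_measure_mono) (auto simp: far_def scale_def)
    also have "\<dots> \<le> y / 2" using elim(1) by simp
    finally show ?case using \<open>0 < y\<close> by simp
  qed
qed (auto intro!: always_eventually less_le_trans[OF _ measure_nonneg])

text \<open>The bulk carries b^2, and an event of vanishing probability on the far left carries K v.
  From above, the square is split into the capped square, the far left part and two intermediate
  parts that are small by uniform integrability; from below, the first two are added and their
  overlap is subtracted.\<close>

lemma second_moment_tendsto:
  "(\<lambda>n. expectation (\<lambda>m. W n m ^ 2) / scale n ^ 2) \<longlonglongrightarrow> b\<^sup>2 + K * v"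
proof (rule LIMSEQ_I)
  fix e :: real assume "0 < e"
  then have e: "0 < e / 8" by simp
  obtain c1 where c1: "\<forall>\<^sub>F n in sequentially. (\<integral>m. W n m ^ 2 * of_bool (c1 * scale n < W n m) \<partial>M) \<le> e / 8 * scale n ^ 2"
    using right_tail_moment[OF e] by blast
  obtain c2 where c2: "\<forall>\<^sub>F n in sequentially.
    (\<integral>m. W n m ^ 2 * of_bool (W n m < - (c2 * scale n) \<and> - far n \<le> W n m) \<partial>M) \<le> e / 8 * scale n ^ 2"
    using left_tail_moment[OF e] by blast
  let ?t = "\<lambda>k. \<integral>x. min (x\<^sup>2) (real k ^ 2) \<partial>std_normal_distribution"
  have "(\<lambda>k. b\<^sup>2 * ?t k) \<longlonglongrightarrow> b\<^sup>2 * 1"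
    by (intro tendsto_mult_left std_normal_truncated_second_moment)
  from tendstoD[OF this e] have ev_k: "\<forall>\<^sub>F k in sequentially. \<bar>b\<^sup>2 * ?t k - b\<^sup>2\<bar> < e / 8"
    unfolding dist_real_def by simp
  have ev_k': "\<forall>\<^sub>F k in sequentially. max (max c1 c2) 1 / b \<le> real k"
    using filterlim_real_sequentially unfolding filterlim_at_top by blast
  obtain k where k: "\<bar>b\<^sup>2 * ?t k - b\<^sup>2\<bar> < e / 8" "max (max c1 c2) 1 / b \<le> real k"
    using eventually_happens'[OF sequentially_bot eventually_conj[OF ev_k ev_k']] by auto
  \<comment> \<open>Capping |Y n| at k is capping |W n| at b k times the scale; the choice of k puts
    this above both thresholds c1 and c2.\<close>
  define C where "C = b * real k"
  have C: "c1 \<le> C" "c2 \<le> C" "1 \<le> C"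
    using k(2) b_pos by (simp_all add: C_def field_simps)
  let ?f = "\<lambda>x. min (x\<^sup>2) (real k ^ 2)"
  have "(\<lambda>n. b\<^sup>2 * expectation (\<lambda>m. ?f (Y n m))) \<longlonglongrightarrow> b\<^sup>2 * ?t k"
    by (intro tendsto_mult_left Y_bounded_conv[where B = "real k ^ 2"]) (auto intro!: continuous_intros)
  from tendstoD[OF this e] have ev_f: "\<forall>\<^sub>F n in sequentially. \<bar>b\<^sup>2 * expectation (\<lambda>m. ?f (Y n m)) - b\<^sup>2 * ?t k\<bar> < e / 8"
    unfolding dist_real_def .
  have ev_far: "\<forall>\<^sub>F n in sequentially. \<bar>(\<integral>m. W n m ^ 2 * of_bool (W n m < - far n) \<partial>M) / scale n ^ 2 - K * v\<bar> < e / 8"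
    using tendstoD[OF far_left_moment e] unfolding dist_real_def .
  have "(\<lambda>n. C\<^sup>2 * \<P>(m in M. W n m < - far n)) \<longlonglongrightarrow> 0"
    by (intro tendsto_mult_right_zero prob_far_left_tendsto)
  then have ev_p: "\<forall>\<^sub>F n in sequentially. C\<^sup>2 * \<P>(m in M. W n m < - far n) < e / 8"
    using e by (intro order_tendstoD(2)) auto
  have ev_C: "\<forall>\<^sub>F n in sequentially. C * sqrt (real n * ln (real n)) \<le> sqrt (real n) * ln (real n) ^ 3"
    by real_asymp
  have "\<forall>\<^sub>F n in sequentially. norm (expectation (\<lambda>m. W n m ^ 2) / scale n ^ 2 - (b\<^sup>2 + K * v)) < e"
    using c1 c2 ev_f ev_far ev_p ev_C[folded scale_def far_def] eventually_ge_at_top[of 2]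
  proof eventually_elim
    case (elim n)
    let ?s = "scale n"
    have s: "0 < ?s" by (rule scale_pos) (use elim in simp)
    have sq: "0 < ?s ^ 2" using s by simp
    have bY: "(b * Y n m)\<^sup>2 * ?s ^ 2 = W n m ^ 2" for m
      using s b_pos by (simp add: Y_def power_divide power_mult_distrib)
    let ?F = "\<lambda>m. b\<^sup>2 * ?s ^ 2 * ?f (Y n m)"
    have F: "?F m = min (W n m ^ 2) ((C * ?s) ^ 2)" for m
    proof -
      have "?F m = min (b\<^sup>2 * ?s ^ 2 * Y n m ^ 2) (b\<^sup>2 * ?s ^ 2 * real k ^ 2)"
        by (simp add: min_mult_distrib_left)
      also have "b\<^sup>2 * ?s ^ 2 * Y n m ^ 2 = W n m ^ 2"
        using bY[of m] by (simp add: power_mult_distrib mult_ac)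
      also have "b\<^sup>2 * ?s ^ 2 * real k ^ 2 = (C * ?s) ^ 2"
        by (simp add: C_def power_mult_distrib mult_ac)
      finally show ?thesis .
    qed
    let ?A = "\<lambda>m. W n m ^ 2 * of_bool (W n m < - far n)"
    let ?B1 = "\<lambda>m. W n m ^ 2 * of_bool (c1 * ?s < W n m)"
    let ?B2 = "\<lambda>m. W n m ^ 2 * of_bool (W n m < - (c2 * ?s) \<and> - far n \<le> W n m)"
    \<comment> \<open>The capped square also counts the far left. The overlap is at most (C scale)^2
      times a probability that tends to 0.\<close>
    let ?P = "\<lambda>m. (C * ?s) ^ 2 * of_bool (W n m < - far n)"
    have intA: "integrable M ?A" and intB1: "integrable M ?B1" and intB2: "integrable M ?B2"
      by (rule integrable_W_sq; measurable)+
    have intP: "integrable M ?P"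
      by (rule integrable_const_bound[where B = "(C * ?s) ^ 2"]) auto
    have intf: "integrable M (\<lambda>m. ?f (Y n m))"
      by (rule integrable_const_bound[where B = "real k ^ 2"]) auto
    then have intF: "integrable M ?F" by simp
    have mono: "c1 * ?s \<le> C * ?s" "c2 * ?s \<le> C * ?s" "0 \<le> C * ?s"
      using C s by (simp_all add: mult_right_mono)
    have upper: "W n m ^ 2 \<le> ?F m + ?A m + ?B1 m + ?B2 m" for m
    proof (cases "\<bar>W n m\<bar> \<le> C * ?s")
      case True
      then have "\<bar>W n m\<bar>\<^sup>2 \<le> (C * ?s) ^ 2" by (intro power_mono) auto
      then have "?F m = W n m ^ 2" unfolding F by (simp add: min_def)
      then show ?thesis by simp
    next
      case False
      have "0 \<le> ?F m" by (simp add: F)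
      moreover have "W n m ^ 2 \<le> ?A m + ?B1 m + ?B2 m"
      proof (cases "0 \<le> W n m")
        case True
        then have "c1 * ?s < W n m" using False mono by linarith
        then show ?thesis by simp
      next
        case neg: False
        then have "W n m < - (c2 * ?s)" using False mono by linarith
        then show ?thesis by (cases "W n m < - far n") auto
      qed
      ultimately show ?thesis by linarith
    qed
    have lower: "?F m + ?A m - ?P m \<le> W n m ^ 2" for m
      unfolding F by auto
    have "expectation (\<lambda>m. W n m ^ 2) \<le> expectation (\<lambda>m. ?F m + ?A m + ?B1 m + ?B2 m)"
      using intF intA intB1 intB2 by (intro integral_mono integrable_W_square upper Bochner_Integration.integrable_add)
    also have "\<dots> = expectation ?F + expectation ?A + expectation ?B1 + expectation ?B2"
      using intF intA intB1 intB2 by simp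
    also have "\<dots> \<le> expectation ?F + expectation ?A + e / 8 * ?s ^ 2 + e / 8 * ?s ^ 2"
      by (intro add_mono order_refl elim)
    finally have up: "expectation (\<lambda>m. W n m ^ 2) \<le> expectation ?F + expectation ?A + e / 4 * ?s ^ 2" by simp
    have "expectation (\<lambda>m. ?F m + ?A m - ?P m) \<le> expectation (\<lambda>m. W n m ^ 2)"
      using intF intA intP by (intro integral_mono integrable_W_square lower Bochner_Integration.integrable_diff Bochner_Integration.integrable_add)
    moreover have "expectation (\<lambda>m. ?F m + ?A m - ?P m) = expectation ?F + expectation ?A - expectation ?P"
      using intF intA intP by simp
    moreover have "expectation ?P = C\<^sup>2 * \<P>(m in M. W n m < - far n) * ?s ^ 2"
      by (simp add: integral_of_bool power_mult_distrib)
    moreover have "\<dots> \<le> e / 8 * ?s ^ 2"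
      using elim(5) by (intro mult_right_mono) auto
    ultimately have low: "expectation ?F + expectation ?A - e / 8 * ?s ^ 2 \<le> expectation (\<lambda>m. W n m ^ 2)" by linarith
    have EF: "expectation ?F = b\<^sup>2 * expectation (\<lambda>m. ?f (Y n m)) * ?s ^ 2" by simp
    have "expectation (\<lambda>m. W n m ^ 2) / ?s ^ 2 \<le> (expectation ?F + expectation ?A + e / 4 * ?s ^ 2) / ?s ^ 2"
      using up by (intro divide_right_mono) auto
    also have "\<dots> = b\<^sup>2 * expectation (\<lambda>m. ?f (Y n m)) + expectation ?A / ?s ^ 2 + e / 4"
      unfolding EF using s by (simp add: add_divide_distrib)
    finally have up': "expectation (\<lambda>m. W n m ^ 2) / ?s ^ 2 \<le> b\<^sup>2 * expectation (\<lambda>m. ?f (Y n m)) + expectation ?A / ?s ^ 2 + e / 4" .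
    have "(expectation ?F + expectation ?A - e / 8 * ?s ^ 2) / ?s ^ 2 \<le> expectation (\<lambda>m. W n m ^ 2) / ?s ^ 2"
      using low by (intro divide_right_mono) auto
    moreover have "(expectation ?F + expectation ?A - e / 8 * ?s ^ 2) / ?s ^ 2 =
        b\<^sup>2 * expectation (\<lambda>m. ?f (Y n m)) + expectation ?A / ?s ^ 2 - e / 8"
      unfolding EF using s by (simp add: add_divide_distrib diff_divide_distrib)
    ultimately show ?case
      using up' elim(3,4) k(1) \<open>0 < e\<close> unfolding real_norm_def by linarith
  qed
  then show "\<exists>no. \<forall>n\<ge>no. norm (expectation (\<lambda>m. W n m ^ 2) / scale n ^ 2 - (b\<^sup>2 + K * v)) < e"
    by (simp add: eventually_sequentially)
qed

text \<open>Bounded second moments make clipping at k cost at most their size divided by k. The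
  clipped mean converges to the integral of an odd function under a symmetric law, hence to
  0.\<close>

lemma mean_tendsto: "(\<lambda>n. expectation (W n) / scale n) \<longlonglongrightarrow> 0"
proof (rule LIMSEQ_I)
  fix e :: real assume e: "0 < e"
  define D where "D = b\<^sup>2 + K * v + 1"
  have D: "0 < D" using K_nonneg v_pos b_pos by (simp add: D_def add_nonneg_pos)
  have ev_D: "\<forall>\<^sub>F n in sequentially. expectation (\<lambda>m. W n m ^ 2) / scale n ^ 2 < D"
    by (rule order_tendstoD(2)[OF second_moment_tendsto]) (simp add: D_def)
  \<comment> \<open>Makes the clipping error b * D / (b^2 k) equal to e / 2.\<close>
  define k where "k = 2 * D / (e * b)"
  have k: "0 < k" using D e b_pos by (simp add: k_def)
  let ?g = "\<lambda>x::real. max (- k) (min x k)"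
  have "(\<lambda>n. b * expectation (\<lambda>m. ?g (Y n m))) \<longlonglongrightarrow> b * (\<integral>x. ?g x \<partial>std_normal_distribution)"
    by (intro tendsto_mult_left Y_bounded_conv[where B = k]) (use k in \<open>auto intro!: continuous_intros\<close>)
  then have "(\<lambda>n. b * expectation (\<lambda>m. ?g (Y n m))) \<longlonglongrightarrow> 0"
    using k by (simp add: std_normal_truncated_mean)
  from tendstoD[OF this half_gt_zero[OF e]]
  have ev_g: "\<forall>\<^sub>F n in sequentially. \<bar>b * expectation (\<lambda>m. ?g (Y n m))\<bar> < e / 2"
    by (simp add: dist_real_def)
  have "\<forall>\<^sub>F n in sequentially. norm (expectation (W n) / scale n - 0) < e"
    using ev_D ev_g eventually_ge_at_top[of 2]
  proof eventually_elim
    case (elim n)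
    let ?s = "scale n"
    have s: "0 < ?s" by (rule scale_pos) (use elim in simp)
    have intg: "integrable M (\<lambda>m. ?g (Y n m))"
      by (rule integrable_const_bound[where B = k]) (use k in auto)
    have WY: "W n m / ?s = b * Y n m" for m
      using s b_pos by (simp add: Y_def)
    have intY: "integrable M (Y n)"
      unfolding Y_def by (intro integrable_divide integrable_W)
    have intY2: "integrable M (\<lambda>m. Y n m ^ 2)"
      unfolding Y_def power_divide by (intro integrable_divide integrable_W_square)
    have clamp: "\<bar>x - ?g x\<bar> \<le> x\<^sup>2 / k" for x :: real
    proof (cases "\<bar>x\<bar> \<le> k")
      case True
      then have "?g x = x" by (simp add: abs_le_iff)
      then show ?thesis using k by simp
    next
      case False
      have "\<bar>x - ?g x\<bar> \<le> \<bar>x\<bar>" using k by auto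
      also have "\<bar>x\<bar> * k \<le> \<bar>x\<bar> * \<bar>x\<bar>" using False by (intro mult_left_mono) auto
      then have "\<bar>x\<bar> \<le> x\<^sup>2 / k" using k by (simp add: field_simps power2_eq_square)
      finally show ?thesis .
    qed
    have "\<bar>expectation (\<lambda>m. Y n m - ?g (Y n m))\<bar> \<le> expectation (\<lambda>m. \<bar>Y n m - ?g (Y n m)\<bar>)"
      using integral_abs_bound by blast
    also have "\<dots> \<le> expectation (\<lambda>m. Y n m ^ 2 / k)"
      using intY intg intY2 by (intro integral_mono clamp integrable_divide integrable_abs Bochner_Integration.integrable_diff)
    also have "\<dots> = expectation (\<lambda>m. W n m ^ 2) / ?s ^ 2 / (b\<^sup>2 * k)"
      by (simp add: Y_def power_divide power_mult_distrib)
    also have "\<dots> \<le> D / (b\<^sup>2 * k)"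
      using elim(1) k b_pos by (intro divide_right_mono) auto
    also have "\<dots> = e / (2 * b)"
      using b_pos e D by (simp add: k_def field_simps power2_eq_square)
    finally have 1: "\<bar>expectation (Y n) - expectation (\<lambda>m. ?g (Y n m))\<bar> \<le> e / (2 * b)"
      using intY intg by simp
    have "expectation (W n) / ?s = b * expectation (Y n)"
      using WY by (simp flip: integral_divide_zero integral_mult_right_zero)
    also have "\<bar>\<dots>\<bar> \<le> \<bar>b * (expectation (Y n) - expectation (\<lambda>m. ?g (Y n m)))\<bar> + \<bar>b * expectation (\<lambda>m. ?g (Y n m))\<bar>"
      by (simp add: right_diff_distrib)
    also have "\<bar>b * (expectation (Y n) - expectation (\<lambda>m. ?g (Y n m)))\<bar> \<le> b * (e / (2 * b))"
      unfolding abs_mult using 1 b_pos by (intro mult_mono) auto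
    also have "b * (e / (2 * b)) = e / 2" using b_pos by simp
    finally show ?case using elim(2) by simp
  qed
  then show "\<exists>no. \<forall>n\<ge>no. norm (expectation (W n) / scale n - 0) < e"
    by (simp add: eventually_sequentially)
qed

theorem mean_and_variance:
  "(\<lambda>n. (expectation (\<lambda>m. real_of_int (Z n m)) - real n * v) / sqrt (real n * ln (real n))) \<longlonglongrightarrow> 0"
  "(\<lambda>n. variance (\<lambda>m. real_of_int (Z n m)) / (real n * ln (real n))) \<longlonglongrightarrow> b\<^sup>2 + K * v"
proof -
  have Z: "real_of_int (Z n m) = W n m + real n * v" for n m
    by (simp add: W_def)
  have E: "expectation (\<lambda>m. real_of_int (Z n m)) = expectation (W n) + real n * v" for n
    unfolding Z using integrable_W[of n] by (simp add: prob_space)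
  show "(\<lambda>n. (expectation (\<lambda>m. real_of_int (Z n m)) - real n * v) / sqrt (real n * ln (real n))) \<longlonglongrightarrow> 0"
    unfolding E using mean_tendsto by (simp add: scale_def)
  have V: "variance (\<lambda>m. real_of_int (Z n m)) = expectation (\<lambda>m. W n m ^ 2) - (expectation (W n))\<^sup>2" for n
  proof -
    have "variance (\<lambda>m. real_of_int (Z n m)) = variance (W n)"
      unfolding E unfolding Z by simp
    also have "\<dots> = expectation (\<lambda>m. W n m ^ 2) - (expectation (W n))\<^sup>2"
      by (rule variance_eq[OF integrable_W integrable_W_square])
    finally show ?thesis .
  qed
  have "(\<lambda>n. expectation (\<lambda>m. W n m ^ 2) / scale n ^ 2 - (expectation (W n) / scale n)\<^sup>2) \<longlonglongrightarrow> b\<^sup>2 + K * v - 0\<^sup>2"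
    by (intro tendsto_diff tendsto_power second_moment_tendsto mean_tendsto)
  moreover have "\<forall>\<^sub>F n in sequentially. expectation (\<lambda>m. W n m ^ 2) / scale n ^ 2 - (expectation (W n) / scale n)\<^sup>2 =
      variance (\<lambda>m. real_of_int (Z n m)) / (real n * ln (real n))"
    using eventually_ge_at_top[of 1]
    by eventually_elim (simp add: V scale_sq power_divide diff_divide_distrib)
  ultimately show "(\<lambda>n. variance (\<lambda>m. real_of_int (Z n m)) / (real n * ln (real n))) \<longlonglongrightarrow> b\<^sup>2 + K * v"
    by (simp add: Lim_transform_eventually)
qed

end

section \<open>Consequences of 2-regularity, transience, and the uniform form of the tail\<close>

lemma kappa_regular_2_facts:
  assumes "kappa_regular 2 \<alpha>"
  shows "AE p in \<alpha>. 0 < p \<and> p \<le> 1" "integrable \<alpha> rho" "(\<integral>p. rho p \<partial>\<alpha>) < 1"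
proof -
  have prob: "prob_space \<alpha>" and sets [measurable_cong]: "sets \<alpha> = sets borel" and unit: "AE p in \<alpha>. p \<in> {0..1}"
    and neg: "ext_expectation \<alpha> log_rho < 0" and moment: "rho_moment \<alpha> 2 = 1"
    using assms by (auto simp: kappa_regular_def)
  interpret prob_space \<alpha> by (rule prob)
  have [measurable]: "rho \<in> borel_measurable \<alpha>"
    unfolding rho_def[abs_def] by measurable
  have "AE p in \<alpha>. (if p = 0 then \<infinity> else ennreal (rho p powr 2)) \<noteq> \<infinity>"
    by (rule nn_integral_PInf_AE) (use moment in \<open>auto simp: rho_moment_def\<close>)
  with unit show pos: "AE p in \<alpha>. 0 < p \<and> p \<le> 1"
    by eventually_elim (auto split: if_splits)
  have nonneg: "AE p in \<alpha>. 0 \<le> rho p"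
    using pos by eventually_elim (simp add: rho_def)
  have "(\<integral>\<^sup>+p. ennreal ((rho p)\<^sup>2) \<partial>\<alpha>) = rho_moment \<alpha> 2"
    unfolding rho_moment_def
  proof (rule nn_integral_cong_AE)
    show "AE p in \<alpha>. ennreal ((rho p)\<^sup>2) = (if p = 0 then \<infinity> else ennreal (rho p powr 2))"
      using pos nonneg by eventually_elim (simp add: powr_numeral)
  qed
  with moment have nn: "(\<integral>\<^sup>+p. ennreal ((rho p)\<^sup>2) \<partial>\<alpha>) = ennreal 1" by simp
  then have sq: "has_bochner_integral \<alpha> (\<lambda>p. (rho p)\<^sup>2) 1"
    by (intro has_bochner_integral_nn_integral) auto
  then have sq_int: "integrable \<alpha> (\<lambda>p. (rho p)\<^sup>2)" and sq_eq: "(\<integral>p. (rho p)\<^sup>2 \<partial>\<alpha>) = 1"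
    by (auto simp: has_bochner_integral_iff)
  show int: "integrable \<alpha> rho"
    by (rule square_integrable_imp_integrable[OF _ sq_int]) measurable
  let ?q = "\<integral>p. rho p \<partial>\<alpha>"
  \<comment> \<open>With second moment 1, the mean q is at most 1 because this square is
    nonnegative. Equality would force rho = 1 almost surely, so that log rho vanishes, against the
    negative drift.\<close>
  have dev: "(\<integral>p. (rho p - 1) ^ 2 \<partial>\<alpha>) = 2 * (1 - ?q)"
    using int sq_int sq_eq by (simp add: power2_diff prob_space)
  moreover have "0 \<le> (\<integral>p. (rho p - 1) ^ 2 \<partial>\<alpha>)" by simp
  moreover have "?q \<noteq> 1"
  proof
    assume "?q = 1"
    have "integrable \<alpha> (\<lambda>p. (rho p - 1) ^ 2)"
      using int sq_int by (simp add: power2_diff)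
    then have "AE p in \<alpha>. (rho p - 1) ^ 2 = 0"
      using integral_nonneg_eq_0_iff_AE[of \<alpha> "\<lambda>p. (rho p - 1) ^ 2"] dev \<open>?q = 1\<close> by simp
    with pos have zero: "AE p in \<alpha>. log_rho p = 0"
      by eventually_elim (auto simp: log_rho_def rho_def zero_ereal_def)
    have "(\<integral>\<^sup>+p. e2ennreal (log_rho p) \<partial>\<alpha>) = (\<integral>\<^sup>+p. 0 \<partial>\<alpha>)"
      "(\<integral>\<^sup>+p. e2ennreal (- log_rho p) \<partial>\<alpha>) = (\<integral>\<^sup>+p. 0 \<partial>\<alpha>)"
      by (rule nn_integral_cong_AE, use zero in eventually_elim, simp add: e2ennreal_neg)+
    then have "ext_expectation \<alpha> log_rho = 0"
      by (simp add: ext_expectation_def)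
    with neg show False by simp
  qed
  ultimately show "?q < 1" by simp
qed


text \<open>A walk that stays below b is at distance at least n v - b from n v, which is of larger
  order than the scale sqrt (n log n); so tightness gives this event a probability below every
  \<delta>.\<close>

lemma (in rwre_walk) AE_reach_of_tight:
  assumes "0 < v"
    and tight: "\<And>\<delta>. 0 < \<delta> \<Longrightarrow> \<exists>C n0. \<forall>n\<ge>n0.
      \<P>(m in M. C * sqrt (real n * ln (real n)) < \<bar>real_of_int (Z n m) - real n * v\<bar>) \<le> \<delta>"
  shows "AE m in M. \<forall>b. \<exists>k. b \<le> Z k m"
  unfolding AE_all_countable
proof
  fix b
  have small: "\<P>(m in M. \<forall>k. Z k m < b) \<le> \<delta>" if \<delta>: "0 < \<delta>" for \<delta>
  proof -
    obtain C n0 where C: "\<And>n. n \<ge> n0 \<Longrightarrow>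
        \<P>(m in M. C * sqrt (real n * ln (real n)) < \<bar>real_of_int (Z n m) - real n * v\<bar>) \<le> \<delta>"
      using tight[OF \<delta>] by blast
    have "\<forall>\<^sub>F n in sequentially. C * sqrt (real n * ln (real n)) \<le> real n * v - real_of_int b"
      using \<open>0 < v\<close> by real_asymp
    then have "\<forall>\<^sub>F n in sequentially. n \<ge> n0 \<and> C * sqrt (real n * ln (real n)) \<le> real n * v - real_of_int b"
      using eventually_ge_at_top[of n0] by eventually_elim auto
    then obtain n where n: "n \<ge> n0" "C * sqrt (real n * ln (real n)) \<le> real n * v - real_of_int b"
      using eventually_happens'[OF sequentially_bot] by blast
    have [measurable]: "(\<lambda>m. real_of_int (Z n m)) \<in> borel_measurable M"
      by (rule measurable_compose[OF measurable_Z]) simp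
    have "\<P>(m in M. \<forall>k. Z k m < b) \<le>
        \<P>(m in M. C * sqrt (real n * ln (real n)) < \<bar>real_of_int (Z n m) - real n * v\<bar>)"
    proof (rule finite_measure_mono)
      show "{m \<in> space M. \<forall>k. Z k m < b} \<subseteq>
          {m \<in> space M. C * sqrt (real n * ln (real n)) < \<bar>real_of_int (Z n m) - real n * v\<bar>}"
      proof safe
        fix m assume "\<forall>k. Z k m < b"
        then have "real_of_int (Z n m) < real_of_int b" by simp
        with n(2) show "C * sqrt (real n * ln (real n)) < \<bar>real_of_int (Z n m) - real n * v\<bar>"
          by linarith
      qed
    qed measurable
    with C[OF n(1)] show ?thesis by linarith
  qed
  have "\<P>(m in M. \<forall>k. Z k m < b) \<le> 0"
  proof (rule field_le_epsilon)
    fix e :: real assume "0 < e"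
    from small[OF this] show "\<P>(m in M. \<forall>k. Z k m < b) \<le> 0 + e" by simp
  qed
  then have "\<P>(m in M. \<forall>k. Z k m < b) = 0"
    by (intro order_antisym measure_nonneg)
  then have "AE m in M. \<not> (\<forall>k. Z k m < b)"
    by (subst (asm) prob_Collect_eq_0) measurable
  then show "AE m in M. \<exists>k. b \<le> Z k m"
    by eventually_elim (auto simp: not_less)
qed

text \<open>On a set that is not bounded above, the supremum of reals is a junk value, so boundedness has to be
  checked before the supremum gives pointwise information.\<close>

lemma tail_of_SUP_tendsto:
  fixes p :: "nat \<Rightarrow> real \<Rightarrow> real"
  assumes p: "\<And>n x. 0 \<le> p n x" "\<And>n x. p n x \<le> 1" and "0 < v" "0 < \<epsilon>"
    and lim: "(\<lambda>n. SUP x \<in> {sqrt (real n) * ln (real n) ^ 3 .. real n * v - ln (real n)}.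
        \<bar>p n x / ((real n * v - x) * x powi (-2)) - K\<bar>) \<longlonglongrightarrow> 0"
  shows "\<exists>n0. \<forall>n\<ge>n0. \<forall>x\<in>{sqrt (real n) * ln (real n) ^ 3 .. real n * v - ln (real n)}.
    \<bar>p n x - K * ((real n * v - x) / x\<^sup>2)\<bar> \<le> \<epsilon> * ((real n * v - x) / x\<^sup>2)"
proof -
  let ?I = "\<lambda>n. {sqrt (real n) * ln (real n) ^ 3 .. real n * v - ln (real n)}"
  let ?h = "\<lambda>n x. \<bar>p n x / ((real n * v - x) * x powi (-2)) - K\<bar>"
  have "\<forall>\<^sub>F n in sequentially. (SUP x \<in> ?I n. ?h n x) < \<epsilon>"
    using lim \<open>0 < \<epsilon>\<close> by (rule order_tendstoD(2))
  moreover have "\<forall>\<^sub>F n in sequentially. 1 \<le> ln (real n)" by real_asymp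
  moreover have "\<forall>\<^sub>F n in sequentially. 0 < sqrt (real n) * ln (real n) ^ 3" by real_asymp
  ultimately have "\<forall>\<^sub>F n in sequentially. \<forall>x\<in>?I n. \<bar>p n x - K * ((real n * v - x) / x\<^sup>2)\<bar> \<le> \<epsilon> * ((real n * v - x) / x\<^sup>2)"
  proof eventually_elim
    case (elim n)
    have D: "0 < x" "0 < (real n * v - x) / x\<^sup>2" "1 / (real n * v) ^ 2 \<le> (real n * v - x) / x\<^sup>2" "0 < real n * v"
      "(real n * v - x) * x powi (-2) = (real n * v - x) / x\<^sup>2"
      if "x \<in> ?I n" for x
    proof -
      show x: "0 < x" using that elim(3) by simp
      have w: "1 \<le> real n * v - x" using that elim(2) by simp
      with x show nv: "0 < real n * v" by linarith
      show "0 < (real n * v - x) / x\<^sup>2" using x w by simp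
      show "1 / (real n * v) ^ 2 \<le> (real n * v - x) / x\<^sup>2"
        using x w nv by (intro frac_le power_mono) auto
      show "(real n * v - x) * x powi (-2) = (real n * v - x) / x\<^sup>2"
        by (simp add: power_int_minus divide_inverse)
    qed
    \<comment> \<open>On the range, n v - x >= ln n >= 1 and x <= n v keep the weight above 1 / (n
      v)^2, so the quotients are bounded by (n v)^2.\<close>
    have "bdd_above (?h n ` ?I n)"
    proof (rule bdd_aboveI2)
      fix x assume x: "x \<in> ?I n"
      let ?d = "(real n * v - x) / x\<^sup>2"
      have "p n x / ?d \<le> 1 / (1 / (real n * v) ^ 2)"
        by (rule frac_le[OF zero_le_one p(2) _ D(3)[OF x]]) (intro divide_pos_pos zero_less_power D(4)[OF x] zero_less_one)
      moreover have "0 \<le> p n x / ?d" by (rule divide_nonneg_nonneg[OF p(1) less_imp_le[OF D(2)[OF x]]])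
      ultimately show "?h n x \<le> (real n * v) ^ 2 + \<bar>K\<bar>"
        unfolding D(5)[OF x] by simp
    qed
    then have h: "?h n x < \<epsilon>" if "x \<in> ?I n" for x
      by (rule le_less_trans[OF cSUP_upper[OF that] elim(1)])
    show ?case
    proof
      fix x assume x: "x \<in> ?I n"
      define d where "d = (real n * v - x) / x\<^sup>2"
      have d: "0 < d" "\<bar>p n x / d - K\<bar> < \<epsilon>"
        using D(2)[OF x] h[OF x] unfolding D(5)[OF x] d_def by auto
      then have "p n x - K * d = (p n x / d - K) * d"
        by (simp add: left_diff_distrib)
      then have "\<bar>p n x - K * d\<bar> = \<bar>p n x / d - K\<bar> * d"
        using d by (simp add: abs_mult)
      also have "\<dots> \<le> \<epsilon> * d"
        using d by (intro mult_right_mono) auto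
      finally show "\<bar>p n x - K * ((real n * v - x) / x\<^sup>2)\<bar> \<le> \<epsilon> * ((real n * v - x) / x\<^sup>2)"
        unfolding d_def .
    qed
  qed
  then show ?thesis by (simp add: eventually_sequentially)
qed

theorem corollary1p15:
  fixes \<alpha> :: "real measure"
    and M :: "'a measure"
    and \<omega> :: "'a \<Rightarrow> int \<Rightarrow> real"
    and Z :: "nat \<Rightarrow> 'a \<Rightarrow> int"
    and v b K\<^sub>0 :: real
  assumes regular: "kappa_regular 2 \<alpha>"
    and walk: "rwre \<alpha> M \<omega> Z"
    and v_def: "v = speed \<alpha>"
    and b_pos: "b > 0"
    and b_clt: "weak_conv_m
      (\<lambda>n. distr M borel (\<lambda>m. (real_of_int (Z n m) - real n * v) / (b * sqrt (real n * ln (real n)))))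
      std_normal_distribution"
    and K_pos: "K\<^sub>0 > 0"
    and K_tail: "(\<lambda>n. SUP x \<in> {sqrt (real n) * ln (real n) ^ 3 .. real n * v - ln (real n)}.
        \<bar>measure M {m \<in> space M. real_of_int (Z n m) - real n * v < - x}
           / ((real n * v - x) * x powi (-2)) - K\<^sub>0\<bar>) \<longlonglongrightarrow> 0"
  shows "(\<lambda>n. (prob_space.expectation M (\<lambda>m. real_of_int (Z n m)) - real n * v)
              / sqrt (real n * ln (real n))) \<longlonglongrightarrow> 0
       \<and> (\<lambda>n. prob_space.variance M (\<lambda>m. real_of_int (Z n m)) / (real n * ln (real n)))
           \<longlonglongrightarrow> b\<^sup>2 + K\<^sub>0 * v"
proof -
  \<comment> \<open>A separate first stage: transience, an assumption of the later locales, is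
    proved in this context once tightness has been extracted from the central limit theorem.\<close>
  interpret walk: rwre_walk \<alpha> M \<omega> Z
  proof (rule rwre_walk.intro)
    show "rwre \<alpha> M \<omega> Z" by (rule walk)
    show "prob_space \<alpha>" "sets \<alpha> = sets borel"
      using regular unfolding kappa_regular_def by blast+
  qed (fact kappa_regular_2_facts[OF regular])+
  have v: "0 < v" "v \<le> 1"
    using walk.mean_rho_nonneg walk.mean_rho_less_1 by (simp_all add: v_def speed_def)
  let ?W = "\<lambda>n m. real_of_int (Z n m) - real n * v"
  have mW: "?W n \<in> borel_measurable M" for n
    by (intro borel_measurable_diff borel_measurable_const measurable_compose[OF walk.measurable_Z]) simp
  have tight: "\<exists>C n0. \<forall>n\<ge>n0. walk.prob {m \<in> space M. C * sqrt (real n * ln (real n)) < \<bar>?W n m\<bar>} \<le> \<delta>"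
    if "0 < \<delta>" for \<delta>
  proof -
    have "(\<lambda>m. ?W n m / (b * sqrt (real n * ln (real n)))) \<in> borel_measurable M" for n
      using mW by (rule borel_measurable_divide) simp
    from walk.weak_conv_std_normal_tight[OF this b_clt that]
    obtain C where C: "0 < C" "\<forall>\<^sub>F n in sequentially.
        walk.prob {m \<in> space M. C < \<bar>?W n m / (b * sqrt (real n * ln (real n)))\<bar>} \<le> \<delta>"
      by blast
    have "\<forall>\<^sub>F n in sequentially. walk.prob {m \<in> space M. (C * b) * sqrt (real n * ln (real n)) < \<bar>?W n m\<bar>} \<le> \<delta>"
      using C(2) eventually_ge_at_top[of 2]
    proof eventually_elim
      case (elim n)
      then have s: "0 < sqrt (real n * ln (real n))" by simp
      have "(C * b) * sqrt (real n * ln (real n)) < \<bar>w\<bar> \<longleftrightarrow> C < \<bar>w / (b * sqrt (real n * ln (real n)))\<bar>" for w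
        using s b_pos by (simp add: abs_divide abs_mult pos_less_divide_eq mult.assoc)
      then show ?case using elim(1) by simp
    qed
    then show ?thesis unfolding eventually_sequentially by blast
  qed
  interpret clt: rwre_clt \<alpha> M \<omega> Z v K\<^sub>0 b
  proof unfold_locales
    show "AE m in M. \<forall>b. \<exists>k. b \<le> Z k m"
      by (rule walk.AE_reach_of_tight[OF v(1) tight])
    show "\<exists>n0. \<forall>n\<ge>n0. \<forall>x\<in>{sqrt (real n) * ln (real n) ^ 3 .. real n * v - ln (real n)}.
        \<bar>walk.prob {m \<in> space M. ?W n m < - x} - K\<^sub>0 * ((real n * v - x) / x\<^sup>2)\<bar>
          \<le> \<epsilon> * ((real n * v - x) / x\<^sup>2)" if "0 < \<epsilon>" for \<epsilon>
      using v(1) that K_tail by (intro tail_of_SUP_tendsto) auto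
    show "0 \<le> K\<^sub>0" using K_pos by simp
  qed (fact v b_pos b_clt tight)+
  show ?thesis
    using clt.mean_and_variance by blast
qed

end
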